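(* Let $k\ge 1$, let $f:[0,1]\times\mathbb{R}^{k}\to\mathbb{R}^{k}$ be continuous, let $g=(g^{1},\ldots,g^{k}):[0,1]\to\mathbb{R}^{k}$ have bounded variation, and let $h:\mathbb{R}^{k}\to\mathbb{R}^{k}$ be continuous. Assume that $g(0^{+})\neq g(0)$ and $$\lim_{\varepsilon\to 0^{+}}\operatorname{var}(g,[\varepsilon,1])\leq\min_{1\le j\leq k}|g^{j}(0^{+})-g^{j}(0)|.$$ Suppose there exists $R>0$ such that the following two conditions hold. (i) $\langle f(t,x),x\rangle\leq 0$ for all $t\in(0,1]$ and all $x\in\mathbb{R}^{k}$ with $|x|=R$. (ii) With $$r_{-}:=R\Big(\min_{1\le j\leq k}|g^{j}(0^{+})-g^{j}(0)|-\lim_{\varepsilon\to 0^{+}}\operatorname{var}(g,[\varepsilon,1])\Big),$$ $$r_{+}:=R\Big(|g(0^{+})-g(0)|+\lim_{\varepsilon\to 0^{+}}\operatorname{var}(g,[\varepsilon,1])\Big),$$ one has $h(x)\neq 0$ for all $x\in\mathbb{R}^{k}$ with $r_{-}<|x|\leq r_{+}$, and for some $r\in(r_{-},r_{+}]$ the Brouwer degree $\deg(h,B_{\mathbb{R}^{k}}(0,r),0)$ is defined and is nonzero. Then the boundary value problem $$x'(t)=f(t,x(t))\quad (t\in[0,1]),\qquad h\Big(\int_{0}^{1}x(s)\,dg(s)\Big)=0$$ has at least one solution $x\in C^{1}([0,1],\mathbb{R}^{k})$.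
   Context: $\langle\cdot,\cdot\rangle$ and $|\cdot|$ denote the Euclidean inner product and norm on $\mathbb{R}^{k}$ (and $|\cdot|$ is the absolute value on $\mathbb{R}$); superscripts denote coordinates. $B_{\mathbb{R}^{k}}(0,r)$ is the open ball of radius $r$ centred at $0$. $g(0^{+})=\lim_{s\to 0^{+}}g(s)$ and $g^{j}(0^{+})=\lim_{s\to 0^{+}}g^{j}(s)$. For $g:[a,b]\to\mathbb{R}^{k}$, $\operatorname{var}(g,[a,b])$ is the total variation: the supremum of $\sum_{i=1}^{n}|g(s_{i})-g(s_{i-1})|$ over all partitions $a=s_{0}<\ldots<s_{n}=b$. The integral with respect to $g$ is the coordinatewise Riemann–Stieltjes integral: $$\int_{0}^{1}x(s)\,dg(s)=\Big(\int_{0}^{1}x^{1}(s)\,dg^{1}(s),\ldots,\int_{0}^{1}x^{k}(s)\,dg^{k}(s)\Big)\in\mathbb{R}^{k}.$$ The Brouwer degree $\deg(h,B_{\mathbb{R}^{k}}(0,r),0)$ is defined when $h$ has no zero on $\partial B_{\mathbb{R}^{k}}(0,r)$. *)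

theory Defs
  imports "HOL-Analysis.Analysis"
begin

definition partition_points :: "real \<Rightarrow> real \<Rightarrow> nat \<Rightarrow> (nat \<Rightarrow> real) \<Rightarrow> bool" where
  "partition_points a b n s \<longleftrightarrow> s 0 = a \<and> s n = b \<and> (\<forall>i<n. s i < s (Suc i))"

definition variation_sums :: "(real \<Rightarrow> 'a::real_normed_vector) \<Rightarrow> real \<Rightarrow> real \<Rightarrow> real set" where
  "variation_sums g a b =
     {\<Sum>i<n. norm (g (s (Suc i)) - g (s i)) | n s. partition_points a b n s}"

definition bounded_variation_on :: "(real \<Rightarrow> 'a::real_normed_vector) \<Rightarrow> real \<Rightarrow> real \<Rightarrow> bool" where
  "bounded_variation_on g a b \<longleftrightarrow> bdd_above (variation_sums g a b)"

text \<open>As a real supremum, this is meaningful only if \<open>a \<le> b\<close> and \<open>bounded_variation_on g a b\<close>.\<close>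

definition total_variation :: "(real \<Rightarrow> 'a::real_normed_vector) \<Rightarrow> real \<Rightarrow> real \<Rightarrow> real" where
  "total_variation g a b = Sup (variation_sums g a b)"

text \<open>The Riemann--Stieltjes integral as the limit of tagged sums when the mesh tends to zero.\<close>

definition has_rs_integral ::
    "(real \<Rightarrow> real) \<Rightarrow> (real \<Rightarrow> real) \<Rightarrow> real \<Rightarrow> real \<Rightarrow> real \<Rightarrow> bool" where
  "has_rs_integral u g a b I \<longleftrightarrow>
     (\<forall>\<epsilon>>0. \<exists>\<delta>>0. \<forall>n s \<xi>.
        partition_points a b n s \<longrightarrow>
        (\<forall>i<n. s (Suc i) - s i < \<delta> \<and> \<xi> i \<in> {s i..s (Suc i)}) \<longrightarrow>
        \<bar>(\<Sum>i<n. u (\<xi> i) * (g (s (Suc i)) - g (s i))) - I\<bar> < \<epsilon>)"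

definition has_rs_integral_vec ::
    "(real \<Rightarrow> real^'k) \<Rightarrow> (real \<Rightarrow> real^'k) \<Rightarrow> real \<Rightarrow> real \<Rightarrow> real^'k \<Rightarrow> bool" where
  "has_rs_integral_vec x g a b I \<longleftrightarrow>
     (\<forall>j. has_rs_integral (\<lambda>s. x s $ j) (\<lambda>s. g s $ j) a b (I $ j))"

text \<open>
  The analytic Brouwer degree of \<open>h\<close> on a bounded open set \<open>U\<close> at \<open>y\<close>, for \<open>h\<close> continuous on
  \<open>closure U\<close> with no solution of \<open>h x = y\<close> on \<open>frontier U\<close>: the common value of
  \<open>\<Sum>x \<in> U \<inter> \<phi> -` {y}. sgn (det (\<phi>' x))\<close> over all maps \<open>\<phi>\<close> of class \<open>C\<^sup>1\<close> that are
  uniformly close enough to \<open>h\<close> and have \<open>y\<close> as a regular value. Such \<open>\<phi>\<close> exist arbitrarily close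
  to \<open>h\<close> (Weierstrass, Sard), and by homotopy invariance the sum no longer depends on \<open>\<phi>\<close> once the
  distance is below that of \<open>y\<close> to \<open>h ` frontier U\<close>; the sum is then finite.
  Outside this setting the value is unspecified.
\<close>

definition regular_C1_map ::
    "(real^'k \<Rightarrow> real^'k) \<Rightarrow> (real^'k \<Rightarrow> real^'k^'k) \<Rightarrow> (real^'k) set \<Rightarrow> real^'k \<Rightarrow> bool" where
  "regular_C1_map \<phi> \<phi>' U y \<longleftrightarrow>
     continuous_on (closure U) \<phi> \<and>
     (\<forall>x\<in>U. (\<phi> has_derivative (\<lambda>v. \<phi>' x *v v)) (at x)) \<and>
     continuous_on U \<phi>' \<and>
     (\<forall>x\<in>U. \<phi> x = y \<longrightarrow> det (\<phi>' x) \<noteq> 0)"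

definition brouwer_degree ::
    "(real^'k \<Rightarrow> real^'k) \<Rightarrow> (real^'k) set \<Rightarrow> real^'k \<Rightarrow> int" where
  "brouwer_degree h U y =
     (THE d. \<exists>\<epsilon>>0. \<forall>\<phi> \<phi>'.
        regular_C1_map \<phi> \<phi>' U y \<longrightarrow>
        (\<forall>x\<in>closure U. norm (\<phi> x - h x) < \<epsilon>) \<longrightarrow>
        real_of_int d = (\<Sum>x | x \<in> U \<and> \<phi> x = y. sgn (det (\<phi>' x))))"

definition brouwer_degree_defined ::
    "(real^'k \<Rightarrow> real^'k) \<Rightarrow> (real^'k) set \<Rightarrow> real^'k \<Rightarrow> bool" where
  "brouwer_degree_defined h U y \<longleftrightarrow>
     open U \<and> bounded U \<and> continuous_on (closure U) h \<and> (\<forall>x\<in>frontier U. h x \<noteq> y)"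

text \<open>
  \<open>g(0\<^sup>+) - g(0)\<close> and \<open>lim var(g, [\<epsilon>, 1])\<close> as \<open>\<epsilon> \<rightarrow> 0\<^sup>+\<close>; both limits exist for \<open>g\<close> of bounded
  variation on \<open>[0, 1]\<close>.
\<close>

definition jump0 :: "(real \<Rightarrow> real^'k) \<Rightarrow> real^'k" where
  "jump0 g = Lim (at_right 0) g - g 0"

definition var0 :: "(real \<Rightarrow> real^'k) \<Rightarrow> real" where
  "var0 g = Lim (at_right 0) (\<lambda>\<epsilon>. total_variation g \<epsilon> 1)"

end

theory Submission
  imports Defs "HOL-Complex_Analysis.Great_Picard"
begin

text \<open>
  Let \<open>X\<^sub>n(c)\<close> be Tonelli's delayed approximate solution of \<open>x' = f(t, x)\<close>, \<open>x(0) = c\<close>, where \<open>f\<close> is first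
  composed with the radial projection onto the ball of radius \<open>R\<close>; it depends continuously on \<open>c\<close>,
  and by (i) limits of such functions with \<open>|c| \<le> R\<close> solve the original equation. Put
  \<open>P\<^sub>n(c, \<lambda>) = c J + \<lambda> S\<^sub>n(c)\<close>, where \<open>J\<close> is the jump of \<open>g\<close> at \<open>0\<close> (with coordinatewise product) and \<open>S\<^sub>n(c)\<close>
  a Riemann--Stieltjes sum of \<open>X\<^sub>n(c)\<close> without its first term. If the boundary value problem has no solution, a
  compactness argument and (ii) yield an \<open>n\<close> such that \<open>h(P\<^sub>n(c, \<lambda>)) \<noteq> 0\<close> for \<open>|c| = R\<close>, \<open>\<lambda> \<in> [0, 1]\<close>, and for
  \<open>|c| \<le> R\<close>, \<open>\<lambda> = 1\<close>. Hence \<open>c \<mapsto> h(c J)\<close> is nullhomotopic on the sphere of radius \<open>R\<close> as a map into the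
  nonzero vectors, and by (ii) so is \<open>h\<close> on the sphere of radius \<open>r\<close>; equivalently, \<open>h\<close> has a nonvanishing
  extension from that sphere to the ball. This forces the degree to vanish: the signed count of zeros of a regular
  map \<open>\<phi>\<close> near \<open>h\<close> is, up to a positive constant, the integral of \<open>w(\<phi>) det \<phi>'\<close> with \<open>w\<close> a bump at \<open>0\<close>, and
  this integral does not change when \<open>\<phi>\<close> is replaced in the interior by a nonvanishing map.
\<close>

section \<open>The integral of \<open>w(\<phi>) det \<phi>'\<close>\<close>

text \<open>As \<open>f\<close> is merely continuous, an initial value may have many solutions, so
  there is no solution map to build a homotopy from; the delayed equations are solved by successive
  integration and supply one. Let v be the limit of the variations and m the least |J^j|. The mass
  of \<open>g\<close> at 0 sees only x(0) = c, and the rest of the integral has norm at most R v.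
  For |c| = R one has R m \<le> |c J| \<le> R |J|. So if \<lambda> < 1 and v > 0, scaling the rest
  by \<lambda> puts every limit point z of P_n strictly outside radius r_- and within r_+, where h
  has no zero. If \<lambda> = 1 or v = 0, z may lie on or inside the inner sphere, but then z is the
  integral of a true solution and the assumed unsolvability applies. If m = 0, the map c \<mapsto> c
  J cannot be inverted; then v = 0 and r_- = 0, and a solution starting at 0 settles the case. On
  the degree side a single comparison suffices: every regular map near h is counted against one
  fixed zero-free C^1 map.\<close>

definition C1_on :: "(real^'n) set \<Rightarrow> (real^'n \<Rightarrow> real^'n) \<Rightarrow> (real^'n \<Rightarrow> real^'n^'n) \<Rightarrow> bool" where
  "C1_on S \<phi> \<phi>' \<longleftrightarrow> (\<forall>x\<in>S. (\<phi> has_derivative (*v) (\<phi>' x)) (at x)) \<and> continuous_on S \<phi>'"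

lemma C1_on_continuous: "C1_on S \<phi> \<phi>' \<Longrightarrow> continuous_on S \<phi>"
  unfolding C1_on_def by (meson continuous_at_imp_continuous_on has_derivative_continuous)

lemma C1_on_subset: "C1_on T \<phi> \<phi>' \<Longrightarrow> S \<subseteq> T \<Longrightarrow> C1_on S \<phi> \<phi>'"
  unfolding C1_on_def using continuous_on_subset by blast

lemma C1_on_add: "C1_on S \<phi> \<phi>' \<Longrightarrow> C1_on S \<psi> \<psi>' \<Longrightarrow> C1_on S (\<lambda>x. \<phi> x + \<psi> x) (\<lambda>x. \<phi>' x + \<psi>' x)"
  unfolding C1_on_def
  by (auto intro!: continuous_intros has_derivative_eq_rhs[OF has_derivative_add]
      simp: matrix_vector_mult_add_rdistrib)

lemma C1_on_scaleR: "C1_on S \<phi> \<phi>' \<Longrightarrow> C1_on S (\<lambda>x. a *\<^sub>R \<phi> x) (\<lambda>x. a *\<^sub>R \<phi>' x)"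
  unfolding C1_on_def
  by (auto intro!: continuous_intros has_derivative_eq_rhs[OF has_derivative_scaleR_right]
      simp: scaleR_matrix_vector_assoc)

lemma C1_on_id: "C1_on S (\<lambda>x. x) (\<lambda>x. mat 1)" for S :: "(real^'n) set"
  proof -
  have "(*v) (mat 1) = (\<lambda>x :: real^'n. x)" by (simp add: fun_eq_iff)
  then show ?thesis unfolding C1_on_def by (simp add: has_derivative_ident)
qed

lemma continuous_on_det [continuous_intros]:
  fixes A :: "'a::topological_space \<Rightarrow> real^'n^'n"
  assumes "continuous_on S A"
  shows "continuous_on S (\<lambda>x. det (A x))"
  unfolding det_def by (intro continuous_intros assms)

lemma det_scaleR: "det (c *\<^sub>R A) = c ^ CARD('n) * det A" for A :: "real^'n^'n"
  unfolding det_def by (simp add: prod.distrib sum_distrib_left mult_ac)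

lemma absolutely_integrable_continuous_compact:
  fixes f :: "'a::euclidean_space \<Rightarrow> 'b::euclidean_space"
  assumes "compact S" "continuous_on S f"
  shows "f absolutely_integrable_on S"
  using borel_integrable_compact[OF assms]
  unfolding set_integrable_def by (auto intro!: integrable_completion[THEN iffD2])

lemma integrable_continuous_compact:
  fixes f :: "'a::euclidean_space \<Rightarrow> 'b::euclidean_space"
  assumes "compact S" "continuous_on S f"
  shows "f integrable_on S"
  using absolutely_integrable_continuous_compact[OF assms] set_lebesgue_integral_eq_integral(1) by blast

lemma integral_change_of_variables:
  fixes \<phi> :: "real^'n::{finite,wellorder} \<Rightarrow> real^'n::_" and w :: "real^'n::_ \<Rightarrow> real"
  assumes S: "compact S" and C1: "C1_on S \<phi> \<phi>'" and inj: "inj_on \<phi> S" and w: "continuous_on (\<phi> ` S) w"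
  shows "integral S (\<lambda>x. \<bar>det (\<phi>' x)\<bar> * w (\<phi> x)) = integral (\<phi> ` S) w"
proof -
  \<comment> \<open>The substitution rule is stated for values in a space of vectors, so
    \<open>w\<close> is read as a map into \<open>real^1\<close>.\<close>
  define W :: "real^'n::_ \<Rightarrow> real^1" where "W = (\<lambda>y. vec (w y))"
  have cW: "continuous_on (\<phi> ` S) W"
    unfolding W_def vec_def using w by (intro continuous_intros)
  have cpt: "compact (\<phi> ` S)"
    using S C1_on_continuous[OF C1] compact_continuous_image by blast
  have der: "(\<phi> has_derivative (*v) (\<phi>' x)) (at x within S)" if "x \<in> S" for x
    using C1 that has_derivative_at_withinI unfolding C1_on_def by blast
  have W: "W absolutely_integrable_on \<phi> ` S"
    using absolutely_integrable_continuous_compact[OF cpt cW] .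
  have *: "(\<lambda>x. \<bar>det (matrix ((*v) (\<phi>' x)))\<bar> *\<^sub>R W (\<phi> x)) absolutely_integrable_on S \<and>
     integral S (\<lambda>x. \<bar>det (matrix ((*v) (\<phi>' x)))\<bar> *\<^sub>R W (\<phi> x)) = integral (\<phi> ` S) W"
    using has_absolute_integral_change_of_variables_compact[OF S der inj] W by blast
  have "integral S (\<lambda>x. \<bar>det (\<phi>' x)\<bar> *\<^sub>R W (\<phi> x)) $ 1 = integral (\<phi> ` S) W $ 1"
    using * by simp
  moreover have "(\<lambda>x. \<bar>det (\<phi>' x)\<bar> *\<^sub>R W (\<phi> x)) integrable_on S"
    using * set_lebesgue_integral_eq_integral(1) by fastforce
  moreover have "W integrable_on \<phi> ` S"
    using W set_lebesgue_integral_eq_integral(1) by blast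
  ultimately have "integral S (\<lambda>x. (\<bar>det (\<phi>' x)\<bar> *\<^sub>R W (\<phi> x)) $ 1) = integral (\<phi> ` S) (\<lambda>y. W y $ 1)"
    by (simp only: integral_component_eq_cart)
  then show ?thesis by (simp add: W_def)
qed

text \<open>By invariance of domain \<open>v\<close> maps the open ball to an open set, whose
  frontier lies in the common image of the sphere. The connected set \<open>u\<close> ball 0
  r\<open>avoids that image by injectivity of\<close>u\<open>and meets\<close>v
  \<open>ball 0 r\<close> at a point of the shell, so it cannot leave it.\<close>

lemma image_cball_subset_of_boundary_eq:
  fixes u v :: "'a::euclidean_space \<Rightarrow> 'a"
  assumes u: "continuous_on (cball 0 r) u" "inj_on u (cball 0 r)"
    and v: "continuous_on (cball 0 r) v" "inj_on v (cball 0 r)"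
    and eq: "\<And>x. x \<in> cball 0 r \<Longrightarrow> \<rho> \<le> norm x \<Longrightarrow> u x = v x"
    and \<rho>: "\<rho> < r" "0 < r"
  shows "u ` cball 0 r \<subseteq> v ` cball 0 r"
proof -
  have opn: "open (v ` ball 0 r)"
    using invariance_of_domain_ball[OF v(1) \<rho>(2) v(2)] .
  have sphere_eq: "u ` sphere 0 r = v ` sphere 0 r"
    using eq \<rho> by (intro image_cong) auto
  have dec: "cball 0 r = ball 0 r \<union> sphere (0::'a) r"
    by auto
  have "closure (v ` ball 0 r) \<subseteq> v ` cball 0 r"
    by (intro closure_minimal image_mono ball_subset_cball compact_imp_closed
        compact_continuous_image[OF v(1)] compact_cball)
  then have fr: "frontier (v ` ball 0 r) \<subseteq> v ` sphere 0 r"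
    unfolding frontier_def using opn dec by (auto simp: interior_open)
  have conn: "connected (u ` ball 0 r)"
    by (rule connected_continuous_image) (auto intro: continuous_on_subset[OF u(1)])
  \<comment> \<open>A point in the middle of the shell where \<open>u\<close> and \<open>v\<close>
    agree; the maximum covers negative \<open>\<rho>\<close>.\<close>
  obtain e :: 'a where e: "norm e = max \<rho> 0 / 2 + r / 2"
    using vector_choose_size[of "max \<rho> 0 / 2 + r / 2"] \<rho> by auto
  then have "norm e < r" "\<rho> \<le> norm e" using \<rho> by auto
  then have "u e \<in> u ` ball 0 r \<inter> v ` ball 0 r"
    using eq[of e] by (metis IntI ball_subset_cball imageI mem_ball_0 subsetD)
  moreover have "u ` ball 0 r \<inter> u ` sphere 0 r = {}"
    using u(2) unfolding inj_on_def by fastforce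
  ultimately have "u ` ball 0 r \<subseteq> v ` ball 0 r"
    using connected_Int_frontier[OF conn, of "v ` ball 0 r"] fr sphere_eq by blast
  then show ?thesis using sphere_eq unfolding dec image_Un by blast
qed

text \<open>The derivative is bounded on the ball, so for small \<open>a\<close> the map
  \<open>a *\<^sub>R \<phi>\<close> is a contraction and adding it to the identity keeps
  injectivity. The determinant is uniformly continuous in \<open>(a, x)\<close> and equals 1 at
  \<open>a = 0\<close>.\<close>

lemma perturbed_identity:
  fixes \<phi> :: "real^'n \<Rightarrow> real^'n"
  assumes C1: "C1_on (cball 0 r) \<phi> \<phi>'"
  obtains a0 where "a0 > 0"
    "\<And>a. \<bar>a\<bar> < a0 \<Longrightarrow> inj_on (\<lambda>x. x + a *\<^sub>R \<phi> x) (cball 0 r)"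
    "\<And>a x. \<bar>a\<bar> < a0 \<Longrightarrow> x \<in> cball 0 r \<Longrightarrow> 0 < det (mat 1 + a *\<^sub>R \<phi>' x)"
proof -
  have cont: "continuous_on (cball 0 r) \<phi>'" using C1 unfolding C1_on_def by blast
  have "compact (\<phi>' ` cball 0 r)" using cont compact_cball compact_continuous_image by blast
  then obtain B where B: "B > 0" "\<And>x. x \<in> cball 0 r \<Longrightarrow> norm (\<phi>' x) \<le> B"
    using compact_imp_bounded bounded_pos by (metis imageI)
  \<comment> \<open>Matrix entries bounded by \<open>B\<close> give this bound on the operator
    norm.\<close>
  define L where "L = real CARD('n) * real CARD('n) * B"
  have L: "L > 0" unfolding L_def using B by simp
  have on: "onorm ((*v) (\<phi>' x)) \<le> L" if "x \<in> cball 0 r" for x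
    unfolding L_def
  proof (rule onorm_le_matrix_component)
    fix i j
    have "\<bar>\<phi>' x $ i $ j\<bar> \<le> norm (\<phi>' x $ i)" using component_le_norm_cart .
    also have "\<dots> \<le> norm (\<phi>' x)" using Finite_Cartesian_Product.norm_nth_le .
    finally show "\<bar>\<phi>' x $ i $ j\<bar> \<le> B" using B(2)[OF that] by simp
  qed
  have lip: "norm (\<phi> x - \<phi> y) \<le> L * norm (x - y)" if "x \<in> cball 0 r" "y \<in> cball 0 r" for x y
    by (rule differentiable_bound[OF convex_cball[of 0 r] _ on])
      (use C1 that in \<open>auto simp: C1_on_def intro: has_derivative_at_withinI\<close>)
  have "continuous_on ({-1..1} \<times> cball 0 r) (\<lambda>(a, x). det (mat 1 + a *\<^sub>R \<phi>' x))"
    unfolding case_prod_unfold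
    by (intro continuous_intros continuous_on_compose2[OF cont]) auto
  then have "uniformly_continuous_on ({-1..1} \<times> cball 0 r) (\<lambda>(a, x). det (mat 1 + a *\<^sub>R \<phi>' x))"
    by (intro compact_uniformly_continuous compact_Times) auto
  then obtain d where d: "d > 0" "\<And>p q. p \<in> {-1..1} \<times> cball 0 r \<Longrightarrow> q \<in> {-1..1} \<times> cball 0 r \<Longrightarrow> dist q p < d
      \<Longrightarrow> dist ((\<lambda>(a, x). det (mat 1 + a *\<^sub>R \<phi>' x)) q) ((\<lambda>(a, x). det (mat 1 + a *\<^sub>R \<phi>' x)) p) < 1"
    unfolding uniformly_continuous_on_def by (metis zero_less_one)
  show thesis
  proof
    show "min (min 1 d) (1 / L) > 0" using d L by simp
    fix a :: real assume a: "\<bar>a\<bar> < min (min 1 d) (1 / L)"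
    show "inj_on (\<lambda>x. x + a *\<^sub>R \<phi> x) (cball 0 r)"
    proof (rule inj_onI)
      fix x y assume xy: "x \<in> cball 0 r" "y \<in> cball 0 r" "x + a *\<^sub>R \<phi> x = y + a *\<^sub>R \<phi> y"
      then have "x - y = a *\<^sub>R (\<phi> y - \<phi> x)" by (simp add: algebra_simps)
      then have "norm (x - y) \<le> \<bar>a\<bar> * (L * norm (x - y))"
        using lip[OF xy(2,1)] by (simp add: mult_left_mono norm_minus_commute)
      moreover have "\<bar>a\<bar> * L < 1" using a L by (simp add: pos_less_divide_eq)
      ultimately show "x = y"
        by (metis eq_iff_diff_eq_0 mult.assoc mult_le_cancel_right1 norm_le_zero_iff not_le)
    qed
    fix x :: "real^'n" assume x: "x \<in> cball 0 r"
    have "dist (a, x) (0, x) < d" using a by (simp add: dist_Pair_Pair)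
    moreover have "a \<in> {-1..1}" using a by auto
    ultimately have "dist (det (mat 1 + a *\<^sub>R \<phi>' x)) (det (mat 1 + 0 *\<^sub>R \<phi>' x)) < 1"
      using d(2)[of "(0, x)" "(a, x)"] x by auto
    then show "0 < det (mat 1 + a *\<^sub>R \<phi>' x)" by (simp add: dist_real_def)
  qed
qed

text \<open>Both sides are the integral of \<open>w\<close> over the same image, the determinants
  being positive. It matters that \<open>a0\<close> is chosen before \<open>w\<close>: the weight
  used later is rescaled by \<open>1 / a\<close>.\<close>

lemma integral_perturbed_identity_eq:
  fixes \<phi> \<psi> :: "real^'n::{finite,wellorder} \<Rightarrow> real^'n::_"
  assumes \<phi>: "C1_on (cball 0 r) \<phi> \<phi>'" and \<psi>: "C1_on (cball 0 r) \<psi> \<psi>'"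
    and eq: "\<And>x. x \<in> cball 0 r \<Longrightarrow> \<rho> \<le> norm x \<Longrightarrow> \<phi> x = \<psi> x"
    and \<rho>: "\<rho> < r" "0 < r"
  obtains a0 where "a0 > 0"
    "\<And>a w. \<bar>a\<bar> < a0 \<Longrightarrow> continuous_on UNIV w \<Longrightarrow>
      integral (cball 0 r) (\<lambda>x. w (x + a *\<^sub>R \<phi> x) * det (mat 1 + a *\<^sub>R \<phi>' x)) =
      integral (cball 0 r) (\<lambda>x. w (x + a *\<^sub>R \<psi> x) * det (mat 1 + a *\<^sub>R \<psi>' x))"
proof -
  obtain a1 where a1: "a1 > 0" "\<And>a. \<bar>a\<bar> < a1 \<Longrightarrow> inj_on (\<lambda>x. x + a *\<^sub>R \<phi> x) (cball 0 r)"
    "\<And>a x. \<bar>a\<bar> < a1 \<Longrightarrow> x \<in> cball 0 r \<Longrightarrow> 0 < det (mat 1 + a *\<^sub>R \<phi>' x)"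
    using perturbed_identity[OF \<phi>] by metis
  obtain a2 where a2: "a2 > 0" "\<And>a. \<bar>a\<bar> < a2 \<Longrightarrow> inj_on (\<lambda>x. x + a *\<^sub>R \<psi> x) (cball 0 r)"
    "\<And>a x. \<bar>a\<bar> < a2 \<Longrightarrow> x \<in> cball 0 r \<Longrightarrow> 0 < det (mat 1 + a *\<^sub>R \<psi>' x)"
    using perturbed_identity[OF \<psi>] by metis
  have cov: "integral (cball 0 r) (\<lambda>x. w (x + a *\<^sub>R u x) * det (mat 1 + a *\<^sub>R u' x))
      = integral ((\<lambda>x. x + a *\<^sub>R u x) ` cball 0 r) w"
    if "C1_on (cball 0 r) u u'" "inj_on (\<lambda>x. x + a *\<^sub>R u x) (cball 0 r)"
      "\<And>x. x \<in> cball 0 r \<Longrightarrow> 0 < det (mat 1 + a *\<^sub>R u' x)" "continuous_on UNIV w"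
    for w :: "real^'n::_ \<Rightarrow> real" and a u u'
  proof -
    have "C1_on (cball 0 r) (\<lambda>x. x + a *\<^sub>R u x) (\<lambda>x. mat 1 + a *\<^sub>R u' x)"
      by (intro C1_on_add C1_on_id C1_on_scaleR that)
    from integral_change_of_variables[OF compact_cball this that(2) continuous_on_subset[OF that(4) subset_UNIV]]
    have "integral ((\<lambda>x. x + a *\<^sub>R u x) ` cball 0 r) w
      = integral (cball 0 r) (\<lambda>x. \<bar>det (mat 1 + a *\<^sub>R u' x)\<bar> * w (x + a *\<^sub>R u x))"
      by simp
    also have "\<dots> = integral (cball 0 r) (\<lambda>x. w (x + a *\<^sub>R u x) * det (mat 1 + a *\<^sub>R u' x))"
      using that(3) by (intro Henstock_Kurzweil_Integration.integral_cong) (auto simp: mult.commute abs_of_pos)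
    finally show ?thesis by simp
  qed
  show thesis
  proof
    show "min a1 a2 > 0" using a1 a2 by simp
    fix a and w :: "real^'n::_ \<Rightarrow> real" assume a: "\<bar>a\<bar> < min a1 a2" and w: "continuous_on UNIV w"
    let ?u = "\<lambda>x. x + a *\<^sub>R \<phi> x" and ?v = "\<lambda>x. x + a *\<^sub>R \<psi> x"
    have cu: "continuous_on (cball 0 r) ?u" and cv: "continuous_on (cball 0 r) ?v"
      by (intro continuous_intros C1_on_continuous[OF \<phi>] C1_on_continuous[OF \<psi>])+
    have iu: "inj_on ?u (cball 0 r)" and iv: "inj_on ?v (cball 0 r)"
      using a1(2) a2(2) a by auto
    have "?u ` cball 0 r = ?v ` cball 0 r"
      using image_cball_subset_of_boundary_eq[OF cu iu cv iv _ \<rho>] image_cball_subset_of_boundary_eq[OF cv iv cu iu _ \<rho>] eq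
      by (intro equalityI) auto
    then show "integral (cball 0 r) (\<lambda>x. w (x + a *\<^sub>R \<phi> x) * det (mat 1 + a *\<^sub>R \<phi>' x)) =
      integral (cball 0 r) (\<lambda>x. w (x + a *\<^sub>R \<psi> x) * det (mat 1 + a *\<^sub>R \<psi>' x))"
      using cov[OF \<phi> iu _ w] cov[OF \<psi> iv _ w] a1(3) a2(3) a by auto
  qed
qed

section \<open>Integrands depending polynomially on a real parameter\<close>

definition poly_family :: "'a::topological_space set \<Rightarrow> (real \<Rightarrow> 'a \<Rightarrow> real) \<Rightarrow> bool" where
  "poly_family S F \<longleftrightarrow> (\<exists>p N. (\<forall>x\<in>S. degree (p x) \<le> N) \<and>
     (\<forall>i. continuous_on S (\<lambda>x. coeff (p x) i)) \<and> (\<forall>e. \<forall>x\<in>S. F e x = poly (p x) e))"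

lemma poly_familyI:
  assumes "\<And>x. x \<in> S \<Longrightarrow> degree (p x) \<le> N" "\<And>i. continuous_on S (\<lambda>x. coeff (p x) i)"
    "\<And>e x. x \<in> S \<Longrightarrow> F e x = poly (p x) e"
  shows "poly_family S F"
  unfolding poly_family_def using assms by blast

lemma poly_family_affine:
  assumes "continuous_on S a" "continuous_on S b"
  shows "poly_family S (\<lambda>e x. e * a x + b x)"
proof (rule poly_familyI)
  show "continuous_on S (\<lambda>x. coeff [:b x, a x:] i)" for i
    using assms by (cases i; cases "i - 1") (auto simp: coeff_pCons split: nat.split)
  show "degree [:b x, a x:] \<le> 1" for x by simp
qed (simp add: mult.commute add.commute)

lemma poly_family_const: "poly_family S (\<lambda>e x. c)"
  using poly_family_affine[of S "\<lambda>_. 0" "\<lambda>_. c"] by simp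

lemma poly_family_add:
  assumes "poly_family S F" "poly_family S G"
  shows "poly_family S (\<lambda>e x. F e x + G e x)"
proof -
  obtain p N where p: "\<forall>x\<in>S. degree (p x) \<le> N" "\<forall>i. continuous_on S (\<lambda>x. coeff (p x) i)"
    "\<forall>e. \<forall>x\<in>S. F e x = poly (p x) e" using assms(1) unfolding poly_family_def by blast
  obtain q M where q: "\<forall>x\<in>S. degree (q x) \<le> M" "\<forall>i. continuous_on S (\<lambda>x. coeff (q x) i)"
    "\<forall>e. \<forall>x\<in>S. G e x = poly (q x) e" using assms(2) unfolding poly_family_def by blast
  show ?thesis
  proof (rule poly_familyI[of S "\<lambda>x. p x + q x" "max N M"])
    show "degree (p x + q x) \<le> max N M" if "x \<in> S" for x
      using that p(1) q(1) by (intro degree_add_le) (auto simp: le_max_iff_disj)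
  qed (use p q in \<open>auto intro!: continuous_intros\<close>)
qed

lemma poly_family_mult:
  assumes "poly_family S F" "poly_family S G"
  shows "poly_family S (\<lambda>e x. F e x * G e x)"
proof -
  obtain p N where p: "\<forall>x\<in>S. degree (p x) \<le> N" "\<forall>i. continuous_on S (\<lambda>x. coeff (p x) i)"
    "\<forall>e. \<forall>x\<in>S. F e x = poly (p x) e" using assms(1) unfolding poly_family_def by blast
  obtain q M where q: "\<forall>x\<in>S. degree (q x) \<le> M" "\<forall>i. continuous_on S (\<lambda>x. coeff (q x) i)"
    "\<forall>e. \<forall>x\<in>S. G e x = poly (q x) e" using assms(2) unfolding poly_family_def by blast
  show ?thesis
  proof (rule poly_familyI[of S "\<lambda>x. p x * q x" "N + M"])
    show "degree (p x * q x) \<le> N + M" if "x \<in> S" for x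
      using that p(1) q(1) by (intro order_trans[OF degree_mult_le] add_mono) auto
  qed (use p q in \<open>auto simp: coeff_mult intro!: continuous_intros\<close>)
qed

lemma poly_family_sum:
  assumes "\<And>i. i \<in> I \<Longrightarrow> poly_family S (F i)"
  shows "poly_family S (\<lambda>e x. \<Sum>i\<in>I. F i e x)"
  using assms
  by (induction I rule: infinite_finite_induct) (auto simp: poly_family_const intro: poly_family_add)

lemma poly_family_prod:
  assumes "\<And>i. i \<in> I \<Longrightarrow> poly_family S (F i)"
  shows "poly_family S (\<lambda>e x. \<Prod>i\<in>I. F i e x)"
  using assms
  by (induction I rule: infinite_finite_induct) (auto simp: poly_family_const intro: poly_family_mult)

lemma poly_family_det:
  fixes A B :: "'a::topological_space \<Rightarrow> real^'n^'n"
  assumes "continuous_on S A" "continuous_on S B"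
  shows "poly_family S (\<lambda>e x. det (e *\<^sub>R A x + B x))"
  unfolding det_def
  by (intro poly_family_sum poly_family_mult poly_family_prod poly_family_const)
    (auto intro!: poly_family_affine continuous_intros assms)

lemma poly_family_real_polynomial_function:
  fixes A B :: "'a::topological_space \<Rightarrow> real^'n"
  assumes "real_polynomial_function w" and A: "continuous_on S A" and B: "continuous_on S B"
  shows "poly_family S (\<lambda>e x. w (e *\<^sub>R A x + B x))"
  using assms(1)
proof induction
  case (linear f)
  then have "linear f" by (simp add: bounded_linear.linear)
  have *: "f (e *\<^sub>R A x + B x) = e * f (A x) + f (B x)" for e x
    by (simp add: linear_add[OF \<open>linear f\<close>] linear_cmul[OF \<open>linear f\<close>])
  show ?case unfolding *
    by (intro poly_family_affine bounded_linear.continuous_on[OF linear] A B)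
qed (simp_all add: poly_family_const poly_family_add poly_family_mult)

text \<open>The degree bound is uniform in the point, so integrating the coefficients makes the
  integral a polynomial in the parameter; vanishing on a half-line, it has infinitely many
  roots.\<close>

lemma poly_family_integral_zero:
  fixes F :: "real \<Rightarrow> 'a::euclidean_space \<Rightarrow> real"
  assumes F: "poly_family S F" and S: "compact S"
    and zero: "\<And>e. e > E \<Longrightarrow> integral S (F e) = 0"
  shows "integral S (F 0) = 0"
proof -
  obtain p N where p: "\<forall>x\<in>S. degree (p x) \<le> N" "\<forall>i. continuous_on S (\<lambda>x. coeff (p x) i)"
    "\<forall>e. \<forall>x\<in>S. F e x = poly (p x) e" using F unfolding poly_family_def by blast
  define c where "c i = integral S (\<lambda>x. coeff (p x) i)" for i
  define q where "q = (\<Sum>i\<le>N. monom (c i) i)"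
  have int: "integral S (F e) = poly q e" for e
  proof -
    have "integral S (F e) = integral S (\<lambda>x. \<Sum>i\<le>N. coeff (p x) i * e ^ i)"
    proof (rule Henstock_Kurzweil_Integration.integral_cong)
      fix x assume x: "x \<in> S"
      \<comment> \<open>The degree may drop at some points; padding with zero coefficients gives one
        range of summation for all of them.\<close>
      have "poly (p x) e = (\<Sum>i\<le>N. coeff (p x) i * e ^ i)"
        unfolding poly_altdef using p(1) x
        by (intro sum.mono_neutral_left) (auto simp: coeff_eq_0)
      then show "F e x = (\<Sum>i\<le>N. coeff (p x) i * e ^ i)" using p(3) x by simp
    qed
    also have "\<dots> = (\<Sum>i\<le>N. integral S (\<lambda>x. coeff (p x) i * e ^ i))"
      using p(2) by (intro integral_sum integrable_continuous_compact[OF S] continuous_intros) auto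
    also have "\<dots> = poly q e"
      by (simp add: q_def c_def poly_sum poly_monom)
    finally show ?thesis .
  qed
  have "infinite {e. poly q e = 0}"
  proof (rule infinite_super)
    show "{E<..} \<subseteq> {e. poly q e = 0}" using zero int by auto
  qed (rule infinite_Ioi)
  then have "q = 0" using poly_roots_finite by blast
  then show ?thesis using int by simp
qed

text \<open>
  \<open>w(\<phi>) det \<phi>'\<close> is a null Lagrangian. For \<open>e\<close> large, \<open>e \<cdot> id + \<phi>\<close> and \<open>e \<cdot> id + \<psi>\<close> are injective
  with the same image, and both integrals are the integral of \<open>w\<close> over it; if \<open>w\<close> is a polynomial, the
  difference is a polynomial in \<open>e\<close>, so it vanishes at \<open>e = 0\<close> too.
\<close>

lemma null_lagrangian_polynomial:
  fixes \<phi> \<psi> :: "real^'n::{finite,wellorder} \<Rightarrow> real^'n::_"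
  assumes \<phi>: "C1_on (cball 0 r) \<phi> \<phi>'" and \<psi>: "C1_on (cball 0 r) \<psi> \<psi>'"
    and eq: "\<And>x. x \<in> cball 0 r \<Longrightarrow> \<rho> \<le> norm x \<Longrightarrow> \<phi> x = \<psi> x"
    and \<rho>: "\<rho> < r" "0 < r" and w: "real_polynomial_function w"
  shows "integral (cball 0 r) (\<lambda>x. w (\<phi> x) * det (\<phi>' x)) = integral (cball 0 r) (\<lambda>x. w (\<psi> x) * det (\<psi>' x))"
proof -
  define G where "G u u' e x = w (e *\<^sub>R x + u x) * det (e *\<^sub>R mat 1 + u' x)"
    for u :: "real^'n::_ \<Rightarrow> real^'n::_" and u' :: "real^'n::_ \<Rightarrow> (real^'n::_)^'n::_" and e x
  define F where "F e x = G \<phi> \<phi>' e x + (-1) * G \<psi> \<psi>' e x" for e x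
  have w_cont: "continuous_on UNIV w"
    using w continuous_on_polymonial_function real_polynomial_function_eq by blast
  have cont: "continuous_on (cball 0 r) \<phi>" "continuous_on (cball 0 r) \<psi>"
    "continuous_on (cball 0 r) \<phi>'" "continuous_on (cball 0 r) \<psi>'"
    using \<phi> \<psi> C1_on_continuous unfolding C1_on_def by blast+
  have "poly_family (cball 0 r) (G u u')"
    if "continuous_on (cball 0 r) u" "continuous_on (cball 0 r) u'" for u u'
    unfolding G_def using that
    by (intro poly_family_mult poly_family_det poly_family_real_polynomial_function[OF w]) (auto intro!: continuous_intros)
  then have fam: "poly_family (cball 0 r) F"
    unfolding F_def using cont by (intro poly_family_add poly_family_mult poly_family_const) auto
  have int: "G u u' e integrable_on cball 0 r"
    if "continuous_on (cball 0 r) u" "continuous_on (cball 0 r) u'" for u u' e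
    unfolding G_def using that
    by (intro integrable_continuous_compact compact_cball continuous_intros continuous_on_compose2[OF w_cont]) auto
  obtain a0 where a0: "a0 > 0" "\<And>a w. \<bar>a\<bar> < a0 \<Longrightarrow> continuous_on UNIV w \<Longrightarrow>
      integral (cball 0 r) (\<lambda>x. w (x + a *\<^sub>R \<phi> x) * det (mat 1 + a *\<^sub>R \<phi>' x)) =
      integral (cball 0 r) (\<lambda>x. w (x + a *\<^sub>R \<psi> x) * det (mat 1 + a *\<^sub>R \<psi>' x))"
    by (rule integral_perturbed_identity_eq[OF \<phi> \<psi> eq \<rho>]) (assumption | blast)+
  have F_int: "integral (cball 0 r) (F e) = integral (cball 0 r) (G \<phi> \<phi>' e) - integral (cball 0 r) (G \<psi> \<psi>' e)" for e
    using integral_diff[OF int[OF cont(1,3), of e] int[OF cont(2,4), of e]] unfolding F_def by simp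
  have "integral (cball 0 r) (F e) = 0" if e: "e > 1 / a0" for e
  proof -
    have e0: "e > 0" using e a0(1) by (meson less_trans zero_less_divide_1_iff)
    have small: "\<bar>1 / e\<bar> < a0" using e e0 a0(1) by (simp add: field_simps)
    have we: "continuous_on UNIV (\<lambda>y. w (e *\<^sub>R y))"
      by (intro continuous_intros continuous_on_compose2[OF w_cont]) auto
    \<comment> \<open>Pulling \<open>e\<close> out of both the argument and the determinant turns
      the large parameter \<open>e\<close> into the small perturbation \<open>1 / e\<close> of the
      identity, with weight \<open>w (e *\<^sub>R y)\<close>.\<close>
    have G_eq: "G u u' e x = e ^ CARD('n) * (w (e *\<^sub>R (x + (1 / e) *\<^sub>R u x)) * det (mat 1 + (1 / e) *\<^sub>R u' x))"
      for u u' x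
    proof -
      have "e *\<^sub>R mat 1 + u' x = e *\<^sub>R (mat 1 + (1 / e) *\<^sub>R u' x)"
        using e0 by (simp add: scaleR_add_right)
      moreover have "e *\<^sub>R x + u x = e *\<^sub>R (x + (1 / e) *\<^sub>R u x)"
        using e0 by (simp add: scaleR_add_right)
      ultimately show ?thesis unfolding G_def by (simp only: det_scaleR mult_ac)
    qed
    show ?thesis
      unfolding F_int G_eq integral_mult_right using a0(2)[OF small we] by simp
  qed
  then have "integral (cball 0 r) (F 0) = 0"
    by (rule poly_family_integral_zero[OF fam compact_cball])
  then show ?thesis unfolding F_int G_def by simp
qed

text \<open>Both integrals depend continuously on \<open>w\<close> in the uniform norm on the
  compact set \<open>K\<close> of values, so the polynomial case carries over by
  Stone-Weierstrass.\<close>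

lemma null_lagrangian:
  fixes \<phi> \<psi> :: "real^'n::{finite,wellorder} \<Rightarrow> real^'n::_"
  assumes \<phi>: "C1_on (cball 0 r) \<phi> \<phi>'" and \<psi>: "C1_on (cball 0 r) \<psi> \<psi>'"
    and eq: "\<And>x. x \<in> cball 0 r \<Longrightarrow> \<rho> \<le> norm x \<Longrightarrow> \<phi> x = \<psi> x"
    and \<rho>: "\<rho> < r" "0 < r" and w: "continuous_on UNIV w"
  shows "integral (cball 0 r) (\<lambda>x. w (\<phi> x) * det (\<phi>' x)) = integral (cball 0 r) (\<lambda>x. w (\<psi> x) * det (\<psi>' x))"
proof -
  have cont: "continuous_on (cball 0 r) \<phi>" "continuous_on (cball 0 r) \<psi>"
    "continuous_on (cball 0 r) \<phi>'" "continuous_on (cball 0 r) \<psi>'"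
    using \<phi> \<psi> C1_on_continuous unfolding C1_on_def by blast+
  define K where "K = \<phi> ` cball 0 r \<union> \<psi> ` cball 0 r"
  have K: "compact K" unfolding K_def using cont by (intro compact_Un compact_continuous_image) auto
  define M where "M = integral (cball 0 r) (\<lambda>x. \<bar>det (\<phi>' x)\<bar>) + integral (cball 0 r) (\<lambda>x. \<bar>det (\<psi>' x)\<bar>)"
  have M: "M \<ge> 0" unfolding M_def by (intro add_nonneg_nonneg integral_nonneg integrable_continuous_compact continuous_intros cont) auto
  have approx: "\<bar>integral (cball 0 r) (\<lambda>x. w (u x) * det (u' x)) - integral (cball 0 r) (\<lambda>x. p (u x) * det (u' x))\<bar>
      \<le> d * integral (cball 0 r) (\<lambda>x. \<bar>det (u' x)\<bar>)"
    if u: "continuous_on (cball 0 r) u" "continuous_on (cball 0 r) u'" and sub: "u ` cball 0 r \<subseteq> K"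
      and p: "continuous_on UNIV p" "\<And>y. y \<in> K \<Longrightarrow> \<bar>w y - p y\<bar> < d"
    for u u' and p :: "real^'n::_ \<Rightarrow> real" and d
  proof -
    have i: "(\<lambda>x. v (u x) * det (u' x)) integrable_on cball 0 r" if "continuous_on UNIV v" for v :: "real^'n::_ \<Rightarrow> real"
      by (intro integrable_continuous_compact compact_cball continuous_intros continuous_on_compose2[OF that] u) auto
    have "\<bar>integral (cball 0 r) (\<lambda>x. w (u x) * det (u' x) - p (u x) * det (u' x))\<bar>
      \<le> integral (cball 0 r) (\<lambda>x. d * \<bar>det (u' x)\<bar>)"
      unfolding real_norm_def[symmetric]
    proof (rule integral_norm_bound_integral)
      show "(\<lambda>x. d * norm (det (u' x))) integrable_on cball 0 r"
        by (intro integrable_continuous_compact compact_cball continuous_intros u)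
      show "norm (w (u x) * det (u' x) - p (u x) * det (u' x)) \<le> d * norm (det (u' x))" if "x \<in> cball 0 r" for x
      proof -
        have "\<bar>w (u x) - p (u x)\<bar> \<le> d" using p(2)[of "u x"] sub that by fastforce
        from mult_right_mono[OF this abs_ge_zero[of "det (u' x)"]] show ?thesis
          by (simp add: left_diff_distrib[symmetric] abs_mult)
      qed
    qed (intro integrable_diff i w p)
    then show ?thesis by (simp add: integral_diff[OF i[OF w] i[OF p(1)]])
  qed
  have "\<bar>integral (cball 0 r) (\<lambda>x. w (\<phi> x) * det (\<phi>' x)) - integral (cball 0 r) (\<lambda>x. w (\<psi> x) * det (\<psi>' x))\<bar> \<le> 0 + e"
    if "e > 0" for e
  proof -
    \<comment> \<open>\<open>M\<close> may be 0, hence \<open>M + 1\<close>.\<close>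
    have "e / (M + 1) > 0" using \<open>e > 0\<close> M by simp
    then obtain p where p: "real_polynomial_function p" "\<And>y. y \<in> K \<Longrightarrow> \<bar>w y - p y\<bar> < e / (M + 1)"
      using Stone_Weierstrass_real_polynomial_function[OF K continuous_on_subset[OF w subset_UNIV]] by metis
    have pc: "continuous_on UNIV p"
      using p(1) continuous_on_polymonial_function real_polynomial_function_eq by blast
    have "\<bar>integral (cball 0 r) (\<lambda>x. w (\<phi> x) * det (\<phi>' x)) - integral (cball 0 r) (\<lambda>x. w (\<psi> x) * det (\<psi>' x))\<bar> \<le> e / (M + 1) * M"
    proof -
      have "\<phi> ` cball 0 r \<subseteq> K" "\<psi> ` cball 0 r \<subseteq> K" unfolding K_def by auto
      from approx[OF cont(1,3) this(1) pc p(2)] approx[OF cont(2,4) this(2) pc p(2)]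
      show ?thesis
        unfolding M_def distrib_left using null_lagrangian_polynomial[OF \<phi> \<psi> eq \<rho> p(1)] by linarith
    qed
    also have "\<dots> \<le> e" using M \<open>e > 0\<close> by (simp add: field_simps)
    finally show ?thesis by simp
  qed
  from field_le_epsilon[OF this] show ?thesis by simp
qed

section \<open>Signed count of zeros\<close>

text \<open>Injectivity comes from the inverse function theorem and the constant sign from
  continuity of the determinant. The final radius is halved to pass from open to closed
  balls.\<close>

lemma C1_on_locally_injective:
  fixes \<phi> :: "real^'n \<Rightarrow> real^'n"
  assumes C1: "C1_on S \<phi> \<phi>'" and S: "open S" "z \<in> S" and det: "det (\<phi>' z) \<noteq> 0"
  obtains r where "r > 0" "cball z r \<subseteq> S" "inj_on \<phi> (cball z r)"
    "\<And>x. x \<in> cball z r \<Longrightarrow> sgn (det (\<phi>' x)) = sgn (det (\<phi>' z))"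
proof -
  have der: "\<And>x. x \<in> S \<Longrightarrow> (\<phi> has_derivative (*v) (\<phi>' x)) (at x)" and cont: "continuous_on S \<phi>'"
    using C1 unfolding C1_on_def by auto
  have cont_z: "isCont \<phi>' z" using cont S continuous_on_eq_continuous_at by blast
  obtain B where B: "B ** \<phi>' z = mat 1"
    using det by (metis invertible_det_nz invertible_def)
  \<comment> \<open>Continuity of the matrix in its norm bounds the entries of the difference, hence
    its operator norm; the factor 2 makes the inequality strict.\<close>
  have cont_onorm: "\<exists>d>0. \<forall>x. dist z x < d \<longrightarrow> onorm (\<lambda>v. \<phi>' x *v v - \<phi>' z *v v) < e" if "e > 0" for e
  proof -
    define N where "N = real CARD('n) * real CARD('n)"
    have N: "N > 0" unfolding N_def by simp
    obtain d where d: "d > 0" "\<And>x. dist x z < d \<Longrightarrow> dist (\<phi>' x) (\<phi>' z) < e / (2 * N)"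
      using cont_z \<open>e > 0\<close> N unfolding continuous_at_eps_delta
      by (metis divide_pos_pos mult_pos_pos zero_less_numeral)
    have "onorm (\<lambda>v. \<phi>' x *v v - \<phi>' z *v v) < e" if "dist z x < d" for x
    proof -
      have "\<bar>(\<phi>' x - \<phi>' z) $ i $ j\<bar> \<le> e / (2 * N)" for i j
      proof -
        have "\<bar>(\<phi>' x - \<phi>' z) $ i $ j\<bar> \<le> norm ((\<phi>' x - \<phi>' z) $ i)" by (rule component_le_norm_cart)
        also have "\<dots> \<le> norm (\<phi>' x - \<phi>' z)" by (rule Finite_Cartesian_Product.norm_nth_le)
        finally show ?thesis using d(2)[of x] that by (simp add: dist_commute dist_norm)
      qed
      then have "onorm ((*v) (\<phi>' x - \<phi>' z)) \<le> real CARD('n) * real CARD('n) * (e / (2 * N))"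
        by (rule onorm_le_matrix_component)
      also have "\<dots> = e / 2" using N unfolding N_def by (simp add: field_simps)
      also have "\<dots> < e" using \<open>e > 0\<close> by simp
      finally show ?thesis unfolding matrix_vector_mult_diff_rdistrib[symmetric] .
    qed
    then show ?thesis using d(1) by blast
  qed
  have inv: "(*v) B \<circ> (*v) (\<phi>' z) = id"
    using B by (simp add: fun_eq_iff matrix_vector_mul_assoc)
  obtain r1 where r1: "r1 > 0" "ball z r1 \<subseteq> S" "inj_on \<phi> (ball z r1)"
    by (rule has_derivative_locally_injective[where f' = "\<lambda>x. (*v) (\<phi>' x)",
          OF S(2,1) matrix_vector_mul_bounded_linear inv der cont_onorm]) (assumption | blast)+
  have "continuous_on S (\<lambda>x. det (\<phi>' x))" using cont by (intro continuous_intros)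
  then have "isCont (\<lambda>x. det (\<phi>' x)) z" using S continuous_on_eq_continuous_at by blast
  then obtain r2 where r2: "r2 > 0" "\<And>x. dist x z < r2 \<Longrightarrow> dist (det (\<phi>' x)) (det (\<phi>' z)) < \<bar>det (\<phi>' z)\<bar>"
    using det unfolding continuous_at_eps_delta by (metis zero_less_abs_iff)
  have sub: "cball z (min r1 r2 / 2) \<subseteq> ball z r1" using r1(1) r2(1) by auto
  show thesis
  proof
    show "min r1 r2 / 2 > 0" using r1(1) r2(1) by simp
    show "cball z (min r1 r2 / 2) \<subseteq> S" using sub r1(2) by blast
    show "inj_on \<phi> (cball z (min r1 r2 / 2))" using sub r1(3) inj_on_subset by blast
    fix x assume "x \<in> cball z (min r1 r2 / 2)"
    then have "dist (det (\<phi>' x)) (det (\<phi>' z)) < \<bar>det (\<phi>' z)\<bar>"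
      using r1(1) r2 by (auto simp: dist_commute)
    then show "sgn (det (\<phi>' x)) = sgn (det (\<phi>' z))"
      by (auto simp: dist_real_def sgn_real_def abs_if split: if_splits)
  qed
qed

lemma finite_set_separation:
  fixes Z :: "'a::metric_space set"
  assumes "finite Z" "\<And>z. z \<in> Z \<Longrightarrow> \<rho> z > 0"
  obtains \<sigma> :: real where "\<sigma> > 0" "\<And>z. z \<in> Z \<Longrightarrow> \<sigma> \<le> \<rho> z"
    "\<And>y z. y \<in> Z \<Longrightarrow> z \<in> Z \<Longrightarrow> y \<noteq> z \<Longrightarrow> cball y \<sigma> \<inter> cball z \<sigma> = {}"
proof -
  \<comment> \<open>A common point of two closed balls of radius at most a third of the distance of
    their centres would contradict the triangle inequality. The element 1 keeps the set
    nonempty.\<close>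
  define M where "M = insert 1 (\<rho> ` Z \<union> (\<lambda>p. dist (fst p) (snd p) / 3) ` {p \<in> Z \<times> Z. fst p \<noteq> snd p})"
  have "finite M"
    unfolding M_def using assms(1) by simp
  have pos: "m > 0" if "m \<in> M" for m using that assms(2) unfolding M_def by auto
  have ne: "M \<noteq> {}" unfolding M_def by simp
  show thesis
  proof
    show "Min M > 0" using \<open>finite M\<close> ne pos by simp
    show "Min M \<le> \<rho> z" if "z \<in> Z" for z
      using \<open>finite M\<close> that unfolding M_def by (intro Min_le) auto
    fix y z assume yz: "y \<in> Z" "z \<in> Z" "y \<noteq> z"
    then have "dist y z / 3 \<in> M"
      unfolding M_def by (intro insertI2 UnI2 image_eqI[of _ _ "(y, z)"]) auto
    then have le: "Min M \<le> dist y z / 3" using Min_le[OF \<open>finite M\<close>] by blast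
    have pos: "dist y z > 0" using yz by simp
    have False if "dist y x \<le> Min M" "dist z x \<le> Min M" for x
      using dist_triangle2[of y z x] that le pos by simp
    then show "cball y (Min M) \<inter> cball z (Min M) = {}" by auto
  qed
qed

lemma compact_norm_lower_bound:
  fixes \<phi> :: "'a::topological_space \<Rightarrow> 'b::real_normed_vector"
  assumes "compact S" "continuous_on S \<phi>" "\<And>x. x \<in> S \<Longrightarrow> \<phi> x \<noteq> 0"
  obtains \<delta> where "\<delta> > 0" "\<And>x. x \<in> S \<Longrightarrow> \<delta> \<le> norm (\<phi> x)"
proof (cases "S = {}")
  case False
  obtain x0 where "x0 \<in> S" "\<forall>x\<in>S. norm (\<phi> x0) \<le> norm (\<phi> x)"
    using continuous_attains_inf[OF assms(1) False continuous_on_norm[OF assms(2)]] by blast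
  then show thesis using that[of "norm (\<phi> x0)"] assms(3) by auto
qed (use that[of 1] in auto)

text \<open>The zeros are isolated, hence finite in number. Near each one \<open>\<phi>\<close> is
  injective with determinant of constant sign and covers a ball around 0, so substitution yields the
  sign times the integral of \<open>w\<close>. Away from these neighbourhoods \<open>\<phi>\<close>
  is bounded below, and \<open>w\<close> vanishes there.\<close>

lemma integral_eq_signed_count:
  fixes \<phi> :: "real^'n::{finite,wellorder} \<Rightarrow> real^'n::_"
  assumes C1: "C1_on (cball 0 r) \<phi> \<phi>'"
    and reg: "\<And>x. x \<in> cball 0 r \<Longrightarrow> \<phi> x = 0 \<Longrightarrow> norm x < r \<and> det (\<phi>' x) \<noteq> 0"
  obtains \<delta>0 where "\<delta>0 > 0"
    "\<And>\<delta> w. 0 < \<delta> \<Longrightarrow> \<delta> \<le> \<delta>0 \<Longrightarrow> continuous_on UNIV w \<Longrightarrow> (\<And>y. \<delta> \<le> norm y \<Longrightarrow> w y = 0) \<Longrightarrow>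
      integral (cball 0 r) (\<lambda>x. w (\<phi> x) * det (\<phi>' x)) =
      (\<Sum>z | z \<in> cball 0 r \<and> \<phi> z = 0. sgn (det (\<phi>' z))) * integral (cball 0 \<delta>) w"
proof -
  define Z where "Z = {z \<in> cball 0 r. \<phi> z = 0}"
  have cont: "continuous_on (cball 0 r) \<phi>" "continuous_on (cball 0 r) \<phi>'"
    using C1 C1_on_continuous unfolding C1_on_def by blast+
  have C1b: "C1_on (ball 0 r) \<phi> \<phi>'" using C1_on_subset[OF C1 ball_subset_cball] .
  have "\<exists>\<rho>. \<rho> > 0 \<and> cball z \<rho> \<subseteq> ball 0 r \<and> inj_on \<phi> (cball z \<rho>) \<and>
      (\<forall>x\<in>cball z \<rho>. sgn (det (\<phi>' x)) = sgn (det (\<phi>' z)))" if "z \<in> Z" for z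
  proof -
    have "z \<in> ball 0 r" "det (\<phi>' z) \<noteq> 0" using that reg unfolding Z_def by auto
    from C1_on_locally_injective[OF C1b open_ball this] show ?thesis by metis
  qed
  then obtain \<rho> where \<rho>: "\<And>z. z \<in> Z \<Longrightarrow> \<rho> z > 0" "\<And>z. z \<in> Z \<Longrightarrow> cball z (\<rho> z) \<subseteq> ball 0 r"
    "\<And>z. z \<in> Z \<Longrightarrow> inj_on \<phi> (cball z (\<rho> z))"
    "\<And>z x. z \<in> Z \<Longrightarrow> x \<in> cball z (\<rho> z) \<Longrightarrow> sgn (det (\<phi>' x)) = sgn (det (\<phi>' z))"
    by metis
  have "closed Z" unfolding Z_def
    using continuous_closed_preimage_constant[OF cont(1) closed_cball] .
  moreover have "bounded Z"
    by (rule bounded_subset[OF bounded_cball[of 0 r]]) (auto simp: Z_def)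
  ultimately have "compact Z"
    by (simp add: compact_eq_bounded_closed)
  moreover have "Z \<subseteq> (\<Union>c\<in>Z. ball c (\<rho> c))" using \<rho>(1) by force
  ultimately obtain C where C: "C \<subseteq> Z" "finite C" "Z \<subseteq> (\<Union>c\<in>C. ball c (\<rho> c))"
    by (rule compactE_image[OF _ open_ball])
  \<comment> \<open>By injectivity each ball of the finite subcover contains no zero but its
    centre.\<close>
  have "Z \<subseteq> C"
  proof
    fix z assume z: "z \<in> Z"
    then obtain c where c: "c \<in> C" "z \<in> ball c (\<rho> c)" using C(3) by blast
    have "z = c"
      using inj_onD[OF \<rho>(3)[of c], of z c] c C(1) z \<rho>(1)[of c] unfolding Z_def by auto
    then show "z \<in> C" using c by simp
  qed
  then have fin: "finite Z" using C(2) finite_subset by blast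
  obtain \<sigma> where \<sigma>: "\<sigma> > 0" "\<And>z. z \<in> Z \<Longrightarrow> \<sigma> \<le> \<rho> z"
    "\<And>y z. y \<in> Z \<Longrightarrow> z \<in> Z \<Longrightarrow> y \<noteq> z \<Longrightarrow> cball y \<sigma> \<inter> cball z \<sigma> = {}"
    using finite_set_separation[of Z \<rho>, OF fin \<rho>(1)] by blast
  have sub: "cball z \<sigma> \<subseteq> cball z (\<rho> z)" if "z \<in> Z" for z using \<sigma>(2)[OF that] by (simp add: subset_cball)
  have subr: "cball z \<sigma> \<subseteq> cball 0 r" if "z \<in> Z" for z
    using sub[OF that] \<rho>(2)[OF that] ball_subset_cball by blast
  have inj: "inj_on \<phi> (cball z \<sigma>)" if "z \<in> Z" for z using inj_on_subset[OF \<rho>(3)[OF that] sub[OF that]] .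
  have "\<exists>\<delta>>0. cball 0 \<delta> \<subseteq> \<phi> ` ball z \<sigma>" if "z \<in> Z" for z
  proof -
    have "open (\<phi> ` ball z \<sigma>)"
      by (rule invariance_of_domain_ball[OF continuous_on_subset[OF cont(1) subr[OF that]] \<sigma>(1) inj[OF that]])
    moreover have "0 \<in> \<phi> ` ball z \<sigma>" using that \<sigma>(1) unfolding Z_def by force
    ultimately show ?thesis by (meson open_contains_cball)
  qed
  then obtain d where d: "\<And>z. z \<in> Z \<Longrightarrow> d z > 0" "\<And>z. z \<in> Z \<Longrightarrow> cball 0 (d z) \<subseteq> \<phi> ` ball z \<sigma>" by metis
  have "compact (cball 0 r - (\<Union>z\<in>Z. ball z \<sigma>))"
    by (intro compact_diff compact_cball open_UN ballI open_ball)
  moreover have "continuous_on (cball 0 r - (\<Union>z\<in>Z. ball z \<sigma>)) \<phi>"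
    by (rule continuous_on_subset[OF cont(1)]) auto
  moreover have "\<phi> x \<noteq> 0" if "x \<in> cball 0 r - (\<Union>z\<in>Z. ball z \<sigma>)" for x
    using that \<sigma>(1) unfolding Z_def by force
  ultimately obtain d1 where d1: "d1 > 0" "\<And>x. x \<in> cball 0 r - (\<Union>z\<in>Z. ball z \<sigma>) \<Longrightarrow> d1 \<le> norm (\<phi> x)"
    by (rule compact_norm_lower_bound) (assumption | blast)+
  define d2 where "d2 = Min (insert 1 (d ` Z))"
  have d2: "d2 > 0" "\<And>z. z \<in> Z \<Longrightarrow> d2 \<le> d z"
    using fin d(1) unfolding d2_def by auto
  show thesis
  proof
    show "min d1 d2 > 0" using d1 d2 by simp
    fix \<delta> and w :: "real^'n::_ \<Rightarrow> real"
    assume \<delta>: "0 < \<delta>" "\<delta> \<le> min d1 d2" and w: "continuous_on UNIV w" and supp: "\<And>y. \<delta> \<le> norm y \<Longrightarrow> w y = 0"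
    \<comment> \<open>Extended by 0 because enlarging the domain of a \<open>has_integral\<close>
      statement requires vanishing at every point outside the smaller set.\<close>
    define F where "F x = (if x \<in> cball 0 r then w (\<phi> x) * det (\<phi>' x) else 0)" for x
    define c where "c = integral (cball 0 \<delta>) w"
    have wc: "(w has_integral c) (cball 0 \<delta>)"
      unfolding c_def
      by (intro integrable_integral integrable_continuous_compact compact_cball continuous_on_subset[OF w]) auto
    have loc: "(F has_integral (sgn (det (\<phi>' z)) * c)) (cball z \<sigma>)" if z: "z \<in> Z" for z
    proof -
      have img: "cball 0 \<delta> \<subseteq> \<phi> ` cball z \<sigma>"
      proof -
        have "cball 0 \<delta> \<subseteq> cball (0::real^'n::_) (d z)"
          using d2(2)[OF z] \<delta> by (simp add: subset_cball)
        also have "\<dots> \<subseteq> \<phi> ` cball z \<sigma>"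
          using d(2)[OF z] image_mono[OF ball_subset_cball] by (rule order_trans)
        finally show ?thesis .
      qed
      have "integral (\<phi> ` cball z \<sigma>) w = c"
        by (intro integral_unique has_integral_on_superset[OF wc _ img] supp) auto
      then have "integral (cball z \<sigma>) (\<lambda>x. \<bar>det (\<phi>' x)\<bar> * w (\<phi> x)) = c"
        using integral_change_of_variables[OF compact_cball C1_on_subset[OF C1 subr[OF z]] inj[OF z]
            continuous_on_subset[OF w subset_UNIV]] by simp
      moreover have "(\<lambda>x. \<bar>det (\<phi>' x)\<bar> * w (\<phi> x)) integrable_on cball z \<sigma>"
        by (intro integrable_continuous_compact compact_cball continuous_intros
            continuous_on_compose2[OF w] continuous_on_subset[OF cont(1) subr[OF z]]
            continuous_on_subset[OF cont(2) subr[OF z]]) auto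
      ultimately have "((\<lambda>x. \<bar>det (\<phi>' x)\<bar> * w (\<phi> x)) has_integral c) (cball z \<sigma>)"
        using has_integral_integrable_integral by blast
      from has_integral_mult_right[OF this, of "sgn (det (\<phi>' z))"] show ?thesis
      proof (rule has_integral_eq[rotated])
        fix x assume x: "x \<in> cball z \<sigma>"
        \<comment> \<open>The sign at the centre is the sign on the whole ball, so it undoes the
          absolute value of the substitution rule.\<close>
        have "sgn (det (\<phi>' z)) * \<bar>det (\<phi>' x)\<bar> = det (\<phi>' x)"
          using \<rho>(4)[OF z, of x] sub[OF z] x by (metis subsetD sgn_mult_abs)
        then show "sgn (det (\<phi>' z)) * (\<bar>det (\<phi>' x)\<bar> * w (\<phi> x)) = F x"
          using subr[OF z] x unfolding F_def by (metis mult.assoc mult.commute subsetD)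
      qed
    qed
    have "(F has_integral (\<Sum>z\<in>Z. sgn (det (\<phi>' z)) * c)) (\<Union>z\<in>Z. cball z \<sigma>)"
      using \<sigma>(3) by (intro has_integral_UN fin loc) (auto simp: pairwise_def)
    then have "(F has_integral (\<Sum>z\<in>Z. sgn (det (\<phi>' z)) * c)) (cball 0 r)"
    proof (rule has_integral_on_superset)
      fix x assume x: "x \<notin> (\<Union>z\<in>Z. cball z \<sigma>)"
      then have "x \<in> cball 0 r \<Longrightarrow> d1 \<le> norm (\<phi> x)" using d1(2)[of x] by force
      then show "F x = 0" unfolding F_def using supp[of "\<phi> x"] \<delta> by auto
    qed (use subr in blast)
    then have "((\<lambda>x. w (\<phi> x) * det (\<phi>' x)) has_integral (\<Sum>z\<in>Z. sgn (det (\<phi>' z)) * c)) (cball 0 r)"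
      by (rule has_integral_eq[rotated]) (simp add: F_def)
    then show "integral (cball 0 r) (\<lambda>x. w (\<phi> x) * det (\<phi>' x)) =
      (\<Sum>z | z \<in> cball 0 r \<and> \<phi> z = 0. sgn (det (\<phi>' z))) * integral (cball 0 \<delta>) w"
      unfolding c_def Z_def sum_distrib_right by (rule integral_unique)
  qed
qed

text \<open>On the ball of half the radius the cone is at least \<open>\<delta> / 2\<close>. This
  integral is the positive factor that is cancelled from the signed count.\<close>

lemma integral_cone_pos:
  assumes "\<delta> > 0"
  shows "integral (cball 0 \<delta>) (\<lambda>y::'a::euclidean_space. max 0 (\<delta> - norm y)) > 0"
proof -
  have int: "(\<lambda>y::'a. max 0 (\<delta> - norm y)) integrable_on cball 0 s" for s
    by (intro integrable_continuous_compact compact_cball continuous_intros)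
  have "0 < \<delta> / 2 * measure lebesgue (cball (0::'a) (\<delta> / 2))"
    using assms content_cball_pos[of "\<delta> / 2" "0::'a"] by simp
  also have "\<dots> = integral (cball (0::'a) (\<delta> / 2)) (\<lambda>_. \<delta> / 2)"
    using lmeasure_integral[of "cball (0::'a) (\<delta> / 2)"] integral_mult_right[of "cball (0::'a) (\<delta> / 2)" "\<delta> / 2" "\<lambda>_. 1"]
    by simp
  also have "\<dots> \<le> integral (cball (0::'a) (\<delta> / 2)) (\<lambda>y. max 0 (\<delta> - norm y))"
    by (intro integral_le int integrable_continuous_compact compact_cball continuous_intros)
      (use assms in \<open>auto simp: max_def\<close>)
  also have "\<dots> \<le> integral (cball (0::'a) \<delta>) (\<lambda>y. max 0 (\<delta> - norm y))"
    using assms by (intro integral_subset_le int) (auto simp: subset_cball)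
  finally show ?thesis .
qed

text \<open>Squaring removes the kink of the positive part at 0. This is the building block both of
  the cut-off function and of the Lyapunov function in \<open>solution_in_cball\<close>.\<close>

lemma has_real_derivative_max0_power2:
  "((\<lambda>x::real. (max 0 x)\<^sup>2) has_real_derivative 2 * max 0 x) (at x)"
proof (cases x "0::real" rule: linorder_cases)
  case less
  have "((\<lambda>x::real. 0) has_real_derivative 2 * max 0 x) (at x)" using less by simp
  then show ?thesis
    by (rule DERIV_cong_ev[THEN iffD1, rotated -1, OF _ refl _ refl])
      (use less in \<open>auto simp: eventually_nhds intro!: exI[of _ "{..<0}"]\<close>)
next
  case equal
  have "((\<lambda>h::real. (max 0 h)\<^sup>2 / h) \<longlongrightarrow> 0) (at 0)"
  proof (rule Lim_null_comparison)
    show "eventually (\<lambda>h::real. norm ((max 0 h)\<^sup>2 / h) \<le> \<bar>h\<bar>) (at 0)"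
      by (intro always_eventually allI) (auto simp: max_def power2_eq_square)
    show "((\<lambda>h::real. \<bar>h\<bar>) \<longlongrightarrow> 0) (at 0)" using tendsto_rabs_zero[OF tendsto_ident_at] by simp
  qed
  then show ?thesis using equal by (simp add: has_field_derivative_def DERIV_def[unfolded has_field_derivative_def])
next
  case greater
  have "((\<lambda>x::real. x\<^sup>2) has_real_derivative 2 * max 0 x) (at x)"
    using greater by (auto intro!: derivative_eq_intros)
  then show ?thesis
    by (rule DERIV_cong_ev[THEN iffD1, rotated -1, OF _ refl _ refl])
      (use greater in \<open>auto simp: eventually_nhds intro!: exI[of _ "{0<..}"]\<close>)
qed

text \<open>Class C^1 is all that is asked for, so squared positive parts do: one makes
  \<open>q\<close> vanish beyond \<open>\<beta>\<close>, the other flattens \<open>\<eta>\<close> to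
  1 where \<open>q\<close> is at least 1. Using \<open>x \<bullet> x\<close> instead of the norm
  avoids trouble at the origin.\<close>

lemma C1_cutoff:
  assumes "0 \<le> \<alpha>" "\<alpha> < \<beta>"
  obtains \<eta> :: "'a::euclidean_space \<Rightarrow> real" and \<eta>' where
    "\<And>x. (\<eta> has_derivative (\<lambda>v. \<eta>' x \<bullet> v)) (at x)" "continuous_on UNIV \<eta>'"
    "\<And>x. norm x \<le> \<alpha> \<Longrightarrow> \<eta> x = 1" "\<And>x. \<beta> \<le> norm x \<Longrightarrow> \<eta> x = 0" "\<And>x. \<eta> x \<in> {0..1}"
proof -
  \<comment> \<open>The value of the numerator of \<open>q\<close> at norm \<open>\<alpha>\<close>,
    so that \<open>q\<close> is at least 1 inside.\<close>
  define D where "D = (\<beta>\<^sup>2 - \<alpha>\<^sup>2)\<^sup>2"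
  have "\<alpha>\<^sup>2 < \<beta>\<^sup>2" using assms by (intro power_strict_mono) auto
  then have D: "D > 0" unfolding D_def by simp
  define m :: "real \<Rightarrow> real" where "m = (\<lambda>x. (max 0 x)\<^sup>2)"
  define q where "q x = m (\<beta>\<^sup>2 - x \<bullet> x) / D" for x :: 'a
  define \<eta> where "\<eta> x = 1 - m (1 - q x)" for x :: 'a
  define \<eta>' where "\<eta>' x = (- (2 * max 0 (1 - q x)) * (2 * max 0 (\<beta>\<^sup>2 - x \<bullet> x) / D) * 2) *\<^sub>R x" for x :: 'a
  have dm: "(m has_derivative (\<lambda>h. 2 * max 0 x * h)) (at x)" for x
    using has_real_derivative_max0_power2[of x] unfolding m_def has_field_derivative_def .
  have dq: "(q has_derivative (\<lambda>v. (2 * max 0 (\<beta>\<^sup>2 - x \<bullet> x) / D) * (- 2 * (x \<bullet> v)))) (at x)" for x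
  proof -
    have "((\<lambda>x::'a. \<beta>\<^sup>2 - x \<bullet> x) has_derivative (\<lambda>v. - 2 * (x \<bullet> v))) (at x)"
      by (auto intro!: derivative_eq_intros simp: inner_commute)
    from has_derivative_compose[OF this dm]
    have "((\<lambda>x. m (\<beta>\<^sup>2 - x \<bullet> x)) has_derivative (\<lambda>v. 2 * max 0 (\<beta>\<^sup>2 - x \<bullet> x) * (- 2 * (x \<bullet> v)))) (at x)" .
    from has_derivative_mult_left[OF this, of "inverse D"] show ?thesis
      unfolding q_def by (simp add: divide_inverse mult_ac)
  qed
  have cq: "continuous_on UNIV q"
    unfolding q_def m_def using D by (intro continuous_intros) auto
  show thesis
  proof
    fix x :: 'a
    have "((\<lambda>x. 1 - q x) has_derivative (\<lambda>v. - ((2 * max 0 (\<beta>\<^sup>2 - x \<bullet> x) / D) * (- 2 * (x \<bullet> v))))) (at x)"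
      using has_derivative_diff[OF has_derivative_const dq, of 1 x] by simp
    from has_derivative_diff[OF has_derivative_const has_derivative_compose[OF this dm], of 1]
    show "(\<eta> has_derivative (\<lambda>v. \<eta>' x \<bullet> v)) (at x)"
      unfolding \<eta>_def \<eta>'_def by (rule has_derivative_eq_rhs) (simp add: fun_eq_iff)
    show "\<eta> x = 1" if "norm x \<le> \<alpha>"
    proof -
      have "x \<bullet> x \<le> \<alpha>\<^sup>2" using that assms by (simp add: dot_square_norm power_mono)
      then have "(\<beta>\<^sup>2 - \<alpha>\<^sup>2)\<^sup>2 \<le> (max 0 (\<beta>\<^sup>2 - x \<bullet> x))\<^sup>2"
        using \<open>\<alpha>\<^sup>2 < \<beta>\<^sup>2\<close> by (intro power_mono) auto
      then have "q x \<ge> 1" using D unfolding q_def m_def D_def by simp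
      then show ?thesis unfolding \<eta>_def m_def by simp
    qed
    show "\<eta> x = 0" if "\<beta> \<le> norm x"
    proof -
      have "x \<bullet> x \<ge> \<beta>\<^sup>2" using that assms by (simp add: dot_square_norm power_mono)
      then show ?thesis unfolding \<eta>_def q_def m_def by simp
    qed
    have "q x \<ge> 0" unfolding q_def m_def using D by simp
    then have "(max 0 (1 - q x))\<^sup>2 \<le> 1" by (intro power_le_one) auto
    then show "\<eta> x \<in> {0..1}" unfolding \<eta>_def m_def by simp
  qed (unfold \<eta>'_def, use D in \<open>intro continuous_intros cq\<close>, auto)
qed

lemma C1_on_smult:
  assumes c: "\<And>x. x \<in> S \<Longrightarrow> (c has_derivative (\<lambda>v. c' x \<bullet> v)) (at x)" "continuous_on S c'"
    and u: "C1_on S u u'"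
  shows "C1_on S (\<lambda>x. c x *\<^sub>R u x) (\<lambda>x. c x *\<^sub>R u' x + (\<chi> i j. u x $ i * c' x $ j))"
proof -
  have cc: "continuous_on S c"
    using c(1) by (meson continuous_at_imp_continuous_on has_derivative_continuous)
  have "((\<lambda>x. c x *\<^sub>R u x) has_derivative (*v) (c x *\<^sub>R u' x + (\<chi> i j. u x $ i * c' x $ j))) (at x)"
    if "x \<in> S" for x
  proof -
    have "(u has_derivative (*v) (u' x)) (at x)" using u that unfolding C1_on_def by blast
    from has_derivative_scaleR[OF c(1)[OF that] this] show ?thesis
    proof (rule has_derivative_eq_rhs, intro ext)
      fix v
      show "c x *\<^sub>R (u' x *v v) + (c' x \<bullet> v) *\<^sub>R u x = (c x *\<^sub>R u' x + (\<chi> i j. u x $ i * c' x $ j)) *v v"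
        by (simp add: vec_eq_iff matrix_vector_mult_def inner_vec_def sum_distrib_left sum.distrib algebra_simps)
    qed
  qed
  moreover have "continuous_on S (\<lambda>x. c x *\<^sub>R u' x + (\<chi> i j. u x $ i * c' x $ j))"
    using u C1_on_continuous[OF u] unfolding C1_on_def by (intro continuous_intros cc c(2)) auto
  ultimately show ?thesis unfolding C1_on_def by blast
qed

text \<open>Glue \<open>\<psi>\<close> inside to \<open>\<phi>\<close> outside, giving a zero-free
  \<open>\<theta>\<close>. For a bump \<open>w\<close> supported close to 0 the integral for
  \<open>\<theta>\<close> is 0, the one for \<open>\<phi>\<close> is the signed count times a
  positive number, and the two agree by \<open>null_lagrangian\<close>. As \<open>\<phi>\<close> is
  differentiable in the open ball only, this is done on a smaller ball.\<close>

lemma signed_count_eq_0: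
  fixes \<phi> \<psi> :: "real^'n::{finite,wellorder} \<Rightarrow> real^'n::_"
  assumes reg: "regular_C1_map \<phi> \<phi>' (ball 0 R) 0" and R: "R > 0"
    and \<psi>: "C1_on (cball 0 R) \<psi> \<psi>'" "\<And>x. x \<in> cball 0 R \<Longrightarrow> \<psi> x \<noteq> 0"
    and close: "\<And>x. norm x = R \<Longrightarrow> norm (\<phi> x - \<psi> x) < norm (\<psi> x)"
  shows "(\<Sum>x | x \<in> ball 0 R \<and> \<phi> x = 0. sgn (det (\<phi>' x))) = 0"
proof -
  have cont\<phi>: "continuous_on (cball 0 R) \<phi>" and \<phi>: "C1_on (ball 0 R) \<phi> \<phi>'"
    and nz: "\<And>x. x \<in> ball 0 R \<Longrightarrow> \<phi> x = 0 \<Longrightarrow> det (\<phi>' x) \<noteq> 0"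
    using reg R unfolding regular_C1_map_def C1_on_def by auto
  have cont\<psi>: "continuous_on (cball 0 R) \<psi>" using C1_on_continuous[OF \<psi>(1)] .
  \<comment> \<open>The compact set where \<open>\<psi>\<close> fails to dominate the difference. It
    misses the sphere, hence stays within some radius \<open>\<alpha> < R\<close>, and all zeros of
    \<open>\<phi>\<close> lie in it.\<close>
  define A where "A = {x \<in> cball 0 R. norm (\<psi> x) - norm (\<phi> x - \<psi> x) \<in> {..0}}"
  have "closed A"
    unfolding A_def
    by (intro continuous_closed_preimage[unfolded vimage_def Int_def mem_Collect_eq] continuous_intros cont\<phi> cont\<psi>) auto
  moreover have "bounded A"
    by (rule bounded_subset[OF bounded_cball[of 0 R]]) (auto simp: A_def)
  ultimately have "compact A"
    by (simp add: compact_eq_bounded_closed)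
  have "\<exists>\<alpha>. 0 \<le> \<alpha> \<and> \<alpha> < R \<and> (\<forall>x\<in>A. norm x \<le> \<alpha>)"
  proof (cases "A = {}")
    case True
    then show ?thesis using R by auto
  next
    case False
    then obtain x where x: "x \<in> A" "\<forall>y\<in>A. norm y \<le> norm x"
      using continuous_attains_sup[OF \<open>compact A\<close> False continuous_on_norm[OF continuous_on_id]] by auto
    have "norm x < R" using x(1) close[of x] unfolding A_def by force
    then show ?thesis using x by (intro exI[of _ "norm x"]) auto
  qed
  then obtain \<alpha> where \<alpha>: "0 \<le> \<alpha>" "\<alpha> < R" "\<And>x. x \<in> A \<Longrightarrow> norm x \<le> \<alpha>" by blast
  have shell: "norm (\<phi> x - \<psi> x) < norm (\<psi> x)" if "\<alpha> < norm x" "norm x \<le> R" for x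
    using \<alpha>(3)[of x] that unfolding A_def by force
  \<comment> \<open>The thirds of the interval from \<open>\<alpha>\<close> to \<open>R\<close>: the
    transition ends at \<open>\<beta>\<close>, and integration is over radius
    \<open>\<gamma>\<close>, leaving a shell where \<open>\<theta>\<close> equals
    \<open>\<phi>\<close>.\<close>
  define \<beta> \<gamma> where "\<beta> = (2 * \<alpha> + R) / 3" and "\<gamma> = (\<alpha> + 2 * R) / 3"
  have ord: "\<alpha> < \<beta>" "\<beta> < \<gamma>" "\<gamma> < R" "0 < \<gamma>" using \<alpha> unfolding \<beta>_def \<gamma>_def by auto
  have zeros: "norm x \<le> \<alpha>" if "\<phi> x = 0" "norm x \<le> R" for x
    using shell[of x] that by force
  obtain \<eta> :: "real^'n::_ \<Rightarrow> real" and \<eta>' where \<eta>: "\<And>x. (\<eta> has_derivative (\<lambda>v. \<eta>' x \<bullet> v)) (at x)" "continuous_on UNIV \<eta>'"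
    "\<And>x. norm x \<le> \<alpha> \<Longrightarrow> \<eta> x = 1" "\<And>x. \<beta> \<le> norm x \<Longrightarrow> \<eta> x = 0" "\<And>x. \<eta> x \<in> {0..1}"
    using C1_cutoff[OF \<alpha>(1) ord(1)] by metis
  define \<theta> where "\<theta> x = \<phi> x + \<eta> x *\<^sub>R (\<psi> x + (-1) *\<^sub>R \<phi> x)" for x
  have sub: "cball 0 \<gamma> \<subseteq> ball (0::real^'n::_) R" "cball 0 \<gamma> \<subseteq> cball (0::real^'n::_) R" using ord by auto
  have \<phi>\<gamma>: "C1_on (cball 0 \<gamma>) \<phi> \<phi>'" using C1_on_subset[OF \<phi> sub(1)] .
  have "C1_on (cball 0 \<gamma>) (\<lambda>x. \<psi> x + (-1) *\<^sub>R \<phi> x) (\<lambda>x. \<psi>' x + (-1) *\<^sub>R \<phi>' x)"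
    by (intro C1_on_add C1_on_scaleR \<phi>\<gamma> C1_on_subset[OF \<psi>(1) sub(2)])
  from C1_on_add[OF \<phi>\<gamma> C1_on_smult[OF \<eta>(1) continuous_on_subset[OF \<eta>(2) subset_UNIV] this]]
  obtain \<theta>' where \<theta>: "C1_on (cball 0 \<gamma>) \<theta> \<theta>'" unfolding \<theta>_def by blast
  have \<theta>nz: "\<theta> x \<noteq> 0" if "x \<in> cball 0 \<gamma>" for x
  proof (cases "norm x \<le> \<alpha>")
    case True
    then show ?thesis using \<eta>(3) \<psi>(2)[of x] that sub unfolding \<theta>_def by auto
  next
    case False
    have "\<theta> x = \<psi> x - (1 - \<eta> x) *\<^sub>R (\<psi> x - \<phi> x)" unfolding \<theta>_def by (simp add: algebra_simps)
    moreover have "norm ((1 - \<eta> x) *\<^sub>R (\<psi> x - \<phi> x)) \<le> norm (\<psi> x - \<phi> x)"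
      using \<eta>(5)[of x] by (simp add: mult_left_le_one_le)
    moreover have "norm (\<phi> x - \<psi> x) < norm (\<psi> x)" using shell[of x] False that ord by auto
    ultimately show ?thesis by (metis eq_iff_diff_eq_0 norm_minus_commute not_le)
  qed
  obtain \<delta>1 where \<delta>1: "\<delta>1 > 0" "\<And>x. x \<in> cball 0 \<gamma> \<Longrightarrow> \<delta>1 \<le> norm (\<theta> x)"
    using compact_norm_lower_bound[OF compact_cball C1_on_continuous[OF \<theta>] \<theta>nz] by metis
  have "norm x < \<gamma> \<and> det (\<phi>' x) \<noteq> 0" if "x \<in> cball 0 \<gamma>" "\<phi> x = 0" for x
    using zeros[of x] nz[of x] that ord by auto
  then obtain \<delta>0 where \<delta>0: "\<delta>0 > 0"
    "\<And>\<delta> w. 0 < \<delta> \<Longrightarrow> \<delta> \<le> \<delta>0 \<Longrightarrow> continuous_on UNIV w \<Longrightarrow> (\<And>y. \<delta> \<le> norm y \<Longrightarrow> w y = 0) \<Longrightarrow>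
      integral (cball 0 \<gamma>) (\<lambda>x. w (\<phi> x) * det (\<phi>' x)) =
      (\<Sum>z | z \<in> cball 0 \<gamma> \<and> \<phi> z = 0. sgn (det (\<phi>' z))) * integral (cball 0 \<delta>) w"
    by (rule integral_eq_signed_count[OF \<phi>\<gamma>]) (assumption | blast)+
  \<comment> \<open>Small enough for the counting formula and for the bump to vanish on all values
    of \<open>\<theta>\<close>.\<close>
  define \<delta> where "\<delta> = min \<delta>0 \<delta>1"
  have \<delta>: "\<delta> > 0" "\<delta> \<le> \<delta>0" "\<delta> \<le> \<delta>1" using \<delta>0(1) \<delta>1(1) unfolding \<delta>_def by auto
  define w where "w y = max 0 (\<delta> - norm y)" for y :: "real^'n::_"
  have w: "continuous_on UNIV w" unfolding w_def by (intro continuous_intros)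
  have "(\<Sum>z | z \<in> cball 0 \<gamma> \<and> \<phi> z = 0. sgn (det (\<phi>' z))) * integral (cball 0 \<delta>) w
    = integral (cball 0 \<gamma>) (\<lambda>x. w (\<phi> x) * det (\<phi>' x))"
    using \<delta>0(2)[OF \<delta>(1,2) w] by (simp add: w_def)
  also have "\<dots> = integral (cball 0 \<gamma>) (\<lambda>x. w (\<theta> x) * det (\<theta>' x))"
    by (rule null_lagrangian[OF \<phi>\<gamma> \<theta> _ ord(2,4) w]) (simp add: \<theta>_def \<eta>(4))
  also have "\<dots> = integral (cball 0 \<gamma>) (\<lambda>x::real^'n::_. 0)"
  proof (rule Henstock_Kurzweil_Integration.integral_cong)
    fix x :: "real^'n::_" assume "x \<in> cball 0 \<gamma>"
    then show "w (\<theta> x) * det (\<theta>' x) = 0" using \<delta>1(2)[of x] \<delta>(3) unfolding w_def by simp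
  qed
  finally have "(\<Sum>z | z \<in> cball 0 \<gamma> \<and> \<phi> z = 0. sgn (det (\<phi>' z))) = 0"
    using integral_cone_pos[OF \<delta>(1), where 'a = "real^'n::_"] unfolding w_def by simp
  moreover have "{z. z \<in> cball 0 \<gamma> \<and> \<phi> z = 0} = {x. x \<in> ball 0 R \<and> \<phi> x = 0}"
    using zeros ord by force
  ultimately show ?thesis by simp
qed

section \<open>Brouwer degree of maps with a nonvanishing extension\<close>

text \<open>The library has the change of variables theorem and Sard's lemma for well-ordered index types
  only; an arbitrary finite index type is therefore replaced by a copy of an initial segment of \<open>nat\<close>.\<close>

typedef 'a idx = "{..<CARD('a::finite)}"
  by (rule exI[of _ 0]) simp

instantiation idx :: (finite) wellorder
begin

definition less_eq_idx :: "'a idx \<Rightarrow> 'a idx \<Rightarrow> bool" where "x \<le> y \<longleftrightarrow> Rep_idx x \<le> Rep_idx y"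
definition less_idx :: "'a idx \<Rightarrow> 'a idx \<Rightarrow> bool" where "x < y \<longleftrightarrow> Rep_idx x < Rep_idx y"

instance
proof
  fix P and a :: "'a idx"
  assume step: "\<And>x. (\<And>y. y < x \<Longrightarrow> P y) \<Longrightarrow> P (x :: 'a idx)"
  show "P a"
  proof (induction a rule: measure_induct_rule[of Rep_idx])
    case (less a)
    show ?case by (rule step) (rule less, simp add: less_idx_def)
  qed
qed (auto simp: less_eq_idx_def less_idx_def Rep_idx_inject)

end

lemma UNIV_idx: "(UNIV :: 'a::finite idx set) = Abs_idx ` {..<CARD('a)}"
  by (rule type_definition.Abs_image[OF type_definition_idx, symmetric])

instance idx :: (finite) finite
  by intro_classes (simp add: UNIV_idx)

lemma card_idx: "CARD('a::finite idx) = CARD('a)"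
  unfolding UNIV_idx by (subst card_image) (auto simp: inj_on_def Abs_idx_inject)

text \<open>Transport along \<open>b\<close> is a sign-preserving bijection between the permutations
  of the two index types, so the Leibniz sums agree term by term.\<close>

lemma det_reindex:
  fixes A :: "real^'k^'k" and b :: "'m::finite \<Rightarrow> 'k"
  assumes b: "bij b"
  shows "det (\<chi> i j. A $ b i $ b j) = det A"
proof -
  have inj: "inj b" and bU: "range b = UNIV" using b unfolding bij_def by auto
  have bij: "bij_betw (map_permutation UNIV b) {p. p permutes UNIV} {p. p permutes (UNIV :: 'k set)}"
  proof (rule bij_betw_byWitness[where f' = "map_permutation UNIV (inv b)"])
    show "\<forall>p\<in>{p. p permutes (UNIV :: 'm set)}. map_permutation UNIV (inv b) (map_permutation UNIV b p) = p"
      using map_permutation_compose_inv[of b UNIV UNIV _ "inv b"] b inj by auto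
    show "\<forall>p\<in>{p. p permutes (UNIV :: 'k set)}. map_permutation UNIV b (map_permutation UNIV (inv b) p) = p"
      using map_permutation_compose_inv[of "inv b" UNIV UNIV _ b] bij_imp_bij_inv[OF b] bU by (auto simp: surj_f_inv_f)
    show "map_permutation UNIV b ` {p. p permutes UNIV} \<subseteq> {p. p permutes UNIV}"
      using map_permutation_permutes[of b UNIV UNIV] b by auto
    show "map_permutation UNIV (inv b) ` {p. p permutes UNIV} \<subseteq> {p. p permutes UNIV}"
      using map_permutation_permutes[of "inv b" UNIV UNIV] bij_imp_bij_inv[OF b] by auto
  qed
  have "det A = (\<Sum>p | p permutes (UNIV :: 'm set). of_int (sign (map_permutation UNIV b p)) *
      (\<Prod>i\<in>UNIV. A $ i $ map_permutation UNIV b p i))"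
    unfolding det_def by (rule sum.reindex_bij_betw[OF bij, symmetric])
  also have "\<dots> = (\<Sum>p | p permutes (UNIV :: 'm set). of_int (sign p) * (\<Prod>i\<in>UNIV. A $ b i $ b (p i)))"
  proof (rule sum.cong[OF refl])
    fix p :: "'m \<Rightarrow> 'm" assume "p \<in> {p. p permutes UNIV}"
    then have "sign (map_permutation UNIV b p) = sign p"
      using sign_map_permutation[OF inj] by auto
    moreover have "map_permutation UNIV b p (b i) = b (p i)" for i
      using inj by (simp add: map_permutation_apply)
    then have "(\<Prod>i\<in>UNIV. A $ i $ map_permutation UNIV b p i) = (\<Prod>i\<in>UNIV. A $ b i $ b (p i))"
      using prod.reindex[OF inj, of "\<lambda>i. A $ i $ map_permutation UNIV b p i"] bU by simp
    ultimately show "of_int (sign (map_permutation UNIV b p)) * (\<Prod>i\<in>UNIV. A $ i $ map_permutation UNIV b p i)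
      = of_int (sign p) * (\<Prod>i\<in>UNIV. A $ b i $ b (p i))" by simp
  qed
  also have "\<dots> = det (\<chi> i j. A $ b i $ b j)" unfolding det_def by simp
  finally show ?thesis ..
qed

definition reindex :: "('m \<Rightarrow> 'k) \<Rightarrow> real^'k \<Rightarrow> real^'m" where
  "reindex b x = (\<chi> i. x $ b i)"

lemma linear_reindex: "linear (reindex b)"
  by (rule linearI) (simp_all add: reindex_def vec_eq_iff)

lemma bounded_linear_reindex: "bounded_linear (reindex b)" for b :: "'m::finite \<Rightarrow> 'k::finite"
  using linear_reindex linear_conv_bounded_linear by blast

lemma reindex_inverse:
  assumes "bij b"
  shows "reindex b (reindex (inv b) y) = y" "reindex (inv b) (reindex b x) = x"
  using assms by (simp_all add: reindex_def vec_eq_iff bij_is_inj bij_is_surj surj_f_inv_f)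

lemma norm_reindex:
  fixes b :: "'m::finite \<Rightarrow> 'k::finite"
  assumes "bij b"
  shows "norm (reindex b x) = norm x"
  unfolding norm_vec_def L2_set_def reindex_def
  using sum.reindex_bij_betw[OF assms, of "\<lambda>i. (norm (x $ i))\<^sup>2"] by simp

lemma C1_on_reindex:
  fixes b :: "'m::finite \<Rightarrow> 'k::finite"
  assumes b: "bij b" and C1: "C1_on S \<phi> \<phi>'"
  shows "C1_on (reindex b ` S) (\<lambda>y. reindex b (\<phi> (reindex (inv b) y)))
    (\<lambda>y. \<chi> i j. \<phi>' (reindex (inv b) y) $ b i $ b j)"
proof -
  note R = bounded_linear_imp_has_derivative[OF bounded_linear_reindex]
  have "((\<lambda>y. reindex b (\<phi> (reindex (inv b) y))) has_derivative
      (*v) (\<chi> i j. \<phi>' (reindex (inv b) y) $ b i $ b j)) (at y)" if y: "y \<in> reindex b ` S" for y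
  proof -
    have "reindex (inv b) y \<in> S" using y reindex_inverse(2)[OF b] by force
    then have "(\<phi> has_derivative (*v) (\<phi>' (reindex (inv b) y))) (at (reindex (inv b) y))"
      using C1 unfolding C1_on_def by blast
    from has_derivative_compose[OF has_derivative_compose[OF R this] R] show ?thesis
    proof (rule has_derivative_eq_rhs, intro ext)
      fix v :: "real^'m"
      show "reindex b (\<phi>' (reindex (inv b) y) *v reindex (inv b) v) = (\<chi> i j. \<phi>' (reindex (inv b) y) $ b i $ b j) *v v"
      proof (simp add: vec_eq_iff reindex_def matrix_vector_mult_def, intro allI)
        fix i
        show "(\<Sum>j\<in>UNIV. \<phi>' (\<chi> i. y $ inv b i) $ b i $ j * v $ inv b j) = (\<Sum>j\<in>UNIV. \<phi>' (\<chi> i. y $ inv b i) $ b i $ b j * v $ j)"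
          using sum.reindex_bij_betw[OF b, of "\<lambda>j. \<phi>' (\<chi> i. y $ inv b i) $ b i $ j * v $ inv b j"] b
          by (simp add: bij_is_inj)
      qed
    qed
  qed
  moreover have "continuous_on (reindex b ` S) (\<lambda>y. \<chi> i j. \<phi>' (reindex (inv b) y) $ b i $ b j)"
  proof -
    have "reindex (inv b) ` reindex b ` S \<subseteq> S"
      by (auto simp: reindex_inverse[OF b])
    then have "continuous_on (reindex b ` S) (\<lambda>y. \<phi>' (reindex (inv b) y))"
      using C1 unfolding C1_on_def
      by (blast intro: continuous_on_compose2[OF _ linear_continuous_on[OF bounded_linear_reindex]])
    then show ?thesis by (intro continuous_intros)
  qed
  ultimately show ?thesis unfolding C1_on_def by blast
qed

lemma ex_bij_idx: "\<exists>b :: 'k::finite idx \<Rightarrow> 'k. bij b"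
  using finite_same_card_bij[of "UNIV :: 'k idx set" "UNIV :: 'k set"] card_idx by auto

text \<open>Conjugation by the coordinate relabelling is isometric and preserves zeros and Jacobian
  determinants, so the count can be made over \<open>'k idx\<close>.\<close>

lemma regular_C1_map_signed_count_eq_0:
  fixes \<phi> \<psi> :: "real^'k \<Rightarrow> real^'k"
  assumes reg: "regular_C1_map \<phi> \<phi>' (ball 0 R) 0" and R: "R > 0"
    and \<psi>: "C1_on (cball 0 R) \<psi> \<psi>'" "\<And>x. x \<in> cball 0 R \<Longrightarrow> \<psi> x \<noteq> 0"
    and close: "\<And>x. norm x = R \<Longrightarrow> norm (\<phi> x - \<psi> x) < norm (\<psi> x)"
  shows "(\<Sum>x | x \<in> ball 0 R \<and> \<phi> x = 0. sgn (det (\<phi>' x))) = 0"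
proof -
  obtain b :: "'k idx \<Rightarrow> 'k" where b: "bij b" using ex_bij_idx by blast
  have b': "bij (inv b)" using bij_imp_bij_inv[OF b] .
  have lin: "linear (reindex b)" by (rule linear_reindex)
  define T where "T \<eta> = (\<lambda>y. reindex b (\<eta> (reindex (inv b) y)))" for \<eta> :: "real^'k \<Rightarrow> real^'k"
  define T' where "T' \<eta>' = (\<lambda>y. \<chi> i j. \<eta>' (reindex (inv b) y) $ b i $ b j)" for \<eta>' :: "real^'k \<Rightarrow> real^'k^'k"
  have img: "reindex b ` ball 0 R = ball 0 R" "reindex b ` cball 0 R = cball 0 R"
  proof -
    have "z \<in> reindex b ` S \<longleftrightarrow> reindex (inv b) z \<in> S" for S z
      by (auto simp: reindex_inverse[OF b] intro!: image_eqI[of _ _ "reindex (inv b) z"])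
    then show "reindex b ` ball 0 R = ball 0 R" "reindex b ` cball 0 R = cball 0 R"
      using norm_reindex[OF b'] by (auto simp: set_eq_iff)
  qed
  have C1T: "C1_on (reindex b ` S) (T \<eta>) (T' \<eta>')" if "C1_on S \<eta> \<eta>'" for S \<eta> \<eta>'
    using C1_on_reindex[OF b that] unfolding T_def T'_def .
  have zero: "T \<eta> y = 0 \<longleftrightarrow> \<eta> (reindex (inv b) y) = 0" for \<eta> y
  proof -
    have "norm (T \<eta> y) = norm (\<eta> (reindex (inv b) y))" unfolding T_def by (rule norm_reindex[OF b])
    then show ?thesis by (metis norm_eq_zero)
  qed
  have detT: "det (T' \<eta>' y) = det (\<eta>' (reindex (inv b) y))" for \<eta>' y
    unfolding T'_def by (rule det_reindex[OF b])
  have reg': "C1_on (ball 0 R) \<phi> \<phi>'" "continuous_on (cball 0 R) \<phi>" "\<And>x. x \<in> ball 0 R \<Longrightarrow> \<phi> x = 0 \<Longrightarrow> det (\<phi>' x) \<noteq> 0"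
    using reg R unfolding regular_C1_map_def C1_on_def by auto
  have "continuous_on (cball 0 R) (T \<phi>)"
  proof -
    have "continuous_on (cball 0 R) (\<lambda>y. \<phi> (reindex (inv b) y))"
      using norm_reindex[OF b']
      by (intro continuous_on_compose2[OF reg'(2)] linear_continuous_on bounded_linear_reindex) auto
    from continuous_on_compose[OF this linear_continuous_on[OF bounded_linear_reindex]] show ?thesis
      unfolding T_def comp_def .
  qed
  then have "regular_C1_map (T \<phi>) (T' \<phi>') (ball 0 R) 0"
    using C1T[OF reg'(1)] reg'(3) R norm_reindex[OF b']
    unfolding regular_C1_map_def C1_on_def img by (auto simp: zero detT)
  moreover have "norm (T \<phi> y - T \<psi> y) < norm (T \<psi> y)" if "norm y = R" for y
    using close[of "reindex (inv b) y"] that norm_reindex[OF b] norm_reindex[OF b']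
    unfolding T_def linear_diff[OF lin, symmetric] by simp
  moreover have "T \<psi> y \<noteq> 0" if "y \<in> cball 0 R" for y
    using \<psi>(2)[of "reindex (inv b) y"] that norm_reindex[OF b'] unfolding zero by simp
  ultimately have "(\<Sum>y | y \<in> ball 0 R \<and> T \<phi> y = 0. sgn (det (T' \<phi>' y))) = 0"
    using signed_count_eq_0[of "T \<phi>" "T' \<phi>'" R "T \<psi>" "T' \<psi>'"] R C1T[OF \<psi>(1)] unfolding img by blast
  also have "(\<Sum>y | y \<in> ball 0 R \<and> T \<phi> y = 0. sgn (det (T' \<phi>' y))) = (\<Sum>x | x \<in> ball 0 R \<and> \<phi> x = 0. sgn (det (\<phi>' x)))"
    by (rule sum.reindex_bij_witness[of _ "reindex b" "reindex (inv b)"])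
      (auto simp: reindex_inverse[OF b] zero detT norm_reindex[OF b] norm_reindex[OF b'])
  finally show ?thesis .
qed

section \<open>Regular values and approximation by regular maps\<close>

lemma ex_regular_value_wellorder:
  fixes \<phi> :: "real^'n::{finite,wellorder} \<Rightarrow> real^'n::_"
  assumes C1: "C1_on UNIV \<phi> \<phi>'" and e: "e > 0"
  shows "\<exists>y. norm y < e \<and> (\<forall>x. \<phi> x = y \<longrightarrow> det (\<phi>' x) \<noteq> 0)"
proof -
  have "negligible (\<phi> ` {x. det (\<phi>' x) = 0})"
  proof (rule baby_Sard[where f' = "\<lambda>x. (*v) (\<phi>' x)"])
    show "(\<phi> has_derivative (*v) (\<phi>' x)) (at x within {x. det (\<phi>' x) = 0})" for x
      using C1 has_derivative_at_withinI unfolding C1_on_def by blast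
    show "rank (matrix ((*v) (\<phi>' x))) < CARD('n)" if "x \<in> {x. det (\<phi>' x) = 0}" for x
      using that det_eq_0_rank[of "\<phi>' x"] by simp
  qed simp
  moreover have "\<not> negligible (ball (0::real^'n::_) e)"
    using e by (intro open_not_negligible) auto
  ultimately have "\<not> ball 0 e \<subseteq> \<phi> ` {x. det (\<phi>' x) = 0}"
    using negligible_subset by blast
  then obtain y where "y \<in> ball 0 e" "y \<notin> \<phi> ` {x. det (\<phi>' x) = 0}" by blast
  then show ?thesis by (intro exI[of _ y]) auto
qed

lemma ex_regular_value:
  fixes \<phi> :: "real^'k \<Rightarrow> real^'k"
  assumes C1: "C1_on UNIV \<phi> \<phi>'" and e: "e > 0"
  shows "\<exists>y. norm y < e \<and> (\<forall>x. \<phi> x = y \<longrightarrow> det (\<phi>' x) \<noteq> 0)"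
proof -
  obtain b :: "'k idx \<Rightarrow> 'k" where b: "bij b" using ex_bij_idx by blast
  have "surj (reindex b)" using reindex_inverse(1)[OF b] by (metis surjI)
  with C1_on_reindex[OF b C1]
  have "C1_on UNIV (\<lambda>y. reindex b (\<phi> (reindex (inv b) y))) (\<lambda>y. \<chi> i j. \<phi>' (reindex (inv b) y) $ b i $ b j)"
    by simp
  from ex_regular_value_wellorder[OF this e] obtain y where
    y: "norm y < e" "\<forall>x. reindex b (\<phi> (reindex (inv b) x)) = y \<longrightarrow> det (\<phi>' (reindex (inv b) x)) \<noteq> 0"
    by (auto simp: det_reindex[OF b])
  show ?thesis
  proof (intro exI[of _ "reindex (inv b) y"] conjI allI impI)
    show "norm (reindex (inv b) y) < e" using y(1) norm_reindex[OF bij_imp_bij_inv[OF b]] by simp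
    fix x assume "\<phi> x = reindex (inv b) y"
    then have "reindex b (\<phi> (reindex (inv b) (reindex b x))) = y" by (simp add: reindex_inverse[OF b])
    with y(2) show "det (\<phi>' x) \<noteq> 0" by (metis reindex_inverse(2)[OF b])
  qed
qed

lemma real_polynomial_function_gradient:
  fixes p :: "real^'n \<Rightarrow> real"
  assumes "real_polynomial_function p"
  shows "\<exists>p'. continuous_on UNIV p' \<and> (\<forall>x. (p has_derivative (\<lambda>v. p' x \<bullet> v)) (at x))"
  using assms
proof induction
  case (linear f)
  have *: "f v = (\<chi> i. f (axis i 1)) \<bullet> v" for v
  proof -
    have "f v = f (\<Sum>i\<in>UNIV. v $ i *\<^sub>R axis i 1)"
      by (simp add: basis_expansion[of v, unfolded scalar_mult_eq_scaleR])
    also have "\<dots> = (\<chi> i. f (axis i 1)) \<bullet> v"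
      by (simp add: linear_sum[OF bounded_linear.linear[OF linear]] linear_cmul[OF bounded_linear.linear[OF linear]] inner_vec_def mult.commute)
    finally show ?thesis .
  qed
  have eq: "(\<lambda>v. (\<chi> i. f (axis i 1)) \<bullet> v) = f" by (rule ext) (rule *[symmetric])
  show ?case
    using bounded_linear_imp_has_derivative[OF linear]
    by (intro exI[of _ "\<lambda>x. \<chi> i. f (axis i 1)"]) (simp add: eq)
next
  case (const c)
  show ?case by (intro exI[of _ "\<lambda>x. 0"]) auto
next
  case (add f g)
  then obtain f' g' where d: "continuous_on UNIV f'" "\<forall>x. (f has_derivative (\<lambda>v. f' x \<bullet> v)) (at x)"
    "continuous_on UNIV g'" "\<forall>x. (g has_derivative (\<lambda>v. g' x \<bullet> v)) (at x)" by blast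
  then show ?case
    by (intro exI[of _ "\<lambda>x. f' x + g' x"])
      (auto intro!: continuous_intros has_derivative_eq_rhs[OF has_derivative_add] simp: inner_add_left)
next
  case (mult f g)
  then obtain f' g' where d: "continuous_on UNIV f'" "\<forall>x. (f has_derivative (\<lambda>v. f' x \<bullet> v)) (at x)"
    "continuous_on UNIV g'" "\<forall>x. (g has_derivative (\<lambda>v. g' x \<bullet> v)) (at x)" by blast
  have "continuous_on UNIV f" "continuous_on UNIV g"
    using d by (meson continuous_at_imp_continuous_on has_derivative_continuous)+
  with d show ?case
    by (intro exI[of _ "\<lambda>x. f x *\<^sub>R g' x + g x *\<^sub>R f' x"])
      (auto intro!: continuous_intros has_derivative_eq_rhs[OF has_derivative_mult] simp: inner_add_left)
qed

lemma polynomial_function_C1: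
  fixes p :: "real^'n \<Rightarrow> real^'n"
  assumes "polynomial_function p"
  shows "\<exists>p'. C1_on UNIV p p'"
proof -
  have "real_polynomial_function ((\<lambda>v. v $ i) \<circ> p)" for i
    using assms unfolding polynomial_function_def by (rule allE) (erule mp, rule bounded_linear_vec_nth)
  then have "\<forall>i. \<exists>G. continuous_on UNIV G \<and> (\<forall>x. ((\<lambda>x. p x $ i) has_derivative (\<lambda>v. G x \<bullet> v)) (at x))"
    using real_polynomial_function_gradient unfolding comp_def by blast
  from choice[OF this] obtain G where
    G: "\<And>i. continuous_on UNIV (G i)" "\<And>i x. ((\<lambda>x. p x $ i) has_derivative (\<lambda>v. G i x \<bullet> v)) (at x)" by blast
  have "(p has_derivative (*v) (\<chi> i j. G i x $ j)) (at x)" for x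
  proof -
    have "((\<lambda>x. \<Sum>i\<in>UNIV. p x $ i *\<^sub>R (axis i 1 :: real^'n)) has_derivative (\<lambda>v. \<Sum>i\<in>UNIV. (G i x \<bullet> v) *\<^sub>R (axis i 1 :: real^'n))) (at x)"
      by (intro has_derivative_sum has_derivative_scaleR_left G)
    moreover have "(\<Sum>i\<in>UNIV. (G i x \<bullet> v) *\<^sub>R axis i 1) = (\<chi> i j. G i x $ j) *v v" for v
      using basis_expansion[of "(\<chi> i j. G i x $ j) *v v", unfolded scalar_mult_eq_scaleR]
      by (simp add: matrix_vector_mult_def inner_vec_def)
    moreover have "(\<Sum>i\<in>UNIV. y $ i *\<^sub>R axis i 1) = y" for y :: "real^'n"
      using basis_expansion[of y] unfolding scalar_mult_eq_scaleR .
    ultimately show ?thesis by (simp only:)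
  qed
  moreover have "continuous_on UNIV (\<lambda>x. \<chi> i j. G i x $ j)" by (intro continuous_intros G)
  ultimately show ?thesis unfolding C1_on_def by (intro exI[of _ "\<lambda>x. \<chi> i j. G i x $ j"]) simp
qed

text \<open>A polynomial approximation shifted by a small regular value. Its existence is what makes
  the number in \<open>brouwer_degree\<close> unique: without such a map every integer would satisfy
  the description vacuously.\<close>

lemma ex_regular_C1_map_near:
  fixes h :: "real^'k \<Rightarrow> real^'k"
  assumes h: "continuous_on (cball 0 R) h" and e: "e > 0"
  obtains \<phi> \<phi>' where "regular_C1_map \<phi> \<phi>' (ball 0 R) 0" "\<And>x. x \<in> cball 0 R \<Longrightarrow> norm (\<phi> x - h x) < e"
proof -
  obtain p where p: "polynomial_function p" "\<And>x. x \<in> cball 0 R \<Longrightarrow> norm (h x - p x) < e / 2"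
    using Stone_Weierstrass_polynomial_function[OF compact_cball h, of "e / 2"] e by auto
  obtain p' where C1: "C1_on UNIV p p'" using polynomial_function_C1[OF p(1)] by blast
  obtain y where y: "norm y < e / 2" "\<And>x. p x = y \<Longrightarrow> det (p' x) \<noteq> 0"
    using ex_regular_value[OF C1, of "e / 2"] e by auto
  show thesis
  proof
    have "((\<lambda>x. p x - y) has_derivative (*v) (p' x)) (at x)" for x
      using has_derivative_diff[OF _ has_derivative_const, of p "(*v) (p' x)" "at x" y] C1 unfolding C1_on_def by simp
    moreover have "continuous_on S p" "continuous_on S p'" for S
      using C1 C1_on_continuous continuous_on_subset unfolding C1_on_def by blast+
    ultimately show "regular_C1_map (\<lambda>x. p x - y) p' (ball 0 R) 0"
      unfolding regular_C1_map_def using y(2) by (auto intro!: continuous_intros)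
    show "norm ((p x - y) - h x) < e" if "x \<in> cball 0 R" for x
    proof -
      have "norm ((p x - y) - h x) \<le> norm (h x - p x) + norm y"
        using norm_triangle_ineq4[of "p x - h x" y] by (simp add: algebra_simps norm_minus_commute)
      then show ?thesis using p(2)[OF that] y(1) by simp
    qed
  qed
qed

text \<open>A polynomial \<open>\<psi>\<close> near \<open>k\<close> is still zero-free, and on the
  sphere, where \<open>h\<close> and \<open>k\<close> agree, it dominates its distance to any map
  close to \<open>h\<close>. So all regular maps near \<open>h\<close> have signed count 0.\<close>

lemma brouwer_degree_eq_0:
  fixes h k :: "real^'k \<Rightarrow> real^'k"
  assumes R: "R > 0" and h: "continuous_on (cball 0 R) h"
    and k: "continuous_on (cball 0 R) k" "\<And>x. x \<in> cball 0 R \<Longrightarrow> k x \<noteq> 0"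
    and eq: "\<And>x. norm x = R \<Longrightarrow> k x = h x"
  shows "brouwer_degree h (ball 0 R) 0 = 0"
proof -
  obtain \<delta> where \<delta>: "\<delta> > 0" "\<And>x. x \<in> cball 0 R \<Longrightarrow> \<delta> \<le> norm (k x)"
    using compact_norm_lower_bound[OF compact_cball k] by metis
  obtain \<psi> where \<psi>: "polynomial_function \<psi>" "\<And>x. x \<in> cball 0 R \<Longrightarrow> norm (k x - \<psi> x) < \<delta> / 3"
    using Stone_Weierstrass_polynomial_function[OF compact_cball k(1), of "\<delta> / 3"] \<delta>(1) by auto
  obtain \<psi>' where \<psi>': "C1_on UNIV \<psi> \<psi>'" using polynomial_function_C1[OF \<psi>(1)] by blast
  \<comment> \<open>With tolerance \<open>\<delta> / 3\<close> twice, \<open>\<phi>\<close> and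
    \<open>\<psi>\<close> differ on the sphere by less than \<open>2 * \<delta> / 3\<close>, which
    is below the norm of \<open>\<psi>\<close>.\<close>
  have low: "norm (\<psi> x) > 2 * \<delta> / 3" if "x \<in> cball 0 R" for x
    using \<psi>(2)[OF that] \<delta>(2)[OF that] norm_triangle_ineq2[of "k x" "\<psi> x"] by simp
  have clo: "closure (ball (0::real^'k) R) = cball 0 R" using R by simp
  have count: "(\<Sum>x | x \<in> ball 0 R \<and> \<phi> x = 0. sgn (det (\<phi>' x))) = 0"
    if reg: "regular_C1_map \<phi> \<phi>' (ball 0 R) 0" and close: "\<forall>x\<in>cball 0 R. norm (\<phi> x - h x) < \<delta> / 3" for \<phi> \<phi>'
  proof (rule regular_C1_map_signed_count_eq_0[OF reg R C1_on_subset[OF \<psi>' subset_UNIV]])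
    show "\<psi> x \<noteq> 0" if "x \<in> cball 0 R" for x using low[OF that] \<delta>(1) by auto
    show "norm (\<phi> x - \<psi> x) < norm (\<psi> x)" if "norm x = R" for x
    proof -
      have x: "x \<in> cball 0 R" using that by simp
      have "norm (\<phi> x - \<psi> x) \<le> norm (\<phi> x - h x) + norm (k x - \<psi> x)"
        using norm_triangle_ineq[of "\<phi> x - h x" "k x - \<psi> x"] eq[OF that] by simp
      then show ?thesis using close x \<psi>(2)[OF x] low[OF x] by fastforce
    qed
  qed
  show ?thesis
    unfolding brouwer_degree_def clo
  proof (rule the_equality)
    show "\<exists>\<epsilon>>0. \<forall>\<phi> \<phi>'. regular_C1_map \<phi> \<phi>' (ball 0 R) 0 \<longrightarrow> (\<forall>x\<in>cball 0 R. norm (\<phi> x - h x) < \<epsilon>) \<longrightarrow>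
      real_of_int 0 = (\<Sum>x | x \<in> ball 0 R \<and> \<phi> x = 0. sgn (det (\<phi>' x)))"
      using \<delta>(1) count by (intro exI[of _ "\<delta> / 3"]) simp
    fix d :: int
    assume "\<exists>\<epsilon>>0. \<forall>\<phi> \<phi>'. regular_C1_map \<phi> \<phi>' (ball 0 R) 0 \<longrightarrow> (\<forall>x\<in>cball 0 R. norm (\<phi> x - h x) < \<epsilon>) \<longrightarrow>
      real_of_int d = (\<Sum>x | x \<in> ball 0 R \<and> \<phi> x = 0. sgn (det (\<phi>' x)))"
    then obtain \<epsilon> where \<epsilon>: "\<epsilon> > 0" "\<And>\<phi> \<phi>'. regular_C1_map \<phi> \<phi>' (ball 0 R) 0 \<Longrightarrow> (\<forall>x\<in>cball 0 R. norm (\<phi> x - h x) < \<epsilon>) \<Longrightarrow>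
      real_of_int d = (\<Sum>x | x \<in> ball 0 R \<and> \<phi> x = 0. sgn (det (\<phi>' x)))" by blast
    have "min \<epsilon> (\<delta> / 3) > 0" using \<epsilon>(1) \<delta>(1) by simp
    from ex_regular_C1_map_near[OF h this] obtain \<phi> \<phi>' where
      \<phi>: "regular_C1_map \<phi> \<phi>' (ball 0 R) 0" "\<And>x. x \<in> cball 0 R \<Longrightarrow> norm (\<phi> x - h x) < min \<epsilon> (\<delta> / 3)" by blast
    have "real_of_int d = 0" using \<epsilon>(2)[OF \<phi>(1)] count[OF \<phi>(1)] \<phi>(2) by simp
    then show "d = 0" by simp
  qed
qed

section \<open>Bounded variation and the Riemann--Stieltjes integral\<close>

text \<open>Put \<open>s\<close> in front of a partition of the interval from \<open>t\<close> to
  \<open>b\<close>.\<close>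

lemma total_variation_prepend:
  fixes g :: "real \<Rightarrow> 'a::real_normed_vector"
  assumes "bounded_variation_on g s b" "s < t" "t \<le> b"
  shows "norm (g t - g s) + total_variation g t b \<le> total_variation g s b"
    and "bounded_variation_on g t b"
proof -
  have *: "norm (g t - g s) + y \<in> variation_sums g s b" if y_in: "y \<in> variation_sums g t b" for y
  proof -
    obtain n p where p: "partition_points t b n p"
      and y: "y = (\<Sum>i<n. norm (g (p (Suc i)) - g (p i)))"
      using y_in unfolding variation_sums_def by auto
    have "partition_points s b (Suc n) (case_nat s p)"
      using p assms(2) unfolding partition_points_def
      by (simp add: All_less_Suc2)
    moreover have "(\<Sum>i<Suc n. norm (g (case_nat s p (Suc i)) - g (case_nat s p i))) = norm (g t - g s) + y"
      using p unfolding y sum.lessThan_Suc_shift partition_points_def by simp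
    ultimately show ?thesis
      unfolding variation_sums_def mem_Collect_eq by (intro exI[of _ "Suc n"] exI[of _ "case_nat s p"]) simp
  qed
  have bdd: "bdd_above (variation_sums g s b)"
    using assms unfolding bounded_variation_on_def by simp
  have le: "y \<le> total_variation g s b - norm (g t - g s)" if "y \<in> variation_sums g t b" for y
    using cSup_upper[OF *[OF that] bdd] unfolding total_variation_def by simp
  \<comment> \<open>Needed for the supremum to be a least upper bound; for \<open>t = b\<close> only
    the partition without cells is available.\<close>
  have ne: "variation_sums g t b \<noteq> {}"
  proof (cases "t = b")
    case True
    then have "partition_points t b 0 (\<lambda>_. t)" unfolding partition_points_def by simp
    then show ?thesis unfolding variation_sums_def by blast
  next
    case False
    then have "partition_points t b 1 (case_nat t (\<lambda>_. b))"
      using assms unfolding partition_points_def by auto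
    then show ?thesis unfolding variation_sums_def by blast
  qed
  show "norm (g t - g s) + total_variation g t b \<le> total_variation g s b"
    using cSup_least[OF ne le] unfolding total_variation_def by auto
  show "bounded_variation_on g t b"
    unfolding bounded_variation_on_def bdd_above_def using le by blast
qed

lemma tendsto_at_right_0_mono:
  fixes v :: "real \<Rightarrow> real"
  assumes mono: "\<And>s t. 0 < s \<Longrightarrow> s \<le> t \<Longrightarrow> t \<le> 1 \<Longrightarrow> v s \<le> v t"
    and bdd: "\<And>t. 0 < t \<Longrightarrow> t \<le> 1 \<Longrightarrow> B \<le> v t"
  obtains L where "(v \<longlongrightarrow> L) (at_right 0)" "\<And>t. 0 < t \<Longrightarrow> t \<le> 1 \<Longrightarrow> L \<le> v t"
proof
  define L where "L = Inf (v ` {0<..1})"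
  have bb: "bdd_below (v ` {0<..1})" using bdd by (intro bdd_belowI2[where m = B]) auto
  show le: "L \<le> v t" if "0 < t" "t \<le> 1" for t
    unfolding L_def using that bb by (auto intro!: cInf_lower)
  show "(v \<longlongrightarrow> L) (at_right 0)"
  proof (rule tendstoI)
    fix e :: real assume "e > 0"
    then have "\<exists>y\<in>v ` {0<..1}. y < L + e"
      using cInf_less_iff[OF _ bb, of "L + e"] unfolding L_def by auto
    then obtain t where t: "0 < t" "t \<le> 1" "v t < L + e" by auto
    have "dist (v s) L < e" if "0 < s" "s < t" for s
      using le[of s] mono[of s t] t that by (auto simp: dist_real_def)
    then show "eventually (\<lambda>s. dist (v s) L < e) (at_right 0)"
      unfolding eventually_at_right_field using t by auto
  qed
qed

text \<open>The tail variation \<open>w\<close> is nonincreasing and bounded, so it converges at 0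
  from the right, and it dominates the increments of \<open>g\<close>. This makes the limits in
  \<open>var0\<close> and \<open>jump0\<close> genuine.\<close>

lemma bounded_variation_at_0:
  fixes g :: "real \<Rightarrow> real^'k"
  assumes bv: "bounded_variation_on g 0 1"
  defines "w \<equiv> \<lambda>t. total_variation g t 1"
  shows variation_increment: "\<And>s t. 0 \<le> s \<Longrightarrow> s \<le> t \<Longrightarrow> t \<le> 1 \<Longrightarrow> norm (g t - g s) \<le> w s - w t"
    and var0_upper: "\<And>t. 0 < t \<Longrightarrow> t \<le> 1 \<Longrightarrow> w t \<le> var0 g"
    and jump0_tendsto: "((\<lambda>t. g t - g 0) \<longlongrightarrow> jump0 g) (at_right 0)"
    and total_variation_1: "w 1 = 0"
proof -
  show inc: "norm (g t - g s) \<le> w s - w t" if "0 \<le> s" "s \<le> t" "t \<le> 1" for s t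
  proof (cases "s = t")
    case False
    have "bounded_variation_on g s 1"
      using total_variation_prepend(2)[OF bv, of s] bv that by (cases "s = 0") auto
    from total_variation_prepend(1)[OF this, of t] show ?thesis
      using that False by (simp add: w_def)
  qed simp
  have "- w s \<le> - w t" if "0 \<le> s" "s \<le> t" "t \<le> 1" for s t
    using inc[of s t] norm_ge_zero[of "g t - g s"] that by linarith
  then obtain L where L: "((\<lambda>t. - w t) \<longlongrightarrow> L) (at_right 0)"
    "\<And>t. 0 < t \<Longrightarrow> t \<le> 1 \<Longrightarrow> L \<le> - w t"
    using tendsto_at_right_0_mono[of "\<lambda>t. - w t" "- w 0"] by (metis less_imp_le order_refl)
  have wL: "(w \<longlongrightarrow> - L) (at_right 0)" using tendsto_minus[OF L(1)] by simp
  have v0: "var0 g = - L"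
    unfolding var0_def using tendsto_Lim[OF _ wL] by (simp add: w_def)
  show up: "w t \<le> var0 g" if "0 < t" "t \<le> 1" for t
    using L(2)[OF that] v0 by simp
  have ev1: "eventually (\<lambda>t. 0 < t \<and> t \<le> (1::real)) (at_right 0)"
    unfolding eventually_at_right_field by (rule exI[of _ 1]) auto
  \<comment> \<open>Convergence of \<open>w\<close> is turned into the Cauchy criterion for
    \<open>g\<close>, as an increment of \<open>g\<close> is at most the corresponding decrease of
    \<open>w\<close>.\<close>
  have "cauchy_filter (filtermap g (at_right 0))"
    unfolding cauchy_filter_metric_filtermap
  proof (intro allI impI)
    fix e :: real assume "e > 0"
    have "eventually (\<lambda>t. dist (w t) (var0 g) < e) (at_right 0)"
      using wL v0 \<open>e > 0\<close> tendstoD by metis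
    with ev1 have ev: "eventually (\<lambda>t. 0 < t \<and> t \<le> 1 \<and> dist (w t) (var0 g) < e) (at_right 0)"
      by eventually_elim auto
    have aux: "dist (g s) (g t) < e"
      if "0 < s" "s \<le> t" "t \<le> 1" "dist (w t) (var0 g) < e" for s t
    proof -
      have "norm (g t - g s) \<le> w s - w t" "w s \<le> var0 g" using inc[of s t] up[of s] that by auto
      then show ?thesis using that(4) by (simp add: dist_norm norm_minus_commute)
    qed
    then have "dist (g s) (g t) < e"
      if "0 < s \<and> s \<le> 1 \<and> dist (w s) (var0 g) < e" "0 < t \<and> t \<le> 1 \<and> dist (w t) (var0 g) < e" for s t
      using that by (metis dist_commute linear)
    with ev show "\<exists>P. eventually P (at_right 0) \<and> (\<forall>s t. P s \<and> P t \<longrightarrow> dist (g s) (g t) < e)"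
      by blast
  qed
  then have "\<exists>G. filtermap g (at_right 0) \<le> nhds G"
    by (rule cauchy_filter_complete_converges[OF _ complete_UNIV]) (simp_all add: filtermap_bot_iff)
  then obtain G where G: "(g \<longlongrightarrow> G) (at_right 0)" unfolding filterlim_def by blast
  then have "Lim (at_right 0) g = G" by (intro tendsto_Lim) auto
  then show "((\<lambda>t. g t - g 0) \<longlongrightarrow> jump0 g) (at_right 0)"
    unfolding jump0_def using tendsto_diff[OF G tendsto_const] by simp
  \<comment> \<open>Partition points increase strictly, so the degenerate interval has only the
    partition without cells.\<close>
  have "variation_sums g 1 1 = {0}"
  proof -
    have "n = 0" if "partition_points 1 1 n s" for n and s :: "nat \<Rightarrow> real"
    proof (rule ccontr)
      assume "n \<noteq> 0"
      have "i \<le> n \<Longrightarrow> 0 < i \<Longrightarrow> s 0 < s i" for i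
      proof (induction i)
        case (Suc i)
        then have "s i < s (Suc i)" using that unfolding partition_points_def by auto
        then show ?case using Suc by (cases "i = 0") auto
      qed simp
      from this[of n] show False using that \<open>n \<noteq> 0\<close> unfolding partition_points_def by simp
    qed
    moreover have "partition_points 1 1 0 (\<lambda>_. 1)" by (simp add: partition_points_def)
    ultimately show ?thesis unfolding variation_sums_def by force
  qed
  then show "w 1 = 0" unfolding w_def total_variation_def by simp
qed

text \<open>The function \<open>v\<close> is a monotone majorant of the variation of
  \<open>\<gamma>\<close>. On each cell the Riemann-Stieltjes term differs from the increment of an
  explicit primitive by at most the mesh times a multiple of the increment of \<open>v\<close>;
  these errors telescope.\<close>

lemma has_rs_integral_C1:
  fixes x x' \<gamma> v :: "real \<Rightarrow> real"
  assumes inc: "\<And>s t. a \<le> s \<Longrightarrow> s \<le> t \<Longrightarrow> t \<le> b \<Longrightarrow> \<bar>\<gamma> t - \<gamma> s\<bar> \<le> v t - v s"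
    and ab: "a \<le> b"
    and der: "\<And>t. t \<in> {a..b} \<Longrightarrow> (x has_real_derivative x' t) (at t within {a..b})"
    and cont: "continuous_on {a..b} x'"
  shows "\<exists>I. has_rs_integral x \<gamma> a b I"
proof -
  have "compact (x' ` {a..b})" using cont compact_Icc compact_continuous_image by blast
  then obtain M where M: "\<And>t. t \<in> {a..b} \<Longrightarrow> \<bar>x' t\<bar> \<le> M" "M > 0"
    using compact_imp_bounded bounded_pos by (metis imageI real_norm_def)
  have mono_v: "mono_on {a..b} v"
    using inc by (intro mono_onI) (smt (verit) atLeastAtMost_iff)
  have mono_d: "mono_on {a..b} (\<lambda>t. v t - \<gamma> t)"
  proof (intro mono_onI)
    fix r s assume "r \<in> {a..b}" "s \<in> {a..b}" "r \<le> s"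
    then show "v r - \<gamma> r \<le> v s - \<gamma> s" using inc[of r s] by auto
  qed
  have meas: "\<phi> \<in> borel_measurable (lebesgue_on {a..b})" if "mono_on {a..b} \<phi>" for \<phi> :: "real \<Rightarrow> real"
  proof -
    have "space lborel = space lebesgue" "sets borel \<subseteq> sets lebesgue"
      by force+
    with that show ?thesis
      by (metis borel_measurable_mono_on_fnc borel_measurable_subalgebra mono_restrict_space
          space_lborel space_restrict_space)
  qed
  \<comment> \<open>Jordan decomposition: \<open>\<gamma>\<close> is a difference of monotone
    functions, hence measurable.\<close>
  have "(\<lambda>t. v t - (v t - \<gamma> t)) \<in> borel_measurable (lebesgue_on {a..b})"
    by (rule borel_measurable_diff[OF meas[OF mono_v] meas[OF mono_d]])
  then have meas\<gamma>: "\<gamma> \<in> borel_measurable (lebesgue_on {a..b})" by simp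
  have bou: "bounded (\<gamma> ` {a..b})"
  proof (rule boundedI[where B = "\<bar>\<gamma> a\<bar> + (v b - v a)"])
    fix y assume "y \<in> \<gamma> ` {a..b}"
    then obtain t where t: "t \<in> {a..b}" "y = \<gamma> t" by blast
    then show "norm y \<le> \<bar>\<gamma> a\<bar> + (v b - v a)"
      using inc[of a t] inc[of t b] by auto
  qed
  have "x' absolutely_integrable_on {a..b}"
    using absolutely_integrable_continuous_real[OF cont] .
  then have int: "(\<lambda>t. \<gamma> t * x' t) integrable_on {a..b}"
    using absolutely_integrable_bounded_measurable_product_real[OF meas\<gamma> _ bou]
      set_lebesgue_integral_eq_integral(1) by fastforce
  \<comment> \<open>integration by parts suggests \<open>\<Phi>\<close> as the indefinite integral of \<open>x\<close> with respect to \<open>\<gamma>\<close>\<close>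
  define \<Phi> where "\<Phi> t = x t * \<gamma> t - integral {a..t} (\<lambda>t. \<gamma> t * x' t)" for t
  \<comment> \<open>The error has two parts, one from moving the tag to \<open>d\<close>, one from
    freezing \<open>\<gamma>\<close> at \<open>c\<close> under the integral; each is at most
    \<open>M * (d - c) * (v d - v c)\<close>.\<close>
  have cell: "\<bar>x \<xi> * (\<gamma> d - \<gamma> c) - (\<Phi> d - \<Phi> c)\<bar> \<le> 2 * M * (d - c) * (v d - v c)"
    if "a \<le> c" "c \<le> \<xi>" "\<xi> \<le> d" "d \<le> b" for c d \<xi>
  proof -
    have cd: "c \<le> d" and sub: "{c..d} \<subseteq> {a..b}" using that by auto
    have v: "0 \<le> v d - v c" "\<bar>\<gamma> d - \<gamma> c\<bar> \<le> v d - v c" using inc[of c d] that by auto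
    have intcd: "(\<lambda>t. \<gamma> t * x' t) integrable_on {c..d}"
      using integrable_subinterval_real[OF int sub] .
    have ftc: "(x' has_integral (x d - x c)) {c..d}"
      using der sub cd
      by (intro fundamental_theorem_of_calculus)
        (auto simp: has_real_derivative_iff_has_vector_derivative[symmetric] intro!: DERIV_subset[OF der _])
    have comb: "integral {a..d} (\<lambda>t. \<gamma> t * x' t) - integral {a..c} (\<lambda>t. \<gamma> t * x' t)
      = integral {c..d} (\<lambda>t. \<gamma> t * x' t)"
      using Henstock_Kurzweil_Integration.integral_combine[of a c d "\<lambda>t. \<gamma> t * x' t"] that
        integrable_subinterval_real[OF int, of a d] by auto
    have hi: "((\<lambda>t. \<gamma> t * x' t - \<gamma> c * x' t) has_integral
       (integral {c..d} (\<lambda>t. \<gamma> t * x' t) - \<gamma> c * (x d - x c))) {c..d}"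
      using has_integral_diff[OF integrable_integral[OF intcd] has_integral_mult_right[OF ftc]] .
    have E: "\<bar>integral {c..d} (\<lambda>t. \<gamma> t * x' t) - \<gamma> c * (x d - x c)\<bar> \<le> (v d - v c) * M * (d - c)"
    proof -
      have "norm (\<gamma> t * x' t - \<gamma> c * x' t) \<le> (v d - v c) * M" if t: "t \<in> cbox c d" for t
      proof -
        have "\<bar>\<gamma> t - \<gamma> c\<bar> \<le> v d - v c" using inc[of c t] inc[of t d] t that(1) \<open>d \<le> b\<close> \<open>a \<le> c\<close> by auto
        moreover have "\<bar>x' t\<bar> \<le> M" using M(1) t sub by auto
        ultimately have "\<bar>\<gamma> t - \<gamma> c\<bar> * \<bar>x' t\<bar> \<le> (v d - v c) * M"
          by (intro mult_mono) (use v in auto)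
        then show ?thesis by (simp add: abs_mult[symmetric] left_diff_distrib)
      qed
      from has_integral_bound[OF _ hi[unfolded cbox_interval[symmetric]] this] show ?thesis
        using v M(2) cd by auto
    qed
    have "norm (x d - x \<xi>) \<le> M * norm (d - \<xi>)"
      by (rule field_differentiable_bound[of "{a..b}" x x'])
        (use der M that in \<open>auto simp: has_field_derivative_def\<close>)
    then have "\<bar>x d - x \<xi>\<bar> \<le> M * (d - c)"
      using that M(2) by (smt (verit, best) mult_left_mono real_norm_def)
    then have F: "\<bar>(x \<xi> - x d) * (\<gamma> d - \<gamma> c)\<bar> \<le> M * (d - c) * (v d - v c)"
      unfolding abs_mult using v M(2) cd by (intro mult_mono) auto
    have eq: "x \<xi> * (\<gamma> d - \<gamma> c) - (\<Phi> d - \<Phi> c)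
      = (x \<xi> - x d) * (\<gamma> d - \<gamma> c) + (integral {c..d} (\<lambda>t. \<gamma> t * x' t) - \<gamma> c * (x d - x c))"
      unfolding \<Phi>_def using comb by (simp add: algebra_simps)
    show ?thesis unfolding eq using E F by (auto simp: algebra_simps intro: order_trans[OF abs_triangle_ineq])
  qed
  have "has_rs_integral x \<gamma> a b (\<Phi> b - \<Phi> a)"
    unfolding has_rs_integral_def
  proof (intro allI impI)
    fix e :: real assume "e > 0"
    \<comment> \<open>The summand 1 keeps \<open>K\<close> positive if \<open>v\<close> is constant
      and leaves room for a strict inequality.\<close>
    define K where "K = 2 * M * (v b - v a) + 1"
    have vab: "v b - v a \<ge> 0" using inc[of a b] ab by auto
    then have K: "K > 0" using M unfolding K_def by (simp add: add_nonneg_pos)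
    show "\<exists>\<delta>>0. \<forall>n s \<xi>. partition_points a b n s \<longrightarrow>
        (\<forall>i<n. s (Suc i) - s i < \<delta> \<and> \<xi> i \<in> {s i..s (Suc i)}) \<longrightarrow>
        \<bar>(\<Sum>i<n. x (\<xi> i) * (\<gamma> (s (Suc i)) - \<gamma> (s i))) - (\<Phi> b - \<Phi> a)\<bar> < e"
    proof (intro exI[of _ "e / K"] conjI allI impI)
      show "e / K > 0" using \<open>e > 0\<close> K by simp
      fix n s \<xi>
      assume p: "partition_points a b n s"
        and fine: "\<forall>i<n. s (Suc i) - s i < e / K \<and> \<xi> i \<in> {s i..s (Suc i)}"
      have s_mono: "i \<le> j \<Longrightarrow> j \<le> n \<Longrightarrow> s i \<le> s j" for i j
      proof (induction j)
        case (Suc j)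
        then show ?case using p unfolding partition_points_def
          by (cases "i = Suc j") (auto, smt (verit) Suc_le_eq le_SucE less_or_eq_imp_le)
      qed simp
      have rng: "a \<le> s i" "s i \<le> b" if "i \<le> n" for i
        using s_mono[of 0 i] s_mono[of i n] that p unfolding partition_points_def by auto
      have tel: "(\<Sum>i<n. F (s (Suc i)) - F (s i)) = F b - F a" for F :: "real \<Rightarrow> real"
        using sum_lessThan_telescope[of "\<lambda>i. F (s i)" n] p unfolding partition_points_def by simp
      have "\<bar>(\<Sum>i<n. x (\<xi> i) * (\<gamma> (s (Suc i)) - \<gamma> (s i))) - (\<Phi> b - \<Phi> a)\<bar>
        = \<bar>\<Sum>i<n. x (\<xi> i) * (\<gamma> (s (Suc i)) - \<gamma> (s i)) - (\<Phi> (s (Suc i)) - \<Phi> (s i))\<bar>"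
        by (simp add: sum_subtractf[of _ _ "{..<n}"] tel[symmetric])
      also have "\<dots> \<le> (\<Sum>i<n. 2 * M * (e / K) * (v (s (Suc i)) - v (s i)))"
      proof (rule order_trans[OF sum_abs], rule sum_mono)
        fix i assume i: "i \<in> {..<n}"
        then have b: "a \<le> s i" "s i \<le> \<xi> i" "\<xi> i \<le> s (Suc i)" "s (Suc i) \<le> b" "s (Suc i) - s i < e / K"
          using fine rng[of i] rng[of "Suc i"] by auto
        have "v (s (Suc i)) - v (s i) \<ge> 0" using inc[of "s i" "s (Suc i)"] b by auto
        then have "2 * M * (s (Suc i) - s i) * (v (s (Suc i)) - v (s i))
          \<le> 2 * M * (e / K) * (v (s (Suc i)) - v (s i))"
          using b M by (intro mult_right_mono mult_left_mono) auto
        with cell[OF b(1-4)]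
        show "\<bar>x (\<xi> i) * (\<gamma> (s (Suc i)) - \<gamma> (s i)) - (\<Phi> (s (Suc i)) - \<Phi> (s i))\<bar>
          \<le> 2 * M * (e / K) * (v (s (Suc i)) - v (s i))" by linarith
      qed
      also have "\<dots> = (e / K) * (K - 1)"
        unfolding sum_distrib_left[symmetric] tel by (simp add: K_def)
      also have "\<dots> < e" using K \<open>e > 0\<close> by (simp add: field_simps)
      finally show "\<bar>(\<Sum>i<n. x (\<xi> i) * (\<gamma> (s (Suc i)) - \<gamma> (s i))) - (\<Phi> b - \<Phi> a)\<bar> < e" .
    qed
  qed
  then show ?thesis by blast
qed

section \<open>Delayed approximations of the Cauchy problem\<close>

lemma continuous_on_lipschitz_snd:
  fixes y :: "'a::metric_space \<Rightarrow> real \<Rightarrow> 'b::real_normed_vector"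
  assumes lip: "\<And>c s t. s \<in> T \<Longrightarrow> t \<in> T \<Longrightarrow> norm (y c t - y c s) \<le> M * \<bar>t - s\<bar>"
    and cont: "\<And>t. t \<in> T \<Longrightarrow> continuous_on S (\<lambda>c. y c t)"
  shows "continuous_on (S \<times> T) (\<lambda>(c, t). y c t)"
  unfolding continuous_on_iff
proof (intro ballI allI impI)
  fix p and e :: real assume "p \<in> S \<times> T" and e: "e > 0"
  then obtain c t where p: "p = (c, t)" "c \<in> S" "t \<in> T" by auto
  obtain d where d: "d > 0" "\<And>c'. c' \<in> S \<Longrightarrow> dist c' c < d \<Longrightarrow> dist (y c' t) (y c t) < e / 2"
    using cont[OF p(3)] p(2) e unfolding continuous_on_iff by (metis half_gt_zero)
  define d2 where "d2 = min d (e / (2 * (\<bar>M\<bar> + 1)))"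
  have "d2 > 0" unfolding d2_def using d(1) e by (auto intro!: divide_pos_pos)
  moreover have "dist (y c' t') (y c t) < e" if "c' \<in> S" "t' \<in> T" "dist (c', t') (c, t) < d2" for c' t'
  proof -
    have "dist c' c < d" "\<bar>t' - t\<bar> < e / (2 * (\<bar>M\<bar> + 1))"
      using that(3) dist_fst_le[of "(c', t')" "(c, t)"] dist_snd_le[of "(c', t')" "(c, t)"]
      unfolding d2_def by (auto simp: dist_real_def)
    then have "M * \<bar>t' - t\<bar> \<le> (\<bar>M\<bar> + 1) * (e / (2 * (\<bar>M\<bar> + 1)))"
      by (intro mult_mono) auto
    also have "\<dots> = e / 2" using abs_ge_zero[of M] by (simp add: field_simps del: abs_ge_zero)
    finally have "norm (y c' t' - y c' t) \<le> e / 2"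
      using lip[OF p(3) that(2), of c'] by simp
    moreover have "dist (y c' t) (y c t) < e / 2" using d(2) that(1) \<open>dist c' c < d\<close> by blast
    ultimately show ?thesis using dist_triangle[of "y c' t'" "y c t" "y c' t"] by (simp add: dist_norm)
  qed
  ultimately show "\<exists>d>0. \<forall>x'\<in>S \<times> T. dist x' p < d \<longrightarrow>
      dist (case x' of (c, t) \<Rightarrow> y c t) (case p of (c, t) \<Rightarrow> y c t) < e"
    unfolding p(1) by auto
qed

text \<open>Iterates of Tonelli's delayed integral operator; they become stationary on \<open>t \<le> j d\<close>.
  For \<open>t \<le> 0\<close> the integral is over a null set, so the value is \<open>c\<close>.\<close>

primrec tonelli :: "(real \<Rightarrow> 'a \<Rightarrow> 'a) \<Rightarrow> real \<Rightarrow> nat \<Rightarrow> 'a \<Rightarrow> real \<Rightarrow> 'a::euclidean_space" where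
  "tonelli F d 0 c t = c"
| "tonelli F d (Suc j) c t = c + integral {0..t} (\<lambda>s. F s (tonelli F d j c (s - d)))"

lemma integral_Icc_nonpos: "t \<le> 0 \<Longrightarrow> integral {0..t::real} f = 0"
  by (cases "t = 0") auto

lemma tonelli_nonpos: "t \<le> 0 \<Longrightarrow> tonelli F d j c t = c"
  by (cases j) (auto simp: integral_Icc_nonpos)

text \<open>With delay \<open>1 / (n + 1)\<close>, the iterate of index \<open>n + 1\<close> is
  stationary up to time 1, so there it solves the delayed equation exactly
  (\<open>delayed_solution_eq\<close>).\<close>

definition delayed_solution :: "(real \<Rightarrow> 'a \<Rightarrow> 'a) \<Rightarrow> nat \<Rightarrow> 'a \<Rightarrow> real \<Rightarrow> 'a::euclidean_space" where
  "delayed_solution F n = tonelli F (1 / real (Suc n)) (Suc n)"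

lemma delayed_solution_0: "delayed_solution F n c 0 = c"
  unfolding delayed_solution_def by (rule tonelli_nonpos) simp

context
  fixes F :: "real \<Rightarrow> 'a::euclidean_space \<Rightarrow> 'a" and M :: real
  assumes F_cont: "continuous_on ({0..1} \<times> UNIV) (\<lambda>(t, x). F t x)"
    and F_bound: "\<And>t x. t \<in> {0..1} \<Longrightarrow> norm (F t x) \<le> M"
begin

lemma continuous_on_F_comp:
  assumes "continuous_on S u" "continuous_on S v" "\<And>x. x \<in> S \<Longrightarrow> u x \<in> {0..1}"
  shows "continuous_on S (\<lambda>x. F (u x) (v x))"
proof -
  have "(\<lambda>x. (u x, v x)) ` S \<subseteq> {0..1} \<times> UNIV" using assms(3) by auto
  from continuous_on_compose2[OF F_cont continuous_on_Pair[OF assms(1,2)] this] show ?thesis by simp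
qed

lemma bound_nonneg: "M \<ge> 0"
  by (rule order_trans[OF norm_ge_zero F_bound[of 0 0]]) simp

text \<open>The two claims are proved together since the next iterate needs joint continuity of the
  present one, and this follows from a Lipschitz bound in time plus continuity in the initial value.
  Times range over \<open>{..1}\<close> because the delay produces negative arguments.\<close>

lemma tonelli_lipschitz_continuous:
  assumes d: "d \<ge> 0"
  shows "(\<forall>c. \<forall>s\<in>{..1}. \<forall>t\<in>{..1}. norm (tonelli F d j c t - tonelli F d j c s) \<le> M * \<bar>t - s\<bar>) \<and>
    (\<forall>t\<in>{..1}. continuous_on UNIV (\<lambda>c. tonelli F d j c t))"
proof (induction j)
  case 0
  show ?case using bound_nonneg by (auto intro!: continuous_intros)
next
  case (Suc j)
  note M = bound_nonneg
  have joint: "continuous_on (UNIV \<times> {..1}) (\<lambda>(c, t). tonelli F d j c t)"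
    by (rule continuous_on_lipschitz_snd[of _ _ M]) (use Suc in auto)
  have delayed: "continuous_on (UNIV \<times> {0..1}) (\<lambda>p. tonelli F d j (fst p) (snd p - d))"
  proof -
    have "continuous_on (UNIV \<times> {0..1}) (\<lambda>p :: 'a \<times> real. (fst p, snd p - d))"
      by (intro continuous_intros)
    moreover have "(\<lambda>p :: 'a \<times> real. (fst p, snd p - d)) ` (UNIV \<times> {0..1}) \<subseteq> UNIV \<times> {..1}"
      using d by auto
    ultimately show ?thesis using continuous_on_compose2[OF joint] by fastforce
  qed
  have integrand: "continuous_on (UNIV \<times> {0..1}) (\<lambda>p. F (snd p) (tonelli F d j (fst p) (snd p - d)))"
    by (rule continuous_on_F_comp[OF _ delayed]) (auto intro!: continuous_intros)
  have int: "(\<lambda>s. F s (tonelli F d j c (s - d))) integrable_on {a..b}" if "0 \<le> a" "b \<le> 1" for a b c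
  proof (rule integrable_continuous_real)
    have "continuous_on {a..b} (\<lambda>s. (c, s))" by (intro continuous_intros)
    moreover have "(\<lambda>s. (c, s)) ` {a..b} \<subseteq> UNIV \<times> {0..1}" using that by auto
    ultimately have "continuous_on {a..b} (\<lambda>s. (\<lambda>p. F (snd p) (tonelli F d j (fst p) (snd p - d))) (c, s))"
      by (rule continuous_on_compose2[OF integrand])
    then show "continuous_on {a..b} (\<lambda>s. F s (tonelli F d j c (s - d)))" by simp
  qed
  define I where "I c t = integral {0..t} (\<lambda>s. F s (tonelli F d j c (s - d)))" for c t
  have I_mono: "norm (I c t - I c s) \<le> M * (t - s)" if "0 \<le> s" "s \<le> t" "t \<le> 1" for c s t
  proof -
    have "I c t - I c s = integral {s..t} (\<lambda>s. F s (tonelli F d j c (s - d)))"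
      unfolding I_def
      using Henstock_Kurzweil_Integration.integral_combine[OF that(1,2) int[of 0 t c], symmetric] that by simp
    moreover have "norm (integral (cbox s t) (\<lambda>s. F s (tonelli F d j c (s - d)))) \<le> M * measure lborel (cbox s t)"
      using int[of s t c] that F_bound M by (intro integrable_bound) auto
    ultimately show ?thesis using that by (simp add: mult.commute)
  qed
  have I_nonpos: "I c t = I c (max 0 t)" for c t
    unfolding I_def by (cases "t \<le> 0") (auto simp: integral_Icc_nonpos)
  have lip: "norm (I c t - I c s) \<le> M * \<bar>t - s\<bar>" if "s \<le> 1" "t \<le> 1" for c s t
  proof -
    have aux: "norm (I c t - I c s) \<le> M * \<bar>t - s\<bar>" if "s \<le> t" "t \<le> 1" for s t
    proof -
      have "norm (I c t - I c s) \<le> M * (max 0 t - max 0 s)"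
        unfolding I_nonpos[of c t] I_nonpos[of c s] using that by (intro I_mono) auto
      also have "\<dots> \<le> M * \<bar>t - s\<bar>" using M that by (intro mult_left_mono) auto
      finally show ?thesis .
    qed
    show ?thesis using aux[of s t] aux[of t s] that by (cases "s \<le> t") (auto simp: norm_minus_commute abs_minus_commute)
  qed
  have contI: "continuous_on UNIV (\<lambda>c. I c t)" if "t \<le> 1" for t
  proof -
    have "continuous_on (UNIV \<times> cbox 0 (max 0 t)) (\<lambda>(c, s). F s (tonelli F d j c (s - d)))"
      unfolding case_prod_unfold
      by (rule continuous_on_subset[OF integrand]) (use that in auto)
    from integral_continuous_on_param[OF this] show ?thesis
      unfolding I_nonpos[of _ t] unfolding I_def by simp
  qed
  show ?case
    using lip contI by (auto simp: I_def[symmetric] intro!: continuous_intros)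
qed

lemma tonelli_joint_continuous:
  "d \<ge> 0 \<Longrightarrow> continuous_on (UNIV \<times> {..1}) (\<lambda>(c, t). tonelli F d j c t)"
  by (rule continuous_on_lipschitz_snd[of _ _ M]) (use tonelli_lipschitz_continuous in auto)

text \<open>Up to time \<open>(j + 1) d\<close> the integrand looks back only to times at most
  \<open>j d\<close>, where the iterates already agree.\<close>

lemma tonelli_stationary:
  assumes d: "d \<ge> 0"
  shows "t \<le> real j * d \<Longrightarrow> t \<le> 1 \<Longrightarrow> tonelli F d (Suc j) c t = tonelli F d j c t"
proof (induction j arbitrary: t)
  case 0
  then show ?case by (simp add: integral_Icc_nonpos)
next
  case (Suc j)
  have "integral {0..t} (\<lambda>s. F s (tonelli F d (Suc j) c (s - d))) = integral {0..t} (\<lambda>s. F s (tonelli F d j c (s - d)))"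
  proof (rule Henstock_Kurzweil_Integration.integral_cong)
    fix s assume s: "s \<in> {0..t}"
    then have "tonelli F d (Suc j) c (s - d) = tonelli F d j c (s - d)"
      using Suc.prems d by (intro Suc.IH) (auto simp: algebra_simps)
    then show "F s (tonelli F d (Suc j) c (s - d)) = F s (tonelli F d j c (s - d))" by simp
  qed
  then show ?case by simp
qed

lemma delayed_solution_eq:
  assumes "t \<le> 1"
  shows "delayed_solution F n c t = c + integral {0..t} (\<lambda>s. F s (delayed_solution F n c (s - 1 / real (Suc n))))"
  using tonelli_stationary[of "1 / real (Suc n)" t "Suc n" c] assms unfolding delayed_solution_def by simp

lemma delayed_solution_lipschitz:
  "s \<le> 1 \<Longrightarrow> t \<le> 1 \<Longrightarrow> norm (delayed_solution F n c t - delayed_solution F n c s) \<le> M * \<bar>t - s\<bar>"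
  using tonelli_lipschitz_continuous[of "1 / real (Suc n)" "Suc n"] unfolding delayed_solution_def
  by (auto simp del: tonelli.simps)

lemma delayed_solution_continuous: "t \<le> 1 \<Longrightarrow> continuous_on UNIV (\<lambda>c. delayed_solution F n c t)"
  using tonelli_lipschitz_continuous[of "1 / real (Suc n)" "Suc n"] unfolding delayed_solution_def
  by (auto simp del: tonelli.simps)

text \<open>The functions are bounded and share the Lipschitz constant \<open>M\<close>, so
  Arzela-Ascoli gives a uniform limit. The delay tends to 0, and dominated convergence takes the
  integral equation to the limit.\<close>

lemma delayed_solution_limit:
  fixes c :: "nat \<Rightarrow> 'a"
  assumes c: "\<And>n. norm (c n) \<le> R"
  obtains x k where "strict_mono (k :: nat \<Rightarrow> nat)" "continuous_on {0..1} x"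
    "\<And>e. e > 0 \<Longrightarrow> \<exists>N. \<forall>n\<ge>N. \<forall>t\<in>{0..1}. norm (delayed_solution F (k n) (c (k n)) t - x t) < e"
    "\<And>t. t \<in> {0..1} \<Longrightarrow> (x has_vector_derivative F t (x t)) (at t within {0..1})"
proof -
  define X where "X n = delayed_solution F n (c n)" for n
  note M = bound_nonneg
  have lip: "norm (X n t - X n s) \<le> M * \<bar>t - s\<bar>" if "s \<le> 1" "t \<le> 1" for n s t
    unfolding X_def by (rule delayed_solution_lipschitz[OF that])
  have bound: "norm (X n t) \<le> R + M" if "t \<in> {0..1}" for n t
  proof -
    have "norm (X n t - X n 0) \<le> M * 1"
      using lip[of 0 t n] that M by (auto intro: order_trans mult_left_le)
    moreover have "norm (X n 0) \<le> R" using c by (simp add: X_def delayed_solution_0)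
    ultimately show ?thesis using norm_triangle_ineq2[of "X n t" "X n 0"] by simp
  qed
  have equi: "\<exists>\<delta>. 0 < \<delta> \<and> (\<forall>n s. s \<in> {0..1} \<and> norm (t - s) < \<delta> \<longrightarrow> norm (X n t - X n s) < e)"
    if "t \<in> {0..1}" "0 < e" for t e :: real
  proof (intro exI conjI allI impI)
    show "0 < e / (M + 1)" using that M by simp
    fix n s assume s: "s \<in> {0..1} \<and> norm (t - s) < e / (M + 1)"
    have "norm (X n t - X n s) \<le> M * \<bar>t - s\<bar>" using lip[of s t n] s that by simp
    also have "\<dots> \<le> M * (e / (M + 1))" using s M by (intro mult_left_mono) auto
    also have "\<dots> < e" using M that by (simp add: field_simps)
    finally show "norm (X n t - X n s) < e" .
  qed
  obtain x k where x: "continuous_on {0..1} x" and k: "strict_mono (k :: nat \<Rightarrow> nat)"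
    and unif: "\<And>e. 0 < e \<Longrightarrow> \<exists>N. \<forall>n t. n \<ge> N \<and> t \<in> {0..1} \<longrightarrow> norm (X (k n) t - x t) < e"
    using Arzela_Ascoli[of "{0..1}" X "R + M", OF compact_Icc bound equi] by blast
  have conv: "(\<lambda>n. X (k n) t) \<longlonglongrightarrow> x t" if "t \<in> {0..1}" for t
    unfolding LIMSEQ_iff using unif that by blast
  have small: "(\<lambda>n. 1 / real (Suc (k n))) \<longlonglongrightarrow> 0"
    using LIMSEQ_subseq_LIMSEQ[OF LIMSEQ_inverse_real_of_nat k] by (simp add: comp_def inverse_eq_divide)
  \<comment> \<open>By the Lipschitz bound the delay costs at most \<open>M\<close> times its
    length, also at negative times.\<close>
  have conv_delayed: "(\<lambda>n. X (k n) (s - 1 / real (Suc (k n)))) \<longlonglongrightarrow> x s" if "s \<in> {0..1}" for s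
  proof -
    have "(\<lambda>n. X (k n) (s - 1 / real (Suc (k n))) - X (k n) s) \<longlonglongrightarrow> 0"
    proof (rule Lim_null_comparison)
      show "\<forall>\<^sub>F n in sequentially. norm (X (k n) (s - 1 / real (Suc (k n))) - X (k n) s) \<le> M * (1 / real (Suc (k n)))"
      proof (intro always_eventually allI)
        fix n
        have pos: "0 \<le> 1 / real (Suc (k n))" by simp
        then have "s - 1 / real (Suc (k n)) \<le> 1" using that unfolding atLeastAtMost_iff by linarith
        with lip[of s "s - 1 / real (Suc (k n))" "k n"] that pos
        show "norm (X (k n) (s - 1 / real (Suc (k n))) - X (k n) s) \<le> M * (1 / real (Suc (k n)))"
          by (simp del: of_nat_Suc)
      qed
      show "(\<lambda>n. M * (1 / real (Suc (k n)))) \<longlonglongrightarrow> 0" using tendsto_mult_right_zero[OF small] .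
    qed
    from tendsto_add[OF this conv[OF that]] show ?thesis by simp
  qed
  have integral_eq: "x t = x 0 + integral {0..t} (\<lambda>s. F s (x s))" if t: "t \<in> {0..1}" for t
  proof -
    have int: "(\<lambda>s. F s (X n (s - 1 / real (Suc n)))) integrable_on {0..t}" for n
    proof -
      have "continuous_on {0..t} (\<lambda>s. X n (s - 1 / real (Suc n)))"
      proof -
        have "continuous_on {0..t} (\<lambda>s. (c n, s - 1 / real (Suc n)))" by (intro continuous_intros)
        moreover have "(\<lambda>s. (c n, s - 1 / real (Suc n))) ` {0..t} \<subseteq> UNIV \<times> {..1}"
        proof (intro image_subsetI SigmaI UNIV_I)
          fix s assume "s \<in> {0..t}"
          then have "s \<le> 1" "0 \<le> 1 / real (Suc n)" using t by auto
          then show "s - 1 / real (Suc n) \<in> {..1}" unfolding atMost_iff by linarith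
        qed
        ultimately have "continuous_on {0..t} (\<lambda>s. (\<lambda>(c, t). tonelli F (1 / real (Suc n)) (Suc n) c t) (c n, s - 1 / real (Suc n)))"
          by (rule continuous_on_compose2[OF tonelli_joint_continuous[OF zero_le_divide_1_iff[THEN iffD2, OF of_nat_0_le_iff]]])
        then show ?thesis unfolding X_def delayed_solution_def prod.case .
      qed
      then show ?thesis
        using t by (intro integrable_continuous_real continuous_on_F_comp continuous_on_id) auto
    qed
    have "(\<lambda>n. integral {0..t} (\<lambda>s. F s (X (k n) (s - 1 / real (Suc (k n)))))) \<longlonglongrightarrow> integral {0..t} (\<lambda>s. F s (x s))"
    proof (rule dominated_convergence(2)[where h = "\<lambda>_. M"])
      show "(\<lambda>s. F s (X (k n) (s - 1 / real (Suc (k n))))) integrable_on {0..t}" for n by (rule int)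
      show "norm (F s (X (k n) (s - 1 / real (Suc (k n))))) \<le> M" if "s \<in> {0..t}" for n s
        using that t by (intro F_bound) auto
      show "(\<lambda>n. F s (X (k n) (s - 1 / real (Suc (k n))))) \<longlonglongrightarrow> F s (x s)" if "s \<in> {0..t}" for s
      proof -
        have s: "s \<in> {0..1}" using that t by auto
        have "continuous_on UNIV (F s)" by (rule continuous_on_F_comp[OF continuous_on_const continuous_on_id]) (use s in auto)
        then have "isCont (F s) (x s)" by (simp add: continuous_on_eq_continuous_at)
        from isCont_tendsto_compose[OF this conv_delayed[OF s]] show ?thesis .
      qed
    qed auto
    moreover have "(\<lambda>n. c (k n)) \<longlonglongrightarrow> x 0"
      using conv[of 0] unfolding X_def delayed_solution_0 by simp
    ultimately have "(\<lambda>n. c (k n) + integral {0..t} (\<lambda>s. F s (X (k n) (s - 1 / real (Suc (k n)))))) \<longlonglongrightarrow>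
      x 0 + integral {0..t} (\<lambda>s. F s (x s))" by (intro tendsto_add)
    moreover have "c (k n) + integral {0..t} (\<lambda>s. F s (X (k n) (s - 1 / real (Suc (k n))))) = X (k n) t" for n
      using delayed_solution_eq[of t "k n" "c (k n)"] t unfolding X_def by simp
    ultimately show ?thesis using LIMSEQ_unique[OF conv[OF t]] by simp
  qed
  show thesis
  proof (rule that[OF k x])
    show "\<exists>N. \<forall>n\<ge>N. \<forall>t\<in>{0..1}. norm (delayed_solution F (k n) (c (k n)) t - x t) < e" if "e > 0" for e
      using unif[OF that] unfolding X_def by blast
    show "(x has_vector_derivative F t (x t)) (at t within {0..1})" if t: "t \<in> {0..1}" for t
    proof -
      have "continuous_on {0..1} (\<lambda>s. F s (x s))" by (rule continuous_on_F_comp[OF continuous_on_id x]) auto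
      from integral_has_vector_derivative[OF this t]
      have "((\<lambda>t. x 0 + integral {0..t} (\<lambda>s. F s (x s))) has_vector_derivative F t (x t)) (at t within {0..1})"
        by (auto intro!: derivative_eq_intros)
      from has_vector_derivative_transform[OF t integral_eq this] show ?thesis .
    qed
  qed
qed

end

definition radial_proj :: "real \<Rightarrow> 'a::real_normed_vector \<Rightarrow> 'a" where
  "radial_proj R x = (R / max R (norm x)) *\<^sub>R x"

lemma radial_proj:
  assumes "R > 0"
  shows "norm (radial_proj R x) \<le> R" "norm x \<le> R \<Longrightarrow> radial_proj R x = x"
    "R \<le> norm x \<Longrightarrow> norm (radial_proj R x) = R \<and> x = (norm x / R) *\<^sub>R radial_proj R x"
proof -
  show "norm (radial_proj R x) \<le> R"
    using assms by (auto simp: radial_proj_def max_def field_simps)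
  show "norm x \<le> R \<Longrightarrow> radial_proj R x = x"
    using assms by (simp add: radial_proj_def max_absorb1)
  assume "R \<le> norm x"
  moreover from this have "norm x > 0" using assms by linarith
  ultimately show "norm (radial_proj R x) = R \<and> x = (norm x / R) *\<^sub>R radial_proj R x"
    using assms by (simp add: radial_proj_def max_absorb2)
qed

lemma continuous_on_radial_proj: "R > 0 \<Longrightarrow> continuous_on S (radial_proj R)"
  unfolding radial_proj_def[abs_def] by (intro continuous_intros) auto

text \<open>Outside the ball \<open>x\<close> is a positive multiple of its projection, so the
  boundary condition gives the derivative of \<open>x \<bullet> x\<close> a sign. Hence the squared
  positive part \<open>V\<close> of \<open>x \<bullet> x - R\<^sup>2\<close> cannot grow from its
  initial value 0. Only derivatives at interior times enter, which fits the condition on positive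
  times.\<close>

lemma solution_in_cball:
  fixes f :: "real \<Rightarrow> 'a::euclidean_space \<Rightarrow> 'a"
  assumes der: "\<And>t. t \<in> {0..1} \<Longrightarrow> (x has_vector_derivative f t (radial_proj R (x t))) (at t within {0..1})"
    and inward: "\<And>t y. t \<in> {0<..1} \<Longrightarrow> norm y = R \<Longrightarrow> f t y \<bullet> y \<le> 0"
    and R: "R > 0" and x0: "norm (x 0) \<le> R" and t: "t \<in> {0..1}"
  shows "norm (x t) \<le> R"
proof -
  define V where "V t = (max 0 (x t \<bullet> x t - R\<^sup>2))\<^sup>2" for t
  have "continuous_on {0..1} x"
    using der by (intro continuous_on_vector_derivative) auto
  then have cV: "continuous_on {0..t} V"
    unfolding V_def using t by (intro continuous_intros) (auto elim: continuous_on_subset)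
  have "V 0 \<ge> V t"
  proof (rule DERIV_nonpos_imp_decreasing_open[OF _ _ cV])
    show "0 \<le> t" using t by simp
    fix s assume s: "0 < s" "s < t"
    define v where "v = f s (radial_proj R (x s))"
    have "at s within {0..1} = at s" using s t by (intro at_within_Icc_at) auto
    then have "(x has_derivative (\<lambda>h. h *\<^sub>R v)) (at s)"
      using der[of s] s t unfolding v_def has_vector_derivative_def by auto
    then have "((\<lambda>s. x s \<bullet> x s - R\<^sup>2) has_derivative (\<lambda>h. 2 * (v \<bullet> x s) * h)) (at s)"
      by (auto intro!: derivative_eq_intros simp: inner_commute)
    then have "((\<lambda>s. x s \<bullet> x s - R\<^sup>2) has_real_derivative 2 * (v \<bullet> x s)) (at s)"
      unfolding has_field_derivative_def .
    from DERIV_chain2[OF has_real_derivative_max0_power2 this]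
    have "DERIV V s :> 2 * max 0 (x s \<bullet> x s - R\<^sup>2) * (2 * (v \<bullet> x s))"
      unfolding V_def .
    moreover have "2 * max 0 (x s \<bullet> x s - R\<^sup>2) * (2 * (v \<bullet> x s)) \<le> 0"
    proof (cases "norm (x s) \<le> R")
      case True
      then have "x s \<bullet> x s \<le> R\<^sup>2" by (simp add: dot_square_norm power_mono)
      then show ?thesis by simp
    next
      case False
      then have P: "norm (radial_proj R (x s)) = R" "x s = (norm (x s) / R) *\<^sub>R radial_proj R (x s)"
        using radial_proj(3)[OF R, of "x s"] by auto
      have "v \<bullet> x s = (norm (x s) / R) * (v \<bullet> radial_proj R (x s))"
        by (subst P(2)) simp
      also have "\<dots> \<le> 0"
        using inward[OF _ P(1), of s] s t R unfolding v_def by (intro mult_nonneg_nonpos) auto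
      finally show ?thesis by (intro mult_nonneg_nonpos) auto
    qed
    ultimately show "\<exists>y. DERIV V s :> y \<and> y \<le> 0" by blast
  qed
  moreover have "V 0 = 0"
    using x0 unfolding V_def by (simp add: dot_square_norm power_mono)
  ultimately have "max 0 (x t \<bullet> x t - R\<^sup>2) = 0" unfolding V_def by simp
  then have "(norm (x t))\<^sup>2 \<le> R\<^sup>2" by (simp add: dot_square_norm)
  then show ?thesis using R by (simp add: power2_le_iff_abs_le)
qed

section \<open>The boundary value problem\<close>

lemma homotopic_with_canonI:
  assumes "continuous_on ({0..1::real} \<times> S) H" "H ` ({0..1} \<times> S) \<subseteq> T"
    and "\<And>x. x \<in> S \<Longrightarrow> H (0, x) = p x" "\<And>x. x \<in> S \<Longrightarrow> H (1, x) = q x"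
  shows "homotopic_with_canon (\<lambda>_. True) S T p q"
proof -
  have "continuous_map (prod_topology (top_of_set {0..1}) (top_of_set S)) (top_of_set T) H"
    using assms(1,2) by (simp add: image_subset_iff_funcset flip: subtopology_Times)
  then show ?thesis
    using assms(3,4) by (subst homotopic_with) (auto intro!: exI[of _ H])
qed

section \<open>Componentwise product and Riemann-Stieltjes sums\<close>

lemma norm_vec_le_of_components:
  fixes a b :: "real^'k"
  assumes "\<And>i. \<bar>a $ i\<bar> \<le> \<bar>b $ i\<bar>"
  shows "norm a \<le> norm b"
  unfolding norm_vec_def using assms by (intro L2_set_mono) auto

lemma norm_times_vec_le: "norm (a * b) \<le> norm a * norm b" for a b :: "real^'k"
proof -
  have "norm (a * b) \<le> norm (norm a *\<^sub>R b)"
    by (rule norm_vec_le_of_components)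
      (auto simp: abs_mult intro!: mult_right_mono component_le_norm_cart)
  then show ?thesis by simp
qed

lemma norm_times_vec_ge:
  fixes a b :: "real^'k"
  assumes "\<And>i. m \<le> \<bar>b $ i\<bar>" "0 \<le> m"
  shows "norm a * m \<le> norm (a * b)"
proof -
  have "norm (m *\<^sub>R a) \<le> norm (a * b)"
  proof (rule norm_vec_le_of_components)
    fix i
    show "\<bar>(m *\<^sub>R a) $ i\<bar> \<le> \<bar>(a * b) $ i\<bar>"
      using mult_right_mono[OF assms(1)[of i] abs_ge_zero[of "a $ i"]] assms(2) by (simp add: abs_mult mult.commute)
  qed
  then show ?thesis using assms(2) by (simp add: mult.commute)
qed

lemma bounded_bilinear_times_vec: "bounded_bilinear ((*) :: real^'k \<Rightarrow> real^'k \<Rightarrow> real^'k)"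
proof
  show "\<exists>K. \<forall>a b. norm (a * b :: real^'k) \<le> norm a * norm b * K"
    by (intro exI[of _ 1]) (simp add: norm_times_vec_le)
qed (simp_all add: vec_eq_iff algebra_simps)

lemmas tendsto_times_vec = bounded_bilinear.tendsto[OF bounded_bilinear_times_vec]
lemmas continuous_on_times_vec = bounded_bilinear.continuous_on[OF bounded_bilinear_times_vec]

text \<open>Left tags are chosen so that the first summand is \<open>u 0\<close> times an increment
  of \<open>g\<close> from 0, the one that carries the jump.\<close>

lemma has_rs_integral_uniform_sums:
  assumes "has_rs_integral u g 0 1 I"
  shows "(\<lambda>n. \<Sum>i<Suc n. u (i / Suc n) * (g (Suc i / Suc n) - g (i / Suc n))) \<longlonglongrightarrow> I"
proof (rule LIMSEQ_I)
  fix e :: real assume "e > 0"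
  then obtain d where d: "d > 0" "\<And>n s \<xi>. partition_points 0 1 n s \<Longrightarrow>
      (\<forall>i<n. s (Suc i) - s i < d \<and> \<xi> i \<in> {s i..s (Suc i)}) \<Longrightarrow>
      \<bar>(\<Sum>i<n. u (\<xi> i) * (g (s (Suc i)) - g (s i))) - I\<bar> < e"
    using assms unfolding has_rs_integral_def by blast
  obtain N where N: "inverse (real (Suc N)) < d" using reals_Archimedean[OF d(1)] by blast
  show "\<exists>N. \<forall>n\<ge>N. norm ((\<Sum>i<Suc n. u (i / Suc n) * (g (Suc i / Suc n) - g (i / Suc n))) - I) < e"
  proof (intro exI allI impI)
    fix n assume "n \<ge> N"
    then have "inverse (real (Suc n)) \<le> inverse (real (Suc N))" by (intro le_imp_inverse_le) auto
    then have small: "inverse (real (Suc n)) < d" using N by linarith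
    define s where "s i = real i / real (Suc n)" for i
    have step: "s (Suc i) - s i = inverse (real (Suc n))" for i
      unfolding s_def by (simp add: diff_divide_distrib[symmetric] inverse_eq_divide)
    have pos: "inverse (real (Suc n)) > 0" by simp
    have less: "s i < s (Suc i)" for i using step[of i] pos by linarith
    have "partition_points 0 1 (Suc n) s"
      unfolding partition_points_def using less by (auto simp: s_def)
    moreover have "\<forall>i<Suc n. s (Suc i) - s i < d \<and> s i \<in> {s i..s (Suc i)}"
      using small less by (auto simp: step less_imp_le simp del: of_nat_Suc)
    ultimately show "norm ((\<Sum>i<Suc n. u (i / Suc n) * (g (Suc i / Suc n) - g (i / Suc n))) - I) < e"
      using d(2)[of "Suc n" s s] unfolding s_def real_norm_def by blast
  qed
qed

lemma has_rs_integral_vec_uniform_sums: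
  assumes "has_rs_integral_vec x g 0 1 I"
  shows "(\<lambda>n. \<Sum>i<Suc n. x (i / Suc n) * (g (Suc i / Suc n) - g (i / Suc n))) \<longlonglongrightarrow> I"
proof (rule vec_tendstoI)
  fix j
  have "has_rs_integral (\<lambda>s. x s $ j) (\<lambda>s. g s $ j) 0 1 (I $ j)"
    using assms unfolding has_rs_integral_vec_def by blast
  from has_rs_integral_uniform_sums[OF this]
  show "(\<lambda>n. (\<Sum>i<Suc n. x (i / Suc n) * (g (Suc i / Suc n) - g (i / Suc n))) $ j) \<longlonglongrightarrow> I $ j"
    by (simp only: sum_component vector_mult_component vector_minus_component)
qed

text \<open>Without the cell at 0 the points stay away from the jump, so the increments sum to at
  most the variation over the interval from \<open>1 / (n + 1)\<close> to 1, which
  \<open>var0 g\<close> bounds independently of \<open>n\<close>.\<close>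

lemma norm_tail_sum_le:
  fixes g :: "real \<Rightarrow> real^'k"
  assumes bv: "bounded_variation_on g 0 1" and z: "\<And>i. norm (z i) \<le> B" and B: "0 \<le> B"
  shows "norm (\<Sum>i=1..<Suc n. z i * (g (Suc i / Suc n) - g (i / Suc n))) \<le> B * var0 g"
proof -
  define w where "w t = total_variation g t 1" for t
  define s where "s i = real i / real (Suc n)" for i
  have "norm (\<Sum>i=1..<Suc n. z i * (g (s (Suc i)) - g (s i))) \<le> (\<Sum>i=1..<Suc n. B * (- w (s (Suc i)) - - w (s i)))"
  proof (rule sum_norm_le)
    fix i assume i: "i \<in> {1..<Suc n}"
    have s: "0 \<le> s i" "s i \<le> s (Suc i)" "s (Suc i) \<le> 1"
      unfolding s_def using i by (auto simp: divide_right_mono simp del: of_nat_Suc)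
    have "norm (g (s (Suc i)) - g (s i)) \<le> w (s i) - w (s (Suc i))"
      using variation_increment[OF bv s] unfolding w_def .
    then have "norm (z i) * norm (g (s (Suc i)) - g (s i)) \<le> B * (w (s i) - w (s (Suc i)))"
      using z B by (intro mult_mono) auto
    then show "norm (z i * (g (s (Suc i)) - g (s i))) \<le> B * (- w (s (Suc i)) - - w (s i))"
      using norm_times_vec_le[of "z i" "g (s (Suc i)) - g (s i)"] by simp
  qed
  also have "\<dots> = B * (w (s 1) - w (s (Suc n)))"
    unfolding sum_distrib_left[symmetric] by (subst sum_Suc_diff') auto
  also have "\<dots> \<le> B * var0 g"
  proof (rule mult_left_mono[OF _ B])
    have "0 < s 1" "s 1 \<le> 1" "s (Suc n) = 1" unfolding s_def by auto
    then show "w (s 1) - w (s (Suc n)) \<le> var0 g"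
      using var0_upper[OF bv, of "s 1"] total_variation_1[OF bv] unfolding w_def by simp
  qed
  finally show ?thesis unfolding s_def .
qed

lemma has_rs_integral_vec_C1:
  fixes g x :: "real \<Rightarrow> real^'k"
  assumes bv: "bounded_variation_on g 0 1"
    and der: "\<And>t. t \<in> {0..1} \<Longrightarrow> (x has_vector_derivative x' t) (at t within {0..1})"
    and cont: "continuous_on {0..1} x'"
  shows "\<exists>I. has_rs_integral_vec x g 0 1 I"
proof -
  have "\<exists>I. has_rs_integral (\<lambda>s. x s $ j) (\<lambda>s. g s $ j) 0 1 I" for j
  proof (rule has_rs_integral_C1)
    \<comment> \<open>The negative tail variation serves as the monotone majorant for every
      coordinate.\<close>
    show "\<bar>g t $ j - g s $ j\<bar> \<le> - total_variation g t 1 - - total_variation g s 1"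
      if "0 \<le> s" "s \<le> t" "t \<le> 1" for s t
      using variation_increment[OF bv that] component_le_norm_cart[of "g t - g s" j] by simp
    show "((\<lambda>s. x s $ j) has_real_derivative x' t $ j) (at t within {0..1})" if "t \<in> {0..1}" for t
      unfolding has_real_derivative_iff_has_vector_derivative
      by (rule bounded_linear.has_vector_derivative[OF bounded_linear_vec_nth der[OF that]])
    show "continuous_on {0..1} (\<lambda>t. x' t $ j)" using cont by (intro continuous_intros)
  qed simp
  then obtain I where "\<And>j. has_rs_integral (\<lambda>s. x s $ j) (\<lambda>s. g s $ j) 0 1 (I j)" by metis
  then have "has_rs_integral_vec x g 0 1 (\<chi> j. I j)" unfolding has_rs_integral_vec_def by simp
  then show ?thesis ..
qed

context
  fixes f :: "real \<Rightarrow> real^'k \<Rightarrow> real^'k" and g :: "real \<Rightarrow> real^'k" and R :: real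
  assumes f_cont: "continuous_on ({0..1} \<times> UNIV) (\<lambda>(t, x). f t x)"
    and bv: "bounded_variation_on g 0 1"
    and R: "R > 0"
    and inward: "\<forall>t\<in>{0<..1}. \<forall>x. norm x = R \<longrightarrow> f t x \<bullet> x \<le> 0"
begin

text \<open>The term of index \<open>0\<close> of the Riemann--Stieltjes sum is left out: it tends to the initial value
  times the jump of \<open>g\<close> at \<open>0\<close>, which is treated separately.\<close>

definition tail_sum :: "nat \<Rightarrow> real^'k \<Rightarrow> real^'k" where
  "tail_sum n c = (\<Sum>i=1..<Suc n. delayed_solution (\<lambda>t x. f t (radial_proj R x)) n c (i / Suc n) *
     (g (Suc i / Suc n) - g (i / Suc n)))"

lemma proj_cont: "continuous_on ({0..1} \<times> UNIV) (\<lambda>(t, x). f t (radial_proj R x))"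
proof -
  have "continuous_on ({0..1} \<times> UNIV) (\<lambda>p :: real \<times> (real^'k). (fst p, radial_proj R (snd p)))"
    by (intro continuous_intros continuous_on_compose2[OF continuous_on_radial_proj[OF R, of UNIV]]) auto
  moreover have "(\<lambda>p :: real \<times> (real^'k). (fst p, radial_proj R (snd p))) ` ({0..1} \<times> UNIV) \<subseteq> {0..1} \<times> UNIV"
    by auto
  ultimately have "continuous_on ({0..1} \<times> UNIV)
      (\<lambda>p :: real \<times> (real^'k). (\<lambda>(t, x). f t x) (fst p, radial_proj R (snd p)))"
    by (rule continuous_on_compose2[OF f_cont])
  then show ?thesis by (simp add: case_prod_unfold)
qed

lemma proj_bound: "\<exists>M. \<forall>t\<in>{0..1}. \<forall>x. norm (f t (radial_proj R x)) \<le> M"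
proof -
  have "compact ((\<lambda>(t, x). f t x) ` ({0..1} \<times> cball 0 R))"
    by (intro compact_continuous_image continuous_on_subset[OF f_cont] compact_Times compact_Icc compact_cball) auto
  then obtain M where "\<forall>y\<in>(\<lambda>(t, x). f t x) ` ({0..1} \<times> cball 0 R). norm y \<le> M"
    using compact_imp_bounded bounded_iff by blast
  then show ?thesis using radial_proj(1)[OF R] by (intro exI[of _ M]) fastforce
qed

lemma tail_sum_continuous: "continuous_on UNIV (tail_sum n)"
proof -
  obtain M where M: "\<And>t x. t \<in> {0..1} \<Longrightarrow> norm (f t (radial_proj R x)) \<le> M" using proj_bound by blast
  show ?thesis
    unfolding tail_sum_def[abs_def]
    by (intro continuous_on_sum continuous_on_times_vec continuous_on_const delayed_solution_continuous[OF proj_cont M])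
      (auto simp: divide_le_eq_1)
qed

text \<open>The compactness step: along one subsequence the initial values, the parameters and the
  sums all converge, and the limit is expressed by a true solution and its integral. It holds for
  varying \<open>c n\<close> and \<open>l n\<close>, as needed to exclude zeros for all parameters
  at once.\<close>

lemma tail_sum_limit:
  assumes c: "\<And>n. norm (c n) \<le> R" and l: "\<And>n. l n \<in> {0..1::real}"
  obtains r x I l0 where "strict_mono (r :: nat \<Rightarrow> nat)" "(\<lambda>n. c (r n)) \<longlonglongrightarrow> x 0" "(\<lambda>n. l (r n)) \<longlonglongrightarrow> l0"
    "\<And>t. t \<in> {0..1} \<Longrightarrow> (x has_vector_derivative f t (x t)) (at t within {0..1})"
    "continuous_on {0..1} (\<lambda>t. f t (x t))"
    "has_rs_integral_vec x g 0 1 I" "norm (I - x 0 * jump0 g) \<le> R * var0 g"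
    "(\<lambda>n. c (r n) * jump0 g + l (r n) *\<^sub>R tail_sum (r n) (c (r n))) \<longlonglongrightarrow>
      x 0 * jump0 g + l0 *\<^sub>R (I - x 0 * jump0 g)"
proof -
  obtain M where M: "\<And>t x. t \<in> {0..1} \<Longrightarrow> norm (f t (radial_proj R x)) \<le> M" using proj_bound by blast
  let ?F = "\<lambda>t x. f t (radial_proj R x)"
  obtain x k where k: "strict_mono (k :: nat \<Rightarrow> nat)" and x: "continuous_on {0..1} x"
    and unif: "\<And>e. e > 0 \<Longrightarrow> \<exists>N. \<forall>n\<ge>N. \<forall>t\<in>{0..1}. norm (delayed_solution ?F (k n) (c (k n)) t - x t) < e"
    and der: "\<And>t. t \<in> {0..1} \<Longrightarrow> (x has_vector_derivative ?F t (x t)) (at t within {0..1})"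
    by (rule delayed_solution_limit[where c = c, OF proj_cont M c]) (assumption | blast)+
  have "\<forall>n. l (k n) \<in> {0..1}" using l by blast
  then obtain l0 k2 where k2: "strict_mono (k2 :: nat \<Rightarrow> nat)" and l0: "((\<lambda>n. l (k n)) \<circ> k2) \<longlonglongrightarrow> l0"
    by (rule seq_compactE[OF compact_imp_seq_compact[OF compact_Icc]])
  define r where "r n = k (k2 n)" for n
  have r: "strict_mono r" using strict_mono_compose[OF k k2] unfolding r_def .
  have unif_r: "\<exists>N. \<forall>n\<ge>N. \<forall>t\<in>{0..1}. norm (delayed_solution ?F (r n) (c (r n)) t - x t) < e" if e: "e > 0" for e
  proof -
    obtain N where N: "\<forall>n\<ge>N. \<forall>t\<in>{0..1}. norm (delayed_solution ?F (k n) (c (k n)) t - x t) < e"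
      using unif[OF e] by blast
    have "N \<le> k2 n" if "N \<le> n" for n using seq_suble[OF k2, of n] that by simp
    then show ?thesis using N unfolding r_def by (intro exI[of _ N]) simp
  qed
  have c_lim: "(\<lambda>n. c (r n)) \<longlonglongrightarrow> x 0"
  proof (rule LIMSEQ_I)
    fix e :: real assume "e > 0"
    then obtain N where N: "\<forall>n\<ge>N. \<forall>t\<in>{0..1}. norm (delayed_solution ?F (r n) (c (r n)) t - x t) < e"
      using unif_r by blast
    have "norm (c (r n) - x 0) < e" if "n \<ge> N" for n
      using N[rule_format, OF that, of 0] by (simp add: delayed_solution_0)
    then show "\<exists>N. \<forall>n\<ge>N. norm (c (r n) - x 0) < e" by blast
  qed
  have x0: "norm (x 0) \<le> R"
    using LIMSEQ_le_const2[OF tendsto_norm[OF c_lim]] c by blast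
  \<comment> \<open>The limit solves the projected equation and stays in the ball, where the
    projection is the identity.\<close>
  have x_ball: "norm (x t) \<le> R" if "t \<in> {0..1}" for t
    by (rule solution_in_cball[where f = f and x = x, OF der inward[rule_format] R x0 that])
  have der_f: "(x has_vector_derivative f t (x t)) (at t within {0..1})" if "t \<in> {0..1}" for t
    using der[OF that] radial_proj(2)[OF R x_ball[OF that]] by simp
  have cont_f: "continuous_on {0..1} (\<lambda>t. f t (x t))"
    using continuous_on_compose2[OF f_cont continuous_on_Pair[OF continuous_on_id x]] by auto
  obtain I where I: "has_rs_integral_vec x g 0 1 I"
    using has_rs_integral_vec_C1[OF bv der_f cont_f] by blast
  \<comment> \<open>The tail sums of the limit \<open>x\<close> itself: the full sums tend to
    \<open>I\<close>, the first summand to \<open>x 0 * jump0 g\<close>.\<close>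
  define T where "T n = (\<Sum>i=1..<Suc n. x (i / Suc n) * (g (Suc i / Suc n) - g (i / Suc n)))" for n
  have T_lim: "T \<longlonglongrightarrow> I - x 0 * jump0 g"
  proof -
    have split: "(\<Sum>i<Suc n. x (i / Suc n) * (g (Suc i / Suc n) - g (i / Suc n)))
      = x 0 * (g (1 / Suc n) - g 0) + T n" for n
      unfolding T_def lessThan_atLeast0 by (subst sum.atLeast_Suc_lessThan) auto
    have "filterlim (\<lambda>n. 1 / real (Suc n)) (at_right 0) sequentially"
      unfolding filterlim_at
      using LIMSEQ_inverse_real_of_nat by (auto simp: inverse_eq_divide)
    from filterlim_compose[OF jump0_tendsto[OF bv] this]
    have "(\<lambda>n. x 0 * (g (1 / Suc n) - g 0)) \<longlonglongrightarrow> x 0 * jump0 g"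
      by (intro tendsto_times_vec tendsto_const)
    from tendsto_diff[OF has_rs_integral_vec_uniform_sums[OF I] this] show ?thesis
      unfolding split by simp
  qed
  have T_bound: "norm (T n) \<le> R * var0 g" for n
  proof -
    \<comment> \<open>\<open>norm_tail_sum_le\<close> wants a bound for every index, so the values
      beyond time 1 are replaced by 0.\<close>
    have "T n = (\<Sum>i=1..<Suc n. (if i \<le> Suc n then x (i / Suc n) else 0) * (g (Suc i / Suc n) - g (i / Suc n)))"
      unfolding T_def by (intro sum.cong) auto
    also have "norm \<dots> \<le> R * var0 g"
      using R by (intro norm_tail_sum_le[OF bv]) (auto intro!: x_ball simp: divide_le_eq_1 simp del: of_nat_Suc)
    finally show ?thesis .
  qed
  have v0: "var0 g \<ge> 0"
    using var0_upper[OF bv, of 1] total_variation_1[OF bv] by simp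
  \<comment> \<open>The difference is a tail sum with uniformly small factors, so the same variation
    bound applies.\<close>
  have diff: "(\<lambda>n. tail_sum (r n) (c (r n)) - T (r n)) \<longlonglongrightarrow> 0"
  proof (rule LIMSEQ_I)
    fix e :: real assume e: "e > 0"
    define d where "d = e / (2 * (var0 g + 1))"
    have d: "d > 0" unfolding d_def using e v0 by simp
    obtain N where N: "\<And>n t. n \<ge> N \<Longrightarrow> t \<in> {0..1} \<Longrightarrow> norm (delayed_solution ?F (r n) (c (r n)) t - x t) < d"
      using unif_r[OF d] by blast
    have "norm (tail_sum (r n) (c (r n)) - T (r n)) < e" if "n \<ge> N" for n
    proof -
      define z where "z i = (if i \<le> Suc (r n) then delayed_solution ?F (r n) (c (r n)) (i / Suc (r n)) - x (i / Suc (r n)) else 0)" for i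
      have "tail_sum (r n) (c (r n)) - T (r n) = (\<Sum>i=1..<Suc (r n). z i * (g (Suc i / Suc (r n)) - g (i / Suc (r n))))"
        unfolding tail_sum_def T_def sum_subtractf[symmetric] by (intro sum.cong) (auto simp: z_def left_diff_distrib)
      also have "norm \<dots> \<le> d * var0 g"
        using d by (intro norm_tail_sum_le[OF bv])
          (auto simp: z_def divide_le_eq_1 simp del: of_nat_Suc intro!: less_imp_le[OF N[OF that]])
      also have "\<dots> \<le> d * (var0 g + 1)" using d by simp
      also have "\<dots> = e / 2" unfolding d_def using v0 by (simp add: field_simps)
      also have "\<dots> < e" using e by simp
      finally show ?thesis .
    qed
    then show "\<exists>N. \<forall>n\<ge>N. norm (tail_sum (r n) (c (r n)) - T (r n) - 0) < e" by auto
  qed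
  have "(\<lambda>n. T (r n)) \<longlonglongrightarrow> I - x 0 * jump0 g"
    using LIMSEQ_subseq_LIMSEQ[OF T_lim r] by (simp add: comp_def)
  from tendsto_add[OF diff this]
  have tail_lim: "(\<lambda>n. tail_sum (r n) (c (r n))) \<longlonglongrightarrow> I - x 0 * jump0 g" by simp
  have l_lim: "(\<lambda>n. l (r n)) \<longlonglongrightarrow> l0" using l0 unfolding r_def comp_def .
  show thesis
  proof (rule that[OF r c_lim l_lim der_f cont_f I])
    show "norm (I - x 0 * jump0 g) \<le> R * var0 g"
      using LIMSEQ_le_const2[OF tendsto_norm[OF T_lim]] T_bound by blast
    show "(\<lambda>n. c (r n) * jump0 g + l (r n) *\<^sub>R tail_sum (r n) (c (r n))) \<longlonglongrightarrow>
      x 0 * jump0 g + l0 *\<^sub>R (I - x 0 * jump0 g)"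
      by (intro tendsto_add tendsto_times_vec tendsto_scaleR c_lim l_lim tail_lim tendsto_const)
  qed
qed

end

theorem theorem3:
  fixes f :: "real \<Rightarrow> real^'k \<Rightarrow> real^'k"
    and g :: "real \<Rightarrow> real^'k"
    and h :: "real^'k \<Rightarrow> real^'k"
    and R r_minus r_plus :: real
  assumes "continuous_on ({0..1} \<times> UNIV) (\<lambda>(t, x). f t x)"
    and "bounded_variation_on g 0 1"
    and "continuous_on UNIV h"
    and "Lim (at_right 0) g \<noteq> g 0"
    and "var0 g \<le> (MIN j. \<bar>jump0 g $ j\<bar>)"
    and "R > 0"
    and "\<And>t x. t \<in> {0<..1} \<Longrightarrow> norm x = R \<Longrightarrow> f t x \<bullet> x \<le> 0"
    and "r_minus = R * ((MIN j. \<bar>jump0 g $ j\<bar>) - var0 g)"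
    and "r_plus = R * (norm (jump0 g) + var0 g)"
    and "\<And>x. r_minus < norm x \<Longrightarrow> norm x \<le> r_plus \<Longrightarrow> h x \<noteq> 0"
    and "\<exists>r\<in>{r_minus<..r_plus}.
           brouwer_degree_defined h (ball 0 r) 0 \<and> brouwer_degree h (ball 0 r) 0 \<noteq> 0"
  shows "\<exists>x x' I.
           (\<forall>t\<in>{0..1}. (x has_vector_derivative x' t) (at t within {0..1})) \<and>
           continuous_on {0..1} x' \<and>
           (\<forall>t\<in>{0..1}. x' t = f t (x t)) \<and>
           has_rs_integral_vec x g 0 1 I \<and> h I = 0"
proof (rule ccontr)
  note f_cont = assms(1) and bv = assms(2) and h = assms(3) and R = assms(6) and h_nz = assms(10)
  have inward: "\<forall>t\<in>{0<..1}. \<forall>x. norm x = R \<longrightarrow> f t x \<bullet> x \<le> 0" using assms(7) by blast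
  assume no_solution: "\<not> ?thesis"
  have unsolvable: "h I \<noteq> 0"
    if "\<And>t. t \<in> {0..1} \<Longrightarrow> (x has_vector_derivative f t (x t)) (at t within {0..1})"
      "continuous_on {0..1} (\<lambda>t. f t (x t))" "has_rs_integral_vec x g 0 1 I" for x I
  proof
    assume "h I = 0"
    with no_solution[unfolded not_ex, rule_format, of x "\<lambda>t. f t (x t)" I] that
    show False by blast
  qed
  define m where "m = (MIN j. \<bar>jump0 g $ j\<bar>)"
  define v where "v = var0 g"
  define J where "J = jump0 g"
  have m_le: "m \<le> \<bar>J $ j\<bar>" for j unfolding m_def J_def by (rule Min_le) auto
  have v0: "0 \<le> v"
    using var0_upper[OF bv, of 1] total_variation_1[OF bv] unfolding v_def by simp
  have vm: "v \<le> m" using assms(5) unfolding v_def m_def .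
  have rm: "r_minus = R * (m - v)" and rp: "r_plus = R * (norm J + v)"
    using assms(8,9) unfolding v_def m_def J_def by auto
  have rm0: "r_minus \<ge> 0" unfolding rm using R vm by simp
  obtain r where r: "r_minus < r" "r \<le> r_plus" and deg: "brouwer_degree h (ball 0 r) 0 \<noteq> 0"
    using assms(11) by auto
  have r0: "r > 0" using r rm0 by simp
  have h_on: "continuous_on S h" for S using h continuous_on_subset by blast
  \<comment> \<open>The contradiction aimed at in both cases: a zero-free extension from the sphere
    would make the degree 0.\<close>
  have no_extension: False
    if "continuous_on (cball 0 r) k" "\<And>x. x \<in> cball 0 r \<Longrightarrow> k x \<noteq> 0" "\<And>x. norm x = r \<Longrightarrow> k x = h x" for k
    using brouwer_degree_eq_0[OF r0 h_on that] deg by simp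
  let ?S = "tail_sum f g R"
  define P where "P n c l = c * J + l *\<^sub>R ?S n c" for n c l
  note limit = tail_sum_limit[OF f_cont bv R inward, folded J_def v_def, folded P_def]
  show False
  proof (cases "m = 0")
    case True
    then have "v = 0" "r_minus = 0" using v0 vm rm by auto
    \<comment> \<open>Otherwise \<open>h\<close> has no zero in the whole ball of radius
      \<open>r\<close> and is itself a forbidden extension.\<close>
    have h0: "h 0 = 0"
    proof (rule ccontr)
      assume "h 0 \<noteq> 0"
      then have "h x \<noteq> 0" if "x \<in> cball 0 r" for x
        using h_nz[of x] that r(2) \<open>r_minus = 0\<close> by (cases "x = 0") auto
      then show False by (rule no_extension[OF h_on _ refl])
    qed
    have "norm (0 :: real^'k) \<le> R" "1 \<in> {0..1::real}" using R by auto
    \<comment> \<open>With initial values 0 the limit solution starts at 0, and the bound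
      \<open>R * v = 0\<close> forces its integral to be 0, a zero of \<open>h\<close>.\<close>
    then obtain s x I l0 where "(\<lambda>n::nat. 0 :: real^'k) \<longlonglongrightarrow> x 0"
      and sol: "\<And>t. t \<in> {0..1} \<Longrightarrow> (x has_vector_derivative f t (x t)) (at t within {0..1})"
        "continuous_on {0..1} (\<lambda>t. f t (x t))" "has_rs_integral_vec x g 0 1 I"
      and I: "norm (I - x 0 * J) \<le> R * v"
      by (rule limit[of "\<lambda>_. 0" "\<lambda>_. 1"]) blast
    then have "x 0 = 0" by (simp add: LIMSEQ_const_iff)
    then have "I = 0" using I \<open>v = 0\<close> by simp
    then show False using unsolvable[OF sol] h0 by simp
  next
    case False
    then have m0: "m > 0" using v0 vm by simp
    have J_nz: "J $ j \<noteq> 0" for j using m_le[of j] m0 by auto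
    \<comment> \<open>The ball at parameter 1 is for the extension, the sphere with all parameters
      for the homotopy; a single \<open>n\<close> must serve both.\<close>
    define K where "K = cball (0::real^'k) R \<times> {1} \<union> sphere 0 R \<times> {0..1::real}"
    have "closed K" unfolding K_def by (intro closed_Un closed_Times closed_cball closed_sphere) auto
    have "\<exists>n. \<forall>(c, l)\<in>K. h (P n c l) \<noteq> 0"
    proof (rule ccontr)
      assume "\<not> ?thesis"
      then have "\<forall>n. \<exists>p. p \<in> K \<and> h (P n (fst p) (snd p)) = 0" by fastforce
      from choice[OF this] obtain p where p: "\<And>n. p n \<in> K" "\<And>n. h (P n (fst (p n)) (snd (p n))) = 0" by blast
      have "norm (fst (p n)) \<le> R" "snd (p n) \<in> {0..1}" for n using p(1)[of n] unfolding K_def by auto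
      then obtain s x I l0 where lim: "(\<lambda>n. fst (p (s n))) \<longlonglongrightarrow> x 0" "(\<lambda>n. snd (p (s n))) \<longlonglongrightarrow> l0"
        and sol: "\<And>t. t \<in> {0..1} \<Longrightarrow> (x has_vector_derivative f t (x t)) (at t within {0..1})"
          "continuous_on {0..1} (\<lambda>t. f t (x t))" "has_rs_integral_vec x g 0 1 I"
        and I: "norm (I - x 0 * J) \<le> R * v"
        and P_lim: "(\<lambda>n. P (s n) (fst (p (s n))) (snd (p (s n)))) \<longlonglongrightarrow> x 0 * J + l0 *\<^sub>R (I - x 0 * J)"
        by (rule limit[of "\<lambda>n. fst (p n)" "\<lambda>n. snd (p n)"]) blast
      define z where "z = x 0 * J + l0 *\<^sub>R (I - x 0 * J)"
      have "(\<lambda>n. p (s n)) \<longlonglongrightarrow> (x 0, l0)" using tendsto_Pair[OF lim] by simp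
      from closed_sequentially[OF \<open>closed K\<close> p(1) this] have inK: "(x 0, l0) \<in> K" .
      have "isCont h z" using h by (simp add: continuous_on_eq_continuous_at)
      from isCont_tendsto_compose[OF this P_lim[folded z_def]]
      have hz: "h z = 0" unfolding p(2) by (simp add: LIMSEQ_const_iff)
      have hI: "h I \<noteq> 0" by (rule unsolvable[OF sol])
      \<comment> \<open>At parameter 1 the limit point is the integral of a solution.\<close>
      have "l0 \<noteq> 1"
      proof
        assume "l0 = 1"
        then have "z = I" unfolding z_def by simp
        then show False using hz hI by simp
      qed
      with inK have x0: "norm (x 0) = R" and l0: "0 \<le> l0" "l0 < 1" unfolding K_def by auto
      have "v \<noteq> 0"
      proof
        assume "v = 0"
        then have "z = I" unfolding z_def using I by simp
        then show False using hz hI by simp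
      qed
      then have v_pos: "v > 0" using v0 by simp
      have tail: "norm (l0 *\<^sub>R (I - x 0 * J)) \<le> l0 * (R * v)"
        using I l0 by (simp add: mult_left_mono)
      \<comment> \<open>This strict inequality puts \<open>z\<close> beyond \<open>r_minus\<close>,
        where \<open>h\<close> is known not to vanish.\<close>
      have "l0 * (R * v) < R * v" using l0 R v_pos by simp
      moreover have "R * m \<le> norm (x 0 * J)"
        using norm_times_vec_ge[OF m_le, of "x 0"] m0 x0 by simp
      moreover have "norm (x 0 * J) \<le> R * norm J"
        using norm_times_vec_le[of "x 0" J] x0 by simp
      moreover have "norm z \<ge> norm (x 0 * J) - norm (l0 *\<^sub>R (I - x 0 * J))"
        "norm z \<le> norm (x 0 * J) + norm (l0 *\<^sub>R (I - x 0 * J))"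
        unfolding z_def using norm_diff_ineq norm_triangle_ineq by blast+
      ultimately have "r_minus < norm z" "norm z \<le> r_plus"
        using tail unfolding rm rp right_diff_distrib distrib_left by linarith+
      then show False using h_nz hz by blast
    qed
    then obtain n where n: "\<And>c l. (c, l) \<in> K \<Longrightarrow> h (P n c l) \<noteq> 0" by blast
    have P_cont: "continuous_on S (\<lambda>p. P n (snd p) (fst p))" for S
      unfolding P_def
      by (intro continuous_intros continuous_on_times_vec continuous_on_compose2[OF tail_sum_continuous[OF f_cont bv R inward]]) auto
    have hom1: "homotopic_with_canon (\<lambda>_. True) (sphere 0 R) (- {0}) (\<lambda>c. h (c * J)) (\<lambda>c. h (P n c 1))"
    proof (rule homotopic_with_canonI)
      show "continuous_on ({0..1} \<times> sphere 0 R) (\<lambda>p. h (P n (snd p) (fst p)))"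
        by (rule continuous_on_compose2[OF h P_cont]) auto
      show "(\<lambda>p. h (P n (snd p) (fst p))) ` ({0..1} \<times> sphere 0 R) \<subseteq> - {0}"
        using n unfolding K_def by auto
    qed (simp_all add: P_def)
    \<comment> \<open>A zero-free map on the whole ball makes its restriction to the sphere
      nullhomotopic.\<close>
    have "continuous_on (cball 0 R) (\<lambda>c. h (P n c 1))"
      using continuous_on_compose2[OF h continuous_on_compose2[OF P_cont[of UNIV] continuous_on_Pair[OF continuous_on_const[of _ 1] continuous_on_id]]]
      by auto
    moreover have "(\<lambda>c. h (P n c 1)) ` cball 0 R \<subseteq> - {0}" using n unfolding K_def by auto
    ultimately have "\<exists>a. homotopic_with_canon (\<lambda>_. True) (sphere 0 R) (- {0}) (\<lambda>c. h (P n c 1)) (\<lambda>_. a)"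
      unfolding nullhomotopic_from_sphere_extension by blast
    then obtain a where "homotopic_with_canon (\<lambda>_. True) (sphere 0 R) (- {0}) (\<lambda>c. h (P n c 1)) (\<lambda>_. a)" ..
    from homotopic_with_trans[OF hom1 this]
    have hom2: "homotopic_with_canon (\<lambda>_. True) (sphere 0 R) (- {0}) (\<lambda>c. h (c * J)) (\<lambda>_. a)" .
    \<comment> \<open>\<open>E\<close> inverts the map multiplying by \<open>J\<close>, and
      \<open>q\<close> rescales it to the sphere of radius \<open>R\<close>, so that
      \<open>q y * J\<close> is a positive multiple of \<open>y\<close>.\<close>
    define E where "E y = y * (\<chi> j. 1 / J $ j)" for y :: "real^'k"
    have EJ: "E y * J = y" for y unfolding E_def using J_nz by (simp add: vec_eq_iff)
    have E_nz: "E y \<noteq> 0" if "norm y = r" for y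
    proof
      assume "E y = 0"
      then have "y = 0" using EJ[of y] by simp
      then show False using that r0 by simp
    qed
    have E_cont: "continuous_on S E" for S
      unfolding E_def[abs_def] by (intro continuous_on_times_vec continuous_on_id continuous_on_const)
    define q where "q y = (R / norm (E y)) *\<^sub>R E y" for y
    have q_sphere: "norm (q y) = R" if "norm y = r" for y using E_nz[OF that] R unfolding q_def by simp
    have qJ: "q y * J = (R / norm (E y)) *\<^sub>R y" for y
    proof -
      have "q y * J = (R / norm (E y)) *\<^sub>R (E y * J)" unfolding q_def by (simp add: vec_eq_iff)
      then show ?thesis unfolding EJ .
    qed
    have "continuous_on (sphere 0 r) q"
      unfolding q_def[abs_def] using E_nz by (intro continuous_intros E_cont) auto
    moreover have "q \<in> sphere 0 r \<rightarrow> sphere 0 R" using q_sphere by auto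
    ultimately have "homotopic_with_canon (\<lambda>_. True) (sphere 0 r) (- {0}) ((\<lambda>c. h (c * J)) \<circ> q) ((\<lambda>_. a) \<circ> q)"
      using hom2 by (intro homotopic_with_compose_continuous_right) auto
    then have hom3: "homotopic_with_canon (\<lambda>_. True) (sphere 0 r) (- {0}) (\<lambda>y. h (q y * J)) (\<lambda>_. a)"
      by (simp add: comp_def)
    \<comment> \<open>Moves \<open>y\<close> along its ray to \<open>q y * J\<close>; the norm is a
      convex combination of those of the endpoints, which keeps it in the annulus for times below
      1.\<close>
    define H where "H p = h ((1 - fst p + fst p * (R / norm (E (snd p)))) *\<^sub>R snd p)" for p :: "real \<times> (real^'k)"
    have hom4: "homotopic_with_canon (\<lambda>_. True) (sphere 0 r) (- {0}) h (\<lambda>y. h (q y * J))"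
    proof (rule homotopic_with_canonI[of _ H])
      show "continuous_on ({0..1} \<times> sphere 0 r) H"
        unfolding H_def[abs_def]
        by (intro continuous_on_compose2[OF h] continuous_intros continuous_on_compose2[OF E_cont[of UNIV]])
          (use E_nz in auto)
      show "H ` ({0..1} \<times> sphere 0 r) \<subseteq> - {0}"
      proof clarsimp
        fix t :: real and y :: "real^'k" assume t: "0 \<le> t" "t \<le> 1" and r_def: "r = norm y" and zero: "H (t, y) = 0"
        have y: "norm y = r" using r_def by simp
        define s where "s = R / norm (E y)"
        have s0: "s > 0" unfolding s_def using R E_nz[OF y] by simp
        have "norm (q y * J) = s * r" unfolding qJ s_def[symmetric] using s0 y by simp
        then have sr: "R * m \<le> s * r" "s * r \<le> R * norm J"
          using norm_times_vec_ge[OF m_le, of "q y"] norm_times_vec_le[of "q y" J] m0 q_sphere[OF y] by auto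
        have Rm: "r_minus \<le> R * m" "R * norm J \<le> r_plus" unfolding rm rp using R v0 by auto
        show False
        proof (cases "t = 1")
          \<comment> \<open>At the end of the path the norm may equal \<open>r_minus\<close>,
            outside the annulus; there the choice of \<open>n\<close> at parameter 0 excludes a
            zero.\<close>
          case True
          then have "H (t, y) = h (P n (q y) 0)" unfolding H_def P_def qJ by simp
          then show False using n[of "q y" 0] zero q_sphere[OF y] unfolding K_def by simp
        next
          case False
          have nonneg: "0 \<le> 1 - t + t * s" using t s0 by simp
          have eq: "norm ((1 - t + t * s) *\<^sub>R y) = (1 - t) * r + t * (s * r)"
            unfolding norm_scaleR y abs_of_nonneg[OF nonneg] by (simp add: algebra_simps)
          have "(1 - t) * r_minus < (1 - t) * r" "t * r_minus \<le> t * (s * r)"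
            using False t r(1) sr(1) Rm(1) by (auto intro!: mult_left_mono)
          moreover have "(1 - t) * r \<le> (1 - t) * r_plus" "t * (s * r) \<le> t * r_plus"
            using t r(2) sr(2) Rm(2) by (auto intro!: mult_left_mono)
          ultimately have "r_minus < norm ((1 - t + t * s) *\<^sub>R y)" "norm ((1 - t + t * s) *\<^sub>R y) \<le> r_plus"
            unfolding eq by (simp_all add: algebra_simps)
          from h_nz[OF this] show False using zero unfolding H_def s_def by simp
        qed
      qed
    qed (simp_all add: H_def qJ)
    have "\<exists>a. homotopic_with_canon (\<lambda>_. True) (sphere 0 r) (- {0}) h (\<lambda>_. a)"
      using homotopic_with_trans[OF hom4 hom3] by blast
    then obtain k where "continuous_on (cball 0 r) k" "k ` cball 0 r \<subseteq> - {0}" "\<forall>x\<in>sphere 0 r. k x = h x"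
      unfolding nullhomotopic_from_sphere_extension by blast
    then show False by (intro no_extension[of k]) force+
  qed
qed

end
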